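(* Let $k$ be a standard valued field that is algebraically closed (its valuation may be trivial), let $K \supseteq k$ and $L \supseteq k$ be extensions of standard valued fields, and let $A = K \otimes_k L$. For $z \in A$ put $$\|z\| = \inf_{z = \sum_i x_i \otimes y_i} \ \max_i |x_i|\,|y_i| \in \mathbf{R}^{\geq 0},$$ the infimum being over all finite presentations $z = \sum_i x_i \otimes y_i$ with $x_i \in K$, $y_i \in L$. Then the tensor semi-norm $\|\cdot\|$ on $A$ is multiplicative, i.e. $\|zz'\| = \|z\|\,\|z'\|$ for all $z,z' \in A$, and it extends to a standard valuation on the fraction field $F = \operatorname{Frac}(A/\ker\|\cdot\|)$, where $\ker\|\cdot\| = \{z \in A : \|z\| = 0\}$. This renders $F$ an extension (as a standard valued field) of both $K$ and $L$, via $x \mapsto x \otimes 1$ and $y \mapsto 1 \otimes y$.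
   Context: A valued field is a pair $(k,O)$ where $k$ is a field and $O \subseteq k$ is a subring (the valuation ring) with $k = O \cup (O\setminus\{0\})^{-1}$. Its value group is $\Gamma^k = k^\times/O^\times$ (written multiplicatively), $|\cdot| \colon k^\times \to \Gamma^k$ is the quotient map, a formal symbol $0 = |0|$ is added, and $\Gamma^k \cup \{0\}$ is ordered by $|a| \leq |b| \iff a \in bO$. A standard valued field is a valued field together with an embedding of ordered groups $(\Gamma^k,\cdot,<) \to (\mathbf{R}^{>0},\cdot,<)$; thus $|\cdot|$ may be regarded as a non-Archimedean multiplicative absolute value $k \to \mathbf{R}^{\geq 0}$ (satisfying $|a+b| \le \max(|a|,|b|)$), and a standard valuation is such a map. The trivial valuation ($O = k$) is allowed. An embedding (extension) of valued fields must respect the valuation ring in both directions, hence induces an embedding of value groups; an embedding (extension) of standard valued fields must moreover respect the embeddings of the value groups in the reals, i.e. it preserves the real-valued $|\cdot|$. *)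

theory Defs
  imports
    Complex_Main
    "HOL-Algebra.QuotRing"
    "HOL-Algebra.Generated_Groups"
    "HOL-Algebra.Free_Abelian_Groups"
    "HOL-Algebra.Algebraic_Closure_Type"
begin

text \<open>
  A standard valuation is the real-valued form of a valuation ring together with an ordered embedding
  of the value group in the positive reals: the ring is the set of \<open>x\<close> with \<open>v x \<le> 1\<close>. The trivial
  valuation is allowed, and \<open>v \<one> = 1\<close> follows. Nothing is required of \<open>v\<close> outside the carrier.
\<close>

locale standard_valued_field = field R for R (structure) +
  fixes v :: "'a \<Rightarrow> real"
  assumes val_nonneg: "x \<in> carrier R \<Longrightarrow> 0 \<le> v x"
    and val_eq_0_iff: "x \<in> carrier R \<Longrightarrow> v x = 0 \<longleftrightarrow> x = \<zero>"
    and val_mult: "x \<in> carrier R \<Longrightarrow> y \<in> carrier R \<Longrightarrow> v (x \<otimes> y) = v x * v y"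
    and val_add: "x \<in> carrier R \<Longrightarrow> y \<in> carrier R \<Longrightarrow> v (x \<oplus> y) \<le> max (v x) (v y)"

definition standard_extension ::
    "('a \<Rightarrow> 'b) \<Rightarrow> ('a, 'm) ring_scheme \<Rightarrow> ('a \<Rightarrow> real) \<Rightarrow> ('b, 'n) ring_scheme \<Rightarrow> ('b \<Rightarrow> real) \<Rightarrow> bool" where
  "standard_extension h R v S w \<longleftrightarrow>
     standard_valued_field R v \<and> standard_valued_field S w \<and>
     h \<in> ring_hom R S \<and> (\<forall>x\<in>carrier R. w (h x) = v x)"

text \<open>
  The algebras are given by structure maps \<open>i\<close> and \<open>j\<close> on a common type of scalars. Their tensor
  product is the free abelian group on pairs modulo the subgroup generated by the bilinearity
  relations, with the multiplication extended biadditively from the componentwise product of pairs. The third kind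
  of relation (moving a scalar across) together with biadditivity gives full bilinearity over the
  scalars.
\<close>

definition pair_ring :: "('a::comm_ring_1 \<times> 'b::comm_ring_1 \<Rightarrow>\<^sub>0 int) ring" where
  "pair_ring =
     \<lparr> carrier = UNIV,
       monoid.mult = (\<lambda>f g.
          frag_extend (\<lambda>(x, y). frag_extend (\<lambda>(x', y'). frag_of (x * x', y * y')) g) f),
       one = frag_of (1, 1),
       zero = 0,
       add = (+) \<rparr>"

definition tensor_relations ::
    "('k \<Rightarrow> 'a::comm_ring_1) \<Rightarrow> ('k \<Rightarrow> 'b::comm_ring_1) \<Rightarrow> ('a \<times> 'b \<Rightarrow>\<^sub>0 int) set" where
  "tensor_relations i j =
     {frag_of (x + x', y) - frag_of (x, y) - frag_of (x', y) | x x' y. True} \<union>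
     {frag_of (x, y + y') - frag_of (x, y) - frag_of (x, y') | x y y'. True} \<union>
     {frag_of (i c * x, y) - frag_of (x, j c * y) | c x y. True}"

definition tensor_subgroup ::
    "('k \<Rightarrow> 'a::comm_ring_1) \<Rightarrow> ('k \<Rightarrow> 'b::comm_ring_1) \<Rightarrow> ('a \<times> 'b \<Rightarrow>\<^sub>0 int) set" where
  "tensor_subgroup i j = generate (add_monoid pair_ring) (tensor_relations i j)"

definition tensor_ring ::
    "('k \<Rightarrow> 'a::comm_ring_1) \<Rightarrow> ('k \<Rightarrow> 'b::comm_ring_1) \<Rightarrow> ('a \<times> 'b \<Rightarrow>\<^sub>0 int) set ring" where
  "tensor_ring i j = pair_ring Quot tensor_subgroup i j"

definition pure_tensor ::
    "('k \<Rightarrow> 'a::comm_ring_1) \<Rightarrow> ('k \<Rightarrow> 'b::comm_ring_1) \<Rightarrow> 'a \<Rightarrow> 'b \<Rightarrow> ('a \<times> 'b \<Rightarrow>\<^sub>0 int) set" where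
  "pure_tensor i j x y = tensor_subgroup i j +>\<^bsub>pair_ring\<^esub> frag_of (x, y)"

text \<open>
  Only presentations with at least one term are used, so that \<open>Max\<close> is taken over a nonempty set;
  the zero tensor has the presentation \<open>0 \<otimes> 0\<close>.
\<close>

definition tensor_seminorm ::
    "('k \<Rightarrow> 'a::comm_ring_1) \<Rightarrow> ('k \<Rightarrow> 'b::comm_ring_1) \<Rightarrow> ('a \<Rightarrow> real) \<Rightarrow> ('b \<Rightarrow> real) \<Rightarrow>
     ('a \<times> 'b \<Rightarrow>\<^sub>0 int) set \<Rightarrow> real" where
  "tensor_seminorm i j v w z =
     Inf {Max ((\<lambda>m. v (x m) * w (y m)) ` {..<n}) | (n::nat) x y.
            0 < n \<and> z = (\<Oplus>\<^bsub>tensor_ring i j\<^esub>m\<in>{..<n}. pure_tensor i j (x m) (y m))}"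

definition tensor_kernel ::
    "('k \<Rightarrow> 'a::comm_ring_1) \<Rightarrow> ('k \<Rightarrow> 'b::comm_ring_1) \<Rightarrow> ('a \<Rightarrow> real) \<Rightarrow> ('b \<Rightarrow> real) \<Rightarrow>
     ('a \<times> 'b \<Rightarrow>\<^sub>0 int) set set" where
  "tensor_kernel i j v w = {z \<in> carrier (tensor_ring i j). tensor_seminorm i j v w z = 0}"

text \<open>
  \<open>fraction R a b\<close> is the equivalence class of pairs representing \<open>a / b\<close>, for a domain \<open>R\<close> and a
  nonzero \<open>b\<close>. The unions in the operations collapse to single classes since the operations are
  compatible with the equivalence.
\<close>

definition fraction :: "('a, 'm) ring_scheme \<Rightarrow> 'a \<Rightarrow> 'a \<Rightarrow> ('a \<times> 'a) set" where
  "fraction R a b =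
     {(c, d). c \<in> carrier R \<and> d \<in> carrier R - {\<zero>\<^bsub>R\<^esub>} \<and> a \<otimes>\<^bsub>R\<^esub> d = c \<otimes>\<^bsub>R\<^esub> b}"

definition fraction_field :: "('a, 'm) ring_scheme \<Rightarrow> ('a \<times> 'a) set ring" where
  "fraction_field R =
     \<lparr> carrier = {fraction R a b | a b. a \<in> carrier R \<and> b \<in> carrier R - {\<zero>\<^bsub>R\<^esub>}},
       monoid.mult = (\<lambda>U V. \<Union>p\<in>U. \<Union>q\<in>V.
          fraction R (fst p \<otimes>\<^bsub>R\<^esub> fst q) (snd p \<otimes>\<^bsub>R\<^esub> snd q)),
       one = fraction R \<one>\<^bsub>R\<^esub> \<one>\<^bsub>R\<^esub>,
       zero = fraction R \<zero>\<^bsub>R\<^esub> \<one>\<^bsub>R\<^esub>,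
       add = (\<lambda>U V. \<Union>p\<in>U. \<Union>q\<in>V.
          fraction R (fst p \<otimes>\<^bsub>R\<^esub> snd q \<oplus>\<^bsub>R\<^esub> fst q \<otimes>\<^bsub>R\<^esub> snd p)
            (snd p \<otimes>\<^bsub>R\<^esub> snd q)) \<rparr>"

end

theory Submission
  imports Defs
begin

text \<open>
  Pass to an ultrapower, where infima over presentations with a fixed number of terms are attained
  up to infinitesimals and, if the valuation of \<open>k\<close> is nontrivial, every positive value is realized
  by \<open>k\<close> up to infinitesimals. The residue field of the ultrapower of \<open>k\<close> is algebraically closed, so
  the residue map of \<open>k\<close> extends to a place of \<open>K\<close> with the same residue field, refining the
  valuation of \<open>K\<close>. Gaussian elimination with respect to this place brings a presentation
  \<open>\<Sum> x a \<otimes> y a\<close> with fewest terms of maximal norm into a form in which one of these terms,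
  the leading one, is strictly higher in the place than all the others. The product of two leading
  terms leads the product presentation, and elimination shows that a leading term cannot be cancelled
  by terms of smaller norm. Hence \<open>\<parallel>z\<parallel> \<parallel>z'\<parallel> \<le> \<parallel>z z'\<parallel>\<close>, and the converse inequality is clear.
\<close>

section \<open>Extension of places\<close>

text \<open>The obstacle is cancellation among terms of equal norm: norms alone do not exclude that
  such terms combine into smaller ones, and the infimum defining the seminorm need not be attained.
  A place whose residue field is that of the scalars breaks the ties. Two terms of equal norm become
  comparable after rescaling by a scalar, and the residue of their quotient is represented by a
  scalar, which can be moved across the tensor sign; so a tie is removed by one elimination step.
  Algebraic closedness enters twice: it allows the place to be constructed without enlarging the
  residue field, and through roots of scalars it makes a nontrivial value group dense. The argument
  is asymmetric: only \<open>K\<close> carries a place, \<open>L\<close> enters through its norm.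
  Freezing the number \<open>n\<close> of terms is harmless, because the infimum over
  \<open>n\<close>-term presentations is at least the seminorm, the direction required for a lower
  bound on products. It is what lets a sequence of presentations define one in the ultrapower and
  keeps the size of the matrix criterion for vanishing bounded.\<close>

locale field_hom =
  fixes i :: "'e::field \<Rightarrow> 'f::field"
  assumes hom_add: "i (x + y) = i x + i y"
    and hom_mult: "i (x * y) = i x * i y"
    and hom_one: "i 1 = 1"
begin

lemma hom_zero: "i 0 = 0"
  using hom_add[of 0 0] by (metis add_0 add_cancel_right_right)

lemma hom_uminus: "i (- x) = - i x"
  using hom_add[of x "- x"] hom_zero by (simp add: eq_neg_iff_add_eq_0 add.commute)

lemma hom_diff: "i (x - y) = i x - i y"
  using hom_add[of x "- y"] hom_uminus by simp

lemma hom_eq_0_iff: "i x = 0 \<longleftrightarrow> x = 0"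
proof
  assume "i x = 0"
  show "x = 0"
  proof (rule ccontr)
    assume "x \<noteq> 0"
    then have "i x * i (inverse x) = 1" using hom_mult[of x "inverse x"] hom_one by simp
    then show False using \<open>i x = 0\<close> by simp
  qed
qed (simp add: hom_zero)

lemma hom_inverse: "i (inverse x) = inverse (i x)"
proof (cases "x = 0")
  case False
  then have "i x * i (inverse x) = 1" using hom_mult[of x "inverse x"] hom_one by simp
  then show ?thesis by (metis inverse_unique)
qed (simp add: hom_zero)

lemma hom_divide: "i (x / y) = i x / i y"
  by (simp add: divide_inverse hom_mult hom_inverse)

lemma map_poly_hom_add: "map_poly i (p + q) = map_poly i p + map_poly i q"
  by (rule poly_eqI) (simp add: coeff_map_poly hom_zero hom_add)

lemma map_poly_hom_smult: "map_poly i (smult c p) = smult (i c) (map_poly i p)"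
  by (rule poly_eqI) (simp add: coeff_map_poly hom_zero hom_mult)

lemma map_poly_hom_pCons: "map_poly i (pCons a p) = pCons (i a) (map_poly i p)"
  by (rule poly_eqI) (simp add: coeff_map_poly hom_zero coeff_pCons split: nat.split)

lemma map_poly_hom_mult: "map_poly i (p * q) = map_poly i p * map_poly i q"
proof (induction p)
  case (pCons a p)
  then show ?case
    by (simp add: map_poly_hom_add map_poly_hom_smult map_poly_hom_pCons hom_zero)
qed simp

end

locale valuation_ring =
  fixes R :: "'a::field set"
  assumes one_closed: "1 \<in> R"
    and add_closed: "x \<in> R \<Longrightarrow> y \<in> R \<Longrightarrow> x + y \<in> R"
    and uminus_closed: "x \<in> R \<Longrightarrow> - x \<in> R"
    and mult_closed: "x \<in> R \<Longrightarrow> y \<in> R \<Longrightarrow> x * y \<in> R"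
    and total: "x \<in> R \<or> inverse x \<in> R"
begin

lemma zero_closed: "0 \<in> R"
  using add_closed[OF one_closed uminus_closed[OF one_closed]] by simp

lemma power_closed: "x \<in> R \<Longrightarrow> x ^ n \<in> R"
  by (induction n) (auto intro: one_closed mult_closed)

lemma sum_closed: "(\<And>a. a \<in> A \<Longrightarrow> f a \<in> R) \<Longrightarrow> sum f A \<in> R"
  by (induction A rule: infinite_finite_induct) (auto intro: zero_closed add_closed)

text \<open>Integral closedness of a valuation ring: if \<open>x\<close> were outside,
  \<open>inverse x\<close> would be inside, and dividing the monic equation by
  \<open>x ^ (n - 1)\<close> would write \<open>x\<close> as a polynomial in
  \<open>inverse x\<close> over \<open>R\<close>.\<close>

lemma monic_root_closed:
  assumes "lead_coeff p = 1" "\<And>n. coeff p n \<in> R" "poly p x = 0"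
  shows "x \<in> R"
proof (rule ccontr)
  assume x: "x \<notin> R"
  then have x0: "x \<noteq> 0" using zero_closed by blast
  have y: "inverse x \<in> R" using x total by blast
  define n where "n = degree p"
  have n: "n > 0"
  proof (rule ccontr)
    assume "\<not> n > 0"
    then have "degree p = 0" by (simp add: n_def)
    then obtain a where "p = [:a:]" by (rule degree_eq_zeroE)
    with assms show False by simp
  qed
  have "0 = (\<Sum>k\<le>n. coeff p k * x ^ k)" using assms(3) by (simp add: poly_altdef n_def)
  also have "\<dots> = (\<Sum>k<n. coeff p k * x ^ k) + x ^ n"
    using assms(1) by (simp add: lessThan_Suc_atMost[symmetric] n_def)
  finally have e: "x ^ n = - (\<Sum>k<n. coeff p k * x ^ k)" by (simp add: eq_neg_iff_add_eq_0 add.commute)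
  have "x = x ^ n * inverse x ^ (n - 1)"
    using x0 n by (cases n) (simp_all add: power_mult_distrib[symmetric] field_simps)
  also have "\<dots> = - (\<Sum>k<n. coeff p k * inverse x ^ (n - 1 - k))"
  proof -
    have "x ^ k * inverse x ^ (n - 1) = inverse x ^ (n - 1 - k)" if "k < n" for k
    proof -
      have "n - 1 = (n - 1 - k) + k" using that by simp
      then have "inverse x ^ (n - 1) = inverse x ^ (n - 1 - k) * inverse x ^ k"
        by (metis power_add)
      then show ?thesis using x0 by (simp add: field_simps)
    qed
    then show ?thesis by (simp add: e sum_distrib_right mult.assoc)
  qed
  also have "\<dots> \<in> R"
    by (intro uminus_closed sum_closed mult_closed power_closed y assms(2))
  finally show False using x by simp
qed

end

text \<open>In the application \<open>R\<close> consists of the scalars of value at most 1, up to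
  infinitesimals, and \<open>m\<close> of the elements whose value is less than 1 by more than an
  infinitesimal. Containing \<open>m\<close> is what makes a place refine the valuation.\<close>

locale place_extension = field_hom i + valuation_ring R
  for i :: "'e::alg_closed_field \<Rightarrow> 'f::field" and R :: "'e set" +
  fixes m :: "'f set"
  assumes zero_m: "0 \<in> m"
    and add_m: "x \<in> m \<Longrightarrow> y \<in> m \<Longrightarrow> x + y \<in> m"
    and mult_m: "x \<in> m \<Longrightarrow> y \<in> m \<Longrightarrow> x * y \<in> m"
    and scale_m: "c \<in> R \<Longrightarrow> x \<in> m \<Longrightarrow> i c * x \<in> m"
    and one_m: "1 \<notin> m"
    and nonunit_m: "c \<in> R \<Longrightarrow> inverse c \<notin> R \<Longrightarrow> i c \<in> m"
begin

text \<open>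
  \<open>J\<close> encodes a homomorphism from the subring \<open>place_ring J\<close> to the residue field of \<open>R\<close> that extends
  the residue map of \<open>R\<close>: it is the kernel, and it determines the subring.
\<close>

definition place_ideal :: "'f set \<Rightarrow> bool" where
  "place_ideal J \<longleftrightarrow> m \<subseteq> J \<and> (\<forall>x\<in>J. \<forall>y\<in>J. x + y \<in> J \<and> x * y \<in> J) \<and>
     (\<forall>c\<in>R. \<forall>x\<in>J. i c * x \<in> J) \<and> 1 \<notin> J"

definition place_ring :: "'f set \<Rightarrow> 'f set" where
  "place_ring J = {i c + x | c x. c \<in> R \<and> x \<in> J}"

text \<open>Zorn's lemma: the closure conditions involve at most two elements of the set at a time,
  so they pass to unions of chains.\<close>

lemma maximal_place_ideal:
  obtains J where "place_ideal J" "\<And>J'. place_ideal J' \<Longrightarrow> J \<subseteq> J' \<Longrightarrow> J' = J"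
proof -
  have "\<exists>M\<in>Collect place_ideal. \<forall>M'\<in>Collect place_ideal. M \<subseteq> M' \<longrightarrow> M' = M"
  proof (rule subset_Zorn_nonempty)
    have "place_ideal m"
      using one_m by (auto simp: place_ideal_def add_m mult_m scale_m)
    then show "Collect place_ideal \<noteq> {}" by blast
  next
    fix C assume C: "C \<noteq> {}" "subset.chain (Collect place_ideal) C"
    have P: "place_ideal J" if "J \<in> C" for J using C that by (auto simp: subset.chain_def)
    have "x + y \<in> \<Union>C \<and> x * y \<in> \<Union>C" if "x \<in> \<Union>C" "y \<in> \<Union>C" for x y
    proof -
      obtain J J' where J: "x \<in> J" "y \<in> J'" "J \<in> C" "J' \<in> C" using \<open>x \<in> \<Union>C\<close> \<open>y \<in> \<Union>C\<close> by blast
      then have "J \<subseteq> J' \<or> J' \<subseteq> J" using C by (auto simp: subset.chain_def)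
      then show ?thesis using J P unfolding place_ideal_def by (meson UnionI subsetD)
    qed
    moreover have "i c * x \<in> \<Union>C" if "c \<in> R" "x \<in> \<Union>C" for c x
      using P that unfolding place_ideal_def by blast
    moreover have "m \<subseteq> \<Union>C" using C(1) P unfolding place_ideal_def by blast
    moreover have "1 \<notin> \<Union>C" using P unfolding place_ideal_def by blast
    ultimately show "\<Union>C \<in> Collect place_ideal"
      unfolding place_ideal_def by blast
  qed
  then show ?thesis using that by blast
qed

end

text \<open>The aim is that \<open>B\<close> is a valuation ring with maximal ideal
  \<open>J\<close>, as in the classical extension theorem for places. Here \<open>B\<close> is
  confined to the residue field of \<open>R\<close>, which suffices because that field is
  algebraically closed.\<close>

locale maximal_place = place_extension +
  fixes J
  assumes place: "place_ideal J"
    and maximal: "place_ideal J' \<Longrightarrow> J \<subseteq> J' \<Longrightarrow> J' = J"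
begin

abbreviation "B \<equiv> place_ring J"

lemma m_sub: "x \<in> m \<Longrightarrow> x \<in> J" using place by (auto simp: place_ideal_def)
lemma J_zero: "0 \<in> J" using zero_m m_sub by blast
lemma J_add: "x \<in> J \<Longrightarrow> y \<in> J \<Longrightarrow> x + y \<in> J" using place by (auto simp: place_ideal_def)
lemma J_mult: "x \<in> J \<Longrightarrow> y \<in> J \<Longrightarrow> x * y \<in> J" using place by (auto simp: place_ideal_def)
lemma J_scale: "c \<in> R \<Longrightarrow> x \<in> J \<Longrightarrow> i c * x \<in> J" using place by (auto simp: place_ideal_def)
lemma J_one: "1 \<notin> J" using place by (auto simp: place_ideal_def)
lemma J_uminus: "x \<in> J \<Longrightarrow> - x \<in> J"
  using J_scale[OF uminus_closed[OF one_closed]] by (simp add: hom_uminus hom_one)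
lemma J_diff: "x \<in> J \<Longrightarrow> y \<in> J \<Longrightarrow> x - y \<in> J"
  using J_add[of x "- y"] J_uminus by simp
lemma J_sum: "(\<And>a. a \<in> A \<Longrightarrow> f a \<in> J) \<Longrightarrow> sum f A \<in> J"
  by (induction A rule: infinite_finite_induct) (auto intro: J_zero J_add)

lemma B_I: "c \<in> R \<Longrightarrow> x \<in> J \<Longrightarrow> i c + x \<in> B" by (auto simp: place_ring_def)
lemma B_E: "x \<in> B \<Longrightarrow> (\<And>c y. c \<in> R \<Longrightarrow> y \<in> J \<Longrightarrow> x = i c + y \<Longrightarrow> thesis) \<Longrightarrow> thesis"
  by (auto simp: place_ring_def)
lemma hom_B: "c \<in> R \<Longrightarrow> i c \<in> B" using B_I[OF _ J_zero] by simp
lemma J_B: "x \<in> J \<Longrightarrow> x \<in> B" using B_I[OF zero_closed] by (simp add: hom_zero)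
lemma B_one: "1 \<in> B" using hom_B[OF one_closed] hom_one by simp
lemma B_add: assumes "x \<in> B" "y \<in> B" shows "x + y \<in> B"
proof -
  obtain c d u v where "c \<in> R" "d \<in> R" "u \<in> J" "v \<in> J" "x = i c + u" "y = i d + v"
    using assms by (auto elim!: B_E)
  then show ?thesis using B_I[of "c + d" "u + v"] by (simp add: add_closed J_add hom_add algebra_simps)
qed
lemma BJ: assumes "x \<in> B" "y \<in> J" shows "x * y \<in> J"
proof -
  obtain c u where "c \<in> R" "u \<in> J" "x = i c + u" using assms(1) by (rule B_E)
  then show ?thesis using assms(2) by (simp add: distrib_right J_add J_scale J_mult)
qed
lemma B_mult: assumes "x \<in> B" "y \<in> B" shows "x * y \<in> B"
proof -
  obtain d v where y: "d \<in> R" "v \<in> J" "y = i d + v" using assms by (auto elim!: B_E)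
  obtain c u where x: "c \<in> R" "u \<in> J" "x = i c + u" using assms by (auto elim!: B_E)
  have "x * y = i (c * d) + (i d * u + x * v)" by (simp add: x y hom_mult algebra_simps)
  also have "\<dots> \<in> B" by (intro B_I mult_closed J_add J_scale BJ x y assms)
  finally show ?thesis .
qed
lemma B_zero: "0 \<in> B" using J_B J_zero by blast
lemma B_sum: "(\<And>a. a \<in> A \<Longrightarrow> f a \<in> B) \<Longrightarrow> sum f A \<in> B"
  by (induction A rule: infinite_finite_induct) (auto intro: B_zero B_add)
lemma B_power: "x \<in> B \<Longrightarrow> x ^ n \<in> B"
  by (induction n) (auto intro: B_one B_mult)

text \<open>This is \<open>S[x]\<close> inside the field. For \<open>S = J\<close> it is the ideal
  of \<open>B[x]\<close> generated by \<open>J\<close>.\<close>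

definition polys :: "'b set \<Rightarrow> 'b \<Rightarrow> 'b set" where
  "polys S x = {poly p x | p. \<forall>n. coeff p n \<in> S}"

lemma polysI: "(\<And>n. coeff p n \<in> S) \<Longrightarrow> poly p x \<in> polys S x"
  by (auto simp: polys_def)

lemma polys_J_add: 
  assumes "u \<in> polys J x" "v \<in> polys J x" shows "u + v \<in> polys J x"
proof -
  obtain p q where pq: "u = poly p x" "v = poly q x" "\<And>n. coeff p n \<in> J" "\<And>n. coeff q n \<in> J"
    using assms by (auto simp: polys_def)
  have "poly (p + q) x \<in> polys J x"
    by (rule polysI) (auto simp: pq coeff_mult intro!: J_add)
  then show ?thesis by (simp add: pq)
qed

lemma polys_B_add: 
  assumes "u \<in> polys B x" "v \<in> polys B x" shows "u + v \<in> polys B x"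
proof -
  obtain p q where pq: "u = poly p x" "v = poly q x" "\<And>n. coeff p n \<in> B" "\<And>n. coeff q n \<in> B"
    using assms by (auto simp: polys_def)
  have "poly (p + q) x \<in> polys B x"
    by (rule polysI) (auto simp: pq coeff_mult intro!: B_add)
  then show ?thesis by (simp add: pq)
qed

lemma polys_B_mult: 
  assumes "u \<in> polys B x" "v \<in> polys B x" shows "u * v \<in> polys B x"
proof -
  obtain p q where pq: "u = poly p x" "v = poly q x" "\<And>n. coeff p n \<in> B" "\<And>n. coeff q n \<in> B"
    using assms by (auto simp: polys_def)
  have "poly (p * q) x \<in> polys B x"
    by (rule polysI) (auto simp: pq coeff_mult intro!: B_sum B_mult)
  then show ?thesis by (simp add: pq)
qed

lemma polys_BJ: 
  assumes "u \<in> polys B x" "v \<in> polys J x" shows "u * v \<in> polys J x"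
proof -
  obtain p q where pq: "u = poly p x" "v = poly q x" "\<And>n. coeff p n \<in> B" "\<And>n. coeff q n \<in> J"
    using assms by (auto simp: polys_def)
  have "poly (p * q) x \<in> polys J x"
    by (rule polysI) (auto simp: pq coeff_mult intro!: J_sum BJ)
  then show ?thesis by (simp add: pq)
qed

lemma polys_const: "0 \<in> S \<Longrightarrow> a \<in> S \<Longrightarrow> a \<in> polys S x"
  using polysI[of "[:a:]" S x] by (auto simp: coeff_pCons split: nat.split)

lemma polys_B_self: "x \<in> polys B x"
  using polysI[of "[:0, 1:]" B x] by (auto simp: coeff_pCons B_zero B_one split: nat.split)

lemma polys_J_diff: 
  assumes "u \<in> polys J x" "v \<in> polys J x" shows "u - v \<in> polys J x"
proof -
  obtain p q where pq: "u = poly p x" "v = poly q x" "\<And>n. coeff p n \<in> J" "\<And>n. coeff q n \<in> J"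
    using assms by (auto simp: polys_def)
  have "poly (p - q) x \<in> polys J x"
    by (rule polysI) (auto simp: pq coeff_mult intro!: J_diff)
  then show ?thesis by (simp add: pq)
qed

text \<open>Otherwise \<open>J + (x - i c) B[x]\<close> would be a place ideal, hence equal to
  \<open>J\<close> by maximality; then \<open>x - i c\<close> would lie in \<open>J\<close> and
  \<open>x\<close> in \<open>B\<close>. Consequently every \<open>x - i c\<close> is a unit modulo
  \<open>J[x]\<close>.\<close>

lemma not_in_B_imp:
  assumes x: "x \<notin> B" and c: "c \<in> R"
  obtains j t where "j \<in> J" "t \<in> polys B x" "1 = j + (x - i c) * t"
proof -
  define J' where "J' = {j + (x - i c) * t | j t. j \<in> J \<and> t \<in> polys B x}"
  have J': "j + (x - i c) * t \<in> J'" if "j \<in> J" "t \<in> polys B x" for j t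
    using that by (auto simp: J'_def)
  have e: "x - i c \<in> polys B x"
    using polys_B_add[OF polys_B_self polys_const[OF B_zero hom_B[OF uminus_closed[OF c]]]]
    by (simp add: hom_uminus)
  have "1 \<in> J'"
  proof (rule ccontr)
    assume 1: "1 \<notin> J'"
    have sub: "J \<subseteq> J'" using J'[OF _ polys_const[OF B_zero B_zero]] by auto
    have "place_ideal J'" unfolding place_ideal_def
    proof (intro conjI ballI)
      show "m \<subseteq> J'" using sub m_sub by blast
      show "1 \<notin> J'" by (rule 1)
    next
      fix u v assume "u \<in> J'" "v \<in> J'"
      then obtain j t j' t' where h: "j \<in> J" "t \<in> polys B x" "j' \<in> J" "t' \<in> polys B x"
        "u = j + (x - i c) * t" "v = j' + (x - i c) * t'" by (auto simp: J'_def)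
      have j: "j \<in> polys B x" "j' \<in> polys B x"
        using h polys_const[OF B_zero J_B] by auto
      have "u + v = (j + j') + (x - i c) * (t + t')" by (simp add: h algebra_simps)
      also have "\<dots> \<in> J'" using h by (intro J' J_add polys_B_add)
      finally show "u + v \<in> J'" .
      have "u * v = j * j' + (x - i c) * (j * t' + j' * t + (x - i c) * (t * t'))"
        by (simp add: h algebra_simps)
      also have "\<dots> \<in> J'" using h j e by (intro J' J_mult polys_B_add polys_B_mult)
      finally show "u * v \<in> J'" .
    next
      fix d u assume d: "d \<in> R" and "u \<in> J'"
      then obtain j t where h: "j \<in> J" "t \<in> polys B x" "u = j + (x - i c) * t" by (auto simp: J'_def)
      have "i d * u = i d * j + (x - i c) * (i d * t)" by (simp add: h algebra_simps)
      also have "\<dots> \<in> J'"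
        using h d polys_const[OF B_zero hom_B[OF d]] by (intro J' J_scale polys_B_mult)
      finally show "i d * u \<in> J'" .
    qed
    then have "J' = J" using maximal sub by blast
    moreover have "x - i c \<in> J'" using J'[OF J_zero polys_const[OF B_zero B_one]] by simp
    ultimately have "i c + (x - i c) \<in> B" using B_I c by blast
    then show False using x by simp
  qed
  then show ?thesis using that by (auto simp: J'_def)
qed

text \<open>Each factor is a unit modulo \<open>J[x]\<close>, so the factors can be cancelled one
  after another.\<close>

lemma prod_roots_imp_one:
  assumes x: "x \<notin> B"
  shows "set cs \<subseteq> R \<Longrightarrow> (\<Prod>c\<leftarrow>cs. x - i c) \<in> polys J x \<Longrightarrow> 1 \<in> polys J x"
proof (induction cs)
  case (Cons c cs)
  obtain j t where h: "j \<in> J" "t \<in> polys B x" "1 = j + (x - i c) * t"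
    using not_in_B_imp[OF x] Cons.prems by auto
  have P: "(\<Prod>c\<leftarrow>cs. x - i c) \<in> polys B x" if "set cs \<subseteq> R" for cs
    using that
  proof (induction cs)
    case (Cons c cs)
    have "x - i c \<in> polys B x"
      using polys_B_add[OF polys_B_self polys_const[OF B_zero hom_B[OF uminus_closed[of c]]]] Cons.prems
      by (simp add: hom_uminus)
    then show ?case using Cons by (simp add: polys_B_mult)
  qed (simp add: polys_const B_zero B_one)
  let ?q = "\<Prod>c\<leftarrow>cs. x - i c"
  have "?q = ?q * (j + (x - i c) * t)" using h(3) by simp
  also have "\<dots> = ?q * j + t * (\<Prod>c\<leftarrow>c # cs. x - i c)" by (simp add: algebra_simps)
  also have "\<dots> \<in> polys J x"
    using Cons.prems h P by (intro polys_J_add polys_BJ) (auto intro: polys_const J_zero)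
  finally show ?case using Cons by auto
qed simp

text \<open>This is where the scalars have to be algebraically closed: \<open>p\<close> splits into
  linear factors, and its roots lie in \<open>R\<close> because \<open>R\<close> is integrally
  closed.\<close>

lemma monic_imp_one:
  assumes x: "x \<notin> B" and p: "lead_coeff p = 1" "\<And>n. coeff p n \<in> R"
    and ev: "poly (map_poly i p) x \<in> polys J x"
  shows "1 \<in> polys J x"
proof -
  obtain A where A: "p = smult (lead_coeff p) (\<Prod>c\<in>#A. [:-c, 1:])"
    using alg_closed_imp_factorization[of p] p by force
  obtain cs where cs: "mset cs = A" using ex_mset by blast
  have pcs: "p = (\<Prod>c\<leftarrow>cs. [:-c, 1:])"
    using A p(1) cs[symmetric] by (simp flip: prod_mset_prod_list)
  have "set cs \<subseteq> R"
  proof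
    fix c assume c: "c \<in> set cs"
    have "poly (\<Prod>c\<leftarrow>cs. [:-c, 1:]) c = 0" using c
      by (induction cs) auto
    then show "c \<in> R" using monic_root_closed[OF p] pcs by simp
  qed
  moreover have "poly (map_poly i (\<Prod>c\<leftarrow>cs. [:-c, 1:])) x = (\<Prod>c\<leftarrow>cs. x - i c)"
    by (induction cs) (simp_all add: map_poly_hom_mult map_poly_hom_pCons hom_uminus hom_one
        del: mult_pCons_left)
  ultimately show ?thesis using prod_roots_imp_one[OF x] ev pcs by simp
qed

lemma nonunit_imp_J: "c \<in> R \<Longrightarrow> inverse c \<notin> R \<Longrightarrow> i c \<in> J"
  using nonunit_m m_sub by blast

lemma unit_coeff_imp_one:
  assumes x: "x \<notin> B"
  shows "\<forall>n. coeff p n \<in> R \<Longrightarrow> coeff p k \<noteq> 0 \<Longrightarrow> inverse (coeff p k) \<in> R \<Longrightarrow>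
    poly (map_poly i p) x \<in> polys J x \<Longrightarrow> 1 \<in> polys J x"
proof (induction "degree p" arbitrary: p rule: less_induct)
  case less
  let ?c = "lead_coeff p"
  have p0: "p \<noteq> 0" using less.prems by auto
  show ?case
  proof (cases "inverse ?c \<in> R")
    case True
    show ?thesis
    proof (rule monic_imp_one[OF x, of "smult (inverse ?c) p"])
      show "lead_coeff (smult (inverse ?c) p) = 1" using p0 by simp
      show "coeff (smult (inverse ?c) p) n \<in> R" for n using less.prems True by (simp add: mult_closed)
      show "poly (map_poly i (smult (inverse ?c) p)) x \<in> polys J x"
        using less.prems polys_BJ[OF polys_const[OF B_zero hom_B[OF True]]]
        by (simp add: map_poly_hom_smult)
    qed
  next
    case False
    let ?m = "monom ?c (degree p)"
    let ?q = "p + - ?m"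
    have c: "i ?c \<in> J" using False less.prems by (simp add: nonunit_imp_J)
    have k: "k \<noteq> degree p" using less.prems False by auto
    then have kd: "k < degree p" using less.prems le_degree nat_less_le by blast
    have d: "degree ?q < degree p"
    proof (rule degree_lessI)
      show "?q \<noteq> 0 \<or> degree p > 0" using kd by simp
      show "\<forall>n\<ge>degree p. coeff ?q n = 0"
        by (auto simp: coeff_eq_0)
    qed
    have e: "poly (map_poly i ?q) x = poly (map_poly i p) x - i ?c * x ^ degree p"
    proof -
      have "map_poly i ?q = map_poly i p - monom (i ?c) (degree p)"
        by (rule poly_eqI) (simp add: coeff_map_poly hom_zero hom_diff)
      then show ?thesis by (simp add: poly_monom)
    qed
    have "poly (monom (i ?c) (degree p)) x \<in> polys J x"
      by (rule polysI) (use c in \<open>auto simp: J_zero\<close>)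
    then have "poly (map_poly i ?q) x \<in> polys J x"
      unfolding e using less.prems by (intro polys_J_diff) (simp_all add: poly_monom)
    moreover have "\<forall>n. coeff ?q n \<in> R" using less.prems by (auto simp: zero_closed)
    ultimately show ?thesis using less.hyps[OF d] less.prems k by simp
  qed
qed

text \<open>The relation \<open>1 = j + x * t\<close> is read modulo \<open>J\<close>: replacing the
  coefficients of \<open>t\<close> by their scalar parts gives a polynomial over \<open>R\<close>
  with value in \<open>J[x]\<close> whose constant coefficient \<open>-1\<close> is a unit.\<close>

lemma not_in_B_imp_one:
  assumes x: "x \<notin> B" shows "1 \<in> polys J x"
proof -
  obtain j t where h: "j \<in> J" "t \<in> polys B x" "1 = j + (x - i 0) * t"
    using not_in_B_imp[OF x zero_closed] by auto
  then obtain q where q: "t = poly q x" "\<And>n. coeff q n \<in> B" by (auto simp: polys_def)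
  have "\<exists>c j. c \<in> R \<and> j \<in> J \<and> coeff q n = i c + j" for n using B_E[OF q(2)[of n]] by metis
  then obtain c d where cd: "\<And>n. c n \<in> R" "\<And>n. d n \<in> J" "\<And>n. coeff q n = i (c n) + d n" by metis
  \<comment> \<open>Beyond the degree of \<open>q\<close> the choice of \<open>c n\<close> is
    arbitrary, so the list is cut there to give a polynomial.\<close>
  define s where "s = poly_of_list (map c [0..<Suc (degree q)])"
  have cs: "coeff s n = (if n \<le> degree q then c n else 0)" for n
    by (auto simp: s_def nth_default_def coeff_Poly_eq simp del: upt_Suc)
  define r where "r = pCons (-1) s"
  have dq: "coeff (q - map_poly i s) n \<in> J" for n
  proof (cases "n \<le> degree q")
    case True
    then show ?thesis using cd(2)[of n] by (simp add: coeff_map_poly hom_zero cs cd(3))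
  next
    case False
    then show ?thesis by (simp add: coeff_map_poly hom_zero cs coeff_eq_0 J_zero)
  qed
  have "poly (map_poly i r) x = - (j + x * poly (q - map_poly i s) x)"
    using h(3) by (simp add: r_def map_poly_hom_pCons hom_uminus hom_one hom_zero q algebra_simps)
  also have "\<dots> = poly [:-1:] x * (j + x * poly (q - map_poly i s) x)" by simp
  also have "\<dots> \<in> polys J x"
  proof (rule polys_BJ)
    show "poly [:-1:] x \<in> polys B x"
      by (rule polysI) (use hom_B[OF uminus_closed[OF one_closed]] in
          \<open>auto simp: coeff_pCons B_zero hom_uminus hom_one split: nat.split\<close>)
    show "j + x * poly (q - map_poly i s) x \<in> polys J x"
      by (intro polys_J_add polys_BJ polys_B_self polysI polys_const J_zero h dq)
  qed
  finally have ev: "poly (map_poly i r) x \<in> polys J x" .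
  show ?thesis
    by (rule unit_coeff_imp_one[OF x, of r 0])
      (use ev in \<open>auto simp: r_def coeff_pCons cs cd zero_closed uminus_closed one_closed split: nat.split\<close>)
qed

text \<open>Otherwise \<open>1\<close> is a polynomial with coefficients in \<open>J\<close> in the
  inverse of \<open>u = 1 - j\<close>. Clearing denominators puts \<open>u ^ d\<close> in
  \<open>J\<close>, while \<open>u ^ d\<close> is congruent to 1 modulo \<open>J\<close>. Thus
  \<open>B\<close> is local with maximal ideal \<open>J\<close>.\<close>

lemma unit_closed:
  assumes j: "j \<in> J" shows "inverse (1 - j) \<in> B"
proof (rule ccontr)
  let ?u = "1 - j"
  assume n: "inverse ?u \<notin> B"
  have u0: "?u \<noteq> 0" using j J_one by auto
  obtain p where p: "1 = poly p (inverse ?u)" "\<And>n. coeff p n \<in> J"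
    using not_in_B_imp_one[OF n] by (auto simp: polys_def)
  define d where "d = degree p"
  have ub: "?u \<in> B" using B_add[OF B_one J_B[OF J_uminus[OF j]]] by simp
  have "?u ^ d = (\<Sum>k\<le>d. coeff p k * inverse ?u ^ k) * ?u ^ d"
    using p(1) by (simp add: poly_altdef d_def)
  also have "\<dots> = (\<Sum>k\<le>d. ?u ^ (d - k) * coeff p k)"
    unfolding sum_distrib_right
  proof (rule sum.cong[OF refl])
    fix k assume "k \<in> {..d}"
    then have "?u ^ d = ?u ^ (d - k) * ?u ^ k" by (simp flip: power_add)
    then show "coeff p k * inverse ?u ^ k * ?u ^ d = ?u ^ (d - k) * coeff p k"
      using u0 by (simp add: power_inverse)
  qed
  also have "\<dots> \<in> J" by (intro J_sum BJ B_power ub p)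
  finally have "?u ^ d \<in> J" .
  moreover have "1 - ?u ^ n \<in> J" for n
  proof (induction n)
    case (Suc n)
    have "1 - ?u ^ Suc n = (1 - ?u ^ n) + ?u ^ n * j" by (simp add: algebra_simps)
    also have "\<dots> \<in> J" using Suc j by (intro J_add BJ B_power ub)
    finally show ?case .
  qed (simp add: J_zero)
  ultimately have "?u ^ d + (1 - ?u ^ d) \<in> J" by (intro J_add)
  then show False using J_one by simp
qed

text \<open>The classical descent in the extension theorem for valuations: the relation of smaller
  degree serves to lower the degree of the other one. Since \<open>x\<close> and
  \<open>inverse x\<close> play symmetric roles, \<open>reduce\<close> treats only the case where
  \<open>p\<close> has the larger degree.\<close>

lemma no_two_relations:
  "poly p x = 1 \<Longrightarrow> poly q (inverse x) = 1 \<Longrightarrow> \<forall>n. coeff p n \<in> J \<Longrightarrow> \<forall>n. coeff q n \<in> J \<Longrightarrow>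
   x \<noteq> 0 \<Longrightarrow> False"
proof (induction "degree p + degree q" arbitrary: p q x rule: less_induct)
  case less
  have reduce: False if h: "poly p x = 1" "poly q (inverse x) = 1" "\<forall>n. coeff p n \<in> J"
    "\<forall>n. coeff q n \<in> J" "x \<noteq> 0" "degree q \<le> degree p"
    and IH: "\<And>p'. degree p' < degree p \<Longrightarrow> poly p' x = 1 \<Longrightarrow> \<forall>n. coeff p' n \<in> J \<Longrightarrow> False"
    for p q x
  proof -
    define n where "n = degree q"
    define j where "j = coeff q 0"
    have n0: "n > 0"
    proof (rule ccontr)
      assume "\<not> n > 0"
      then have "degree q = 0" by (simp add: n_def)
      then obtain a where "q = [:a:]" by (rule degree_eq_zeroE)
      then show False using h(2,4) J_one by (auto dest: spec[of _ 0])
    qed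
    \<comment> \<open>Multiplying \<open>poly q (inverse x) = 1\<close> by \<open>x ^ n\<close>,
      moving the term with \<open>j\<close> to the other side and dividing by the unit
      \<open>1 - j\<close> expresses \<open>x ^ n\<close> as \<open>poly r x\<close>, where all
      coefficients of \<open>r\<close> from \<open>n\<close> on vanish.\<close>
    define r where "r = smult (inverse (1 - j)) (reflect_poly q - monom j n)"
    have j: "j \<in> J" using h by (simp add: j_def)
    then have u0: "1 - j \<noteq> 0" using J_one by auto
    have rJ: "coeff r k \<in> J" for k
      using h(4) j unit_closed[OF j]
      by (auto simp: r_def coeff_reflect_poly BJ J_diff J_zero)
    have "poly (reflect_poly q) x = x ^ n"
      using poly_reflect_poly_nz[OF \<open>x \<noteq> 0\<close>, of q] h(2) by (simp add: n_def)
    then have "poly r x = inverse (1 - j) * ((1 - j) * x ^ n)"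
      by (simp add: r_def poly_monom algebra_simps)
    then have rx: "poly r x = x ^ n" using u0 by simp
    have rd: "coeff r k = 0" if "k \<ge> n" for k
      using that n_def by (auto simp: r_def coeff_reflect_poly j_def)
    define c where "c = lead_coeff p"
    define d where "d = degree p"
    have nd: "n \<le> d" using h by (simp add: n_def d_def)
    \<comment> \<open>The leading term of \<open>p\<close> is traded for
      \<open>c * x ^ (d - n) * poly r x\<close>, which has the same value and smaller
      degree.\<close>
    define p' where "p' = p - monom c d + smult c (monom 1 (d - n) * r)"
    have "coeff p' k \<in> J" for k
      using h(3) rJ by (auto simp: p'_def c_def coeff_monom_mult J_add J_diff J_mult J_zero)
    moreover have "poly p' x = 1"
      using h(1) nd by (simp add: p'_def poly_monom rx flip: power_add)
    moreover have "degree p' < degree p"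
    proof (rule degree_lessI)
      show "p' \<noteq> 0 \<or> degree p > 0" using nd n0 d_def by simp
      show "\<forall>k\<ge>degree p. coeff p' k = 0"
        using nd by (auto simp: p'_def c_def d_def coeff_monom_mult coeff_eq_0 rd)
    qed
    ultimately show False using IH by blast
  qed
  show False
  proof (cases "degree q \<le> degree p")
    case True
    show False
    proof (rule reduce[of p x q])
      fix p' assume "degree p' < degree p" "poly p' x = 1" "\<forall>n. coeff p' n \<in> J"
      then show False using less.hyps[of p' q x] less.prems by simp
    qed (use less.prems True in auto)
  next
    case False
    show False
    proof (rule reduce[of q "inverse x" p])
      fix p' assume "degree p' < degree q" "poly p' (inverse x) = 1" "\<forall>n. coeff p' n \<in> J"
      then show False using less.hyps[of p p' x] less.prems by simp
    qed (use less.prems False in auto)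
  qed
qed

text \<open>By \<open>no_two_relations\<close>, \<open>x\<close> and \<open>inverse x\<close> are
  not both outside \<open>B\<close>. If \<open>inverse x\<close> were in \<open>B\<close> but not in
  \<open>J\<close>, its scalar part \<open>c\<close> would be a unit of \<open>R\<close>; then
  \<open>inverse x\<close> would be a unit of \<open>B\<close>, so that \<open>x\<close> would lie
  in \<open>B\<close>.\<close>

lemma not_in_B_imp_inverse_in_J:
  assumes x: "x \<notin> B" shows "inverse x \<in> J"
proof (cases "x = 0")
  case True then show ?thesis using J_zero by simp
next
  case x0: False
  have b: "inverse x \<in> B"
  proof (rule ccontr)
    assume "inverse x \<notin> B"
    then have "1 \<in> polys J x" "1 \<in> polys J (inverse x)" using x not_in_B_imp_one by auto
    then show False using no_two_relations[of _ x] x0 unfolding polys_def by force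
  qed
  show ?thesis
  proof (rule ccontr)
    assume n: "inverse x \<notin> J"
    obtain c y where cy: "c \<in> R" "y \<in> J" "inverse x = i c + y" using b by (auto elim: B_E)
    have c: "inverse c \<in> R" "c \<noteq> 0" using cy n nonunit_imp_J[OF cy(1)] J_add hom_zero by auto
    have "1 - - (i (inverse c) * y) = i (inverse c) * inverse x"
      using c hom_eq_0_iff[of c] by (simp add: cy hom_inverse distrib_left)
    moreover have "- (i (inverse c) * y) \<in> J" using c cy by (simp add: J_uminus J_scale)
    ultimately have "inverse (i (inverse c) * inverse x) \<in> B" using unit_closed by metis
    then have "i (inverse c) * inverse (i (inverse c) * inverse x) \<in> B" using B_mult hom_B c by blast
    moreover have "i (inverse c) * inverse (i (inverse c) * inverse x) = x"
      using x0 c hom_eq_0_iff[of c] by (simp add: hom_inverse)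
    ultimately show False using x by metis
  qed
qed

end

section \<open>Valued fields up to infinitesimals\<close>

lemma finite_total_preorder_greatest:
  assumes "finite A" "A \<noteq> {}" "\<And>a b. a \<in> A \<Longrightarrow> b \<in> A \<Longrightarrow> leq a b \<or> leq b a"
    "\<And>a b c. a \<in> A \<Longrightarrow> b \<in> A \<Longrightarrow> c \<in> A \<Longrightarrow> leq a b \<Longrightarrow> leq b c \<Longrightarrow> leq a c"
  shows "\<exists>b\<in>A. \<forall>a\<in>A. leq a b"
  using assms
proof (induction A rule: finite_ne_induct)
  case (insert a A)
  have "\<exists>b\<in>A. \<forall>c\<in>A. leq c b"
    by (rule insert.IH) (use insert.prems in \<open>blast+\<close>)
  then obtain b where b: "b \<in> A" "\<And>c. c \<in> A \<Longrightarrow> leq c b" by blast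
  have aa: "leq a a" using insert.prems(1) by blast
  show ?case
  proof (cases "leq a b")
    case True then show ?thesis using b by blast
  next
    case False
    then have ba: "leq b a" using insert.prems(1) b by blast
    have "leq c a" if "c \<in> A" for c
      by (rule insert.prems(2)[OF _ _ _ b(2)[OF that] ba]) (use that b in auto)
    then show ?thesis using aa by blast
  qed
qed blast

text \<open>\<open>x \<preceq> y\<close> means \<open>x \<le> (1 + 1 / n) * y\<close> for all standard \<open>n > 0\<close>, with \<open>n = 0\<close> adding \<open>0 \<le> y\<close>.\<close>

definition lesssim :: "'h::linordered_field \<Rightarrow> 'h \<Rightarrow> bool" (infix \<open>\<preceq>\<close> 50) where
  "x \<preceq> y \<longleftrightarrow> (\<forall>n::nat. of_nat n * x \<le> of_nat (Suc n) * y)"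

definition simeq :: "'h::linordered_field \<Rightarrow> 'h \<Rightarrow> bool" (infix \<open>\<asymp>\<close> 50) where
  "x \<asymp> y \<longleftrightarrow> x \<preceq> y \<and> y \<preceq> x"

lemma lesssim_le: assumes "x \<le> y" "0 \<le> y" shows "x \<preceq> y"
proof -
  have "of_nat n * x \<le> of_nat (Suc n) * y" for n
  proof -
    have "of_nat n * x \<le> of_nat n * y" using assms by (simp add: mult_left_mono)
    also have "\<dots> \<le> of_nat (Suc n) * y" using assms by (intro mult_right_mono) auto
    finally show ?thesis .
  qed
  then show ?thesis by (simp add: lesssim_def)
qed

lemma lesssim_refl [simp]: "0 \<le> x \<Longrightarrow> x \<preceq> x"
  by (rule lesssim_le) auto

lemma lesssim_linear: "0 \<le> x \<Longrightarrow> 0 \<le> y \<Longrightarrow> x \<preceq> y \<or> y \<preceq> x"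
  by (metis lesssim_le linear)

text \<open>Composing or multiplying two comparisons squares the error factor
  \<open>(n + 1) / n\<close>. Since all \<open>n\<close> are available, using the hypothesis at a
  multiple of \<open>n\<close> absorbs the square.\<close>

lemma lesssim_square:
  fixes a b :: "'h::linordered_field"
  assumes b: "0 \<le> b" and h: "\<And>n::nat. of_nat n * of_nat n * a \<le> of_nat (Suc n) * of_nat (Suc n) * b"
  shows "a \<preceq> b"
  unfolding lesssim_def
proof
  fix n :: nat
  show "of_nat n * a \<le> of_nat (Suc n) * b"
  proof (cases "n = 0")
    case True then show ?thesis using b by simp
  next
    case False
    let ?N = "of_nat n :: 'h"
    have n1: "1 \<le> ?N" using False by (metis One_nat_def Suc_leI not_gr0 of_nat_1 of_nat_mono)
    \<comment> \<open>The multiple 3 is the least that works: \<open>(3 n + 1)^2\<close> is at most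
      \<open>9 n (n + 1)\<close> for \<open>n\<close> at least 1, whereas \<open>(2 n + 1)^2\<close>
      exceeds \<open>4 n (n + 1)\<close> by 1.\<close>
    have "9 * ?N * (?N * a) = of_nat (3 * n) * of_nat (3 * n) * a" by (simp add: algebra_simps)
    also have "\<dots> \<le> of_nat (Suc (3 * n)) * of_nat (Suc (3 * n)) * b" by (rule h)
    also have "\<dots> = (9 * ?N * ?N + 6 * ?N + 1) * b" by (simp add: algebra_simps)
    also have "\<dots> \<le> (9 * ?N * ?N + 9 * ?N) * b"
    proof (rule mult_right_mono[OF _ b])
      show "9 * ?N * ?N + 6 * ?N + 1 \<le> 9 * ?N * ?N + 9 * ?N" using n1 by linarith
    qed
    also have "\<dots> = 9 * ?N * (of_nat (Suc n) * b)" by (simp add: algebra_simps)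
    finally show ?thesis using n1 by (simp add: mult_le_cancel_left)
  qed
qed

lemma lesssim_trans [trans]:
  assumes "x \<preceq> y" "y \<preceq> z" "0 \<le> z" shows "x \<preceq> z"
proof (rule lesssim_square[OF assms(3)])
  fix n :: nat
  have "of_nat n * of_nat n * x \<le> of_nat n * (of_nat (Suc n) * y)"
    using assms(1) unfolding lesssim_def mult.assoc by (intro mult_left_mono) auto
  also have "\<dots> = of_nat (Suc n) * (of_nat n * y)" by (simp only: ac_simps)
  also have "\<dots> \<le> of_nat (Suc n) * (of_nat (Suc n) * z)"
    using assms(2) unfolding lesssim_def by (intro mult_left_mono) auto
  finally show "of_nat n * of_nat n * x \<le> of_nat (Suc n) * of_nat (Suc n) * z"
    by (simp only: ac_simps)
qed

lemma lesssim_mult: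
  assumes "x \<preceq> y" "u \<preceq> w" "0 \<le> y" "0 \<le> u" "0 \<le> w" shows "x * u \<preceq> y * w"
proof (rule lesssim_square)
  fix n :: nat
  have "(of_nat n * x) * (of_nat n * u) \<le> (of_nat (Suc n) * y) * (of_nat (Suc n) * w)"
    by (rule mult_mono) (use assms in \<open>auto simp: lesssim_def simp del: of_nat_Suc\<close>)
  then show "of_nat n * of_nat n * (x * u) \<le> of_nat (Suc n) * of_nat (Suc n) * (y * w)"
    by (simp only: ac_simps)
qed (use assms in auto)

lemma lesssim_cancel: assumes "0 < a" "a * x \<preceq> a * y" shows "x \<preceq> y"
  unfolding lesssim_def
proof
  fix n :: nat
  have "of_nat n * (a * x) \<le> of_nat (Suc n) * (a * y)" using assms(2) unfolding lesssim_def by blast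
  then have "a * (of_nat n * x) \<le> a * (of_nat (Suc n) * y)" by (simp only: ac_simps)
  then show "of_nat n * x \<le> of_nat (Suc n) * y" using assms(1) by (simp only: mult_le_cancel_left_pos)
qed

lemma lesssim_mult_left: "x \<preceq> y \<Longrightarrow> 0 \<le> a \<Longrightarrow> a * x \<preceq> a * y"
  unfolding lesssim_def mult.left_commute[of _ a] by (simp add: mult_left_mono)

lemma lesssim_pos: "x \<preceq> y \<Longrightarrow> 0 < x \<Longrightarrow> 0 < y"
proof -
  assume "x \<preceq> y" "0 < x"
  then have "of_nat 1 * x \<le> of_nat (Suc 1) * y" unfolding lesssim_def by blast
  then show "0 < y" using \<open>0 < x\<close> by simp
qed

lemma not_lesssim_less: "\<not> y \<preceq> x \<Longrightarrow> 0 \<le> x \<Longrightarrow> x < y"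
  using lesssim_le not_le_imp_less by blast

lemma lesssim_max: "z \<preceq> max x y \<longleftrightarrow> z \<preceq> x \<or> z \<preceq> y" if "0 \<le> x" "0 \<le> y"
proof
  show "z \<preceq> max x y \<Longrightarrow> z \<preceq> x \<or> z \<preceq> y" by (simp add: max_def split: if_splits)
  show "z \<preceq> x \<or> z \<preceq> y \<Longrightarrow> z \<preceq> max x y"
    using lesssim_trans[OF _ lesssim_le[of x "max x y"]] lesssim_trans[OF _ lesssim_le[of y "max x y"]] that
    by (auto simp: le_max_iff_disj)
qed

lemma simeq_divide:
  assumes "0 < a" "0 < b" "0 < c" "0 < d" "a \<asymp> b" "c \<asymp> d" shows "a / c \<asymp> b / d"
proof -
  have "a / c \<preceq> b / d" if "0 < a" "0 < b" "0 < c" "0 < d" "a \<preceq> b" "d \<preceq> c" for a b c d :: 'a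
  proof (rule lesssim_cancel)
    show "0 < c * d" using that by simp
    have "a * d \<preceq> b * c" using that by (intro lesssim_mult) auto
    then show "c * d * (a / c) \<preceq> c * d * (b / d)" using that by (simp add: field_simps)
  qed
  then show ?thesis using assms by (simp add: simeq_def)
qed

lemma simeq_cancel: "0 < a \<Longrightarrow> a * x \<asymp> a * y \<Longrightarrow> x \<asymp> y"
  using lesssim_cancel by (auto simp: simeq_def)

lemma simeq_pos: "x \<asymp> y \<Longrightarrow> 0 < x \<Longrightarrow> 0 < y" using lesssim_pos by (auto simp: simeq_def)

text \<open>Values lie in an arbitrary ordered field, so that the ultrapower of a real valuation is
  covered too.\<close>

locale valued =
  fixes v :: "'a::field \<Rightarrow> 'h::linordered_field"
  assumes v_nonneg [simp]: "0 \<le> v x"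
    and v_eq_0 [simp]: "v x = 0 \<longleftrightarrow> x = 0"
    and v_mult [simp]: "v (x * y) = v x * v y"
    and v_add: "v (x + y) \<le> max (v x) (v y)"
begin

lemma v_zero [simp]: "v 0 = 0"
  by simp

lemma v_pos [simp]: "0 < v x \<longleftrightarrow> x \<noteq> 0"
  using v_nonneg[of x] v_eq_0[of x] by (auto simp: less_le simp del: v_nonneg v_eq_0)

lemma v_one [simp]: "v 1 = 1"
  using v_mult[of 1 1] v_eq_0[of 1] by (auto simp del: v_mult)

lemma v_minus_one: "v (- 1) = 1"
proof -
  have "v (- 1) * v (- 1) = 1" using v_mult[of "- 1" "- 1"] by simp
  then have "v (- 1) = 1 \<or> v (- 1) = - 1" by (simp add: square_eq_1_iff)
  moreover have "v (- 1) \<noteq> - 1" using v_nonneg[of "- 1"] by (metis neg_0_le_iff_le not_one_le_zero)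
  ultimately show ?thesis by simp
qed

lemma v_uminus [simp]: "v (- x) = v x"
  using v_mult[of "- 1" x] v_minus_one by simp

lemma v_diff: "v (x - y) \<le> max (v x) (v y)"
  using v_add[of x "- y"] by simp

lemma v_inverse [simp]: "v (inverse x) = inverse (v x)"
proof (cases "x = 0")
  case False
  then have "v x * v (inverse x) = 1" using v_mult[of x "inverse x"] by simp
  then show ?thesis by (metis inverse_unique)
next
  case True then show ?thesis by (simp del: v_eq_0)
qed

lemma v_divide [simp]: "v (x / y) = v x / v y" by (simp add: divide_inverse)

lemma v_diff_eq: assumes "v y < v x" shows "v (x - y) = v x"
proof (rule antisym)
  show "v (x - y) \<le> v x" using v_diff[of x y] assms by simp
  show "v x \<le> v (x - y)" using v_add[of "x - y" y] assms by (simp add: le_max_iff_disj)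
qed

text \<open>The factor \<open>c\<close> stands for the norm of a fixed first tensor factor.\<close>

lemma v_sum_lesssim:
  assumes "\<And>a. a \<in> A \<Longrightarrow> c * v (f a) \<preceq> s" "0 \<le> c" "0 \<le> s"
  shows "c * v (sum f A) \<preceq> s"
  using assms(1)
proof (induction A rule: infinite_finite_induct)
  case (insert a A)
  have "v (sum f (insert a A)) \<le> v (f a) \<or> v (sum f (insert a A)) \<le> v (sum f A)"
    using v_add[of "f a" "sum f A"] insert by (auto simp: le_max_iff_disj)
  then have "c * v (sum f (insert a A)) \<le> c * v (f a) \<or> c * v (sum f (insert a A)) \<le> c * v (sum f A)"
    using assms(2) by (auto intro: mult_left_mono)
  then show ?case
  proof
    assume h: "c * v (sum f (insert a A)) \<le> c * v (f a)"
    show ?thesis by (rule lesssim_trans[OF lesssim_le[OF h] insert.prems]) (use assms in auto)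
  next
    assume h: "c * v (sum f (insert a A)) \<le> c * v (sum f A)"
    show ?thesis by (rule lesssim_trans[OF lesssim_le[OF h] insert.IH]) (use assms insert.prems in auto)
  qed
qed (use assms in \<open>auto intro: lesssim_le simp del: v_eq_0\<close>)

text \<open>This ring contains all \<open>c\<close> with \<open>v c \<le> 1\<close> and also those
  whose value exceeds 1 by an infinitesimal; values infinitely close to 1 thus belong to
  units.\<close>

lemma valuation_ring: "valuation_ring {c. v c \<preceq> 1}"
proof
  show "1 \<in> {c. v c \<preceq> 1}" by simp
next
  fix x y assume "x \<in> {c. v c \<preceq> 1}" "y \<in> {c. v c \<preceq> 1}"
  then have h: "v x \<preceq> 1" "v y \<preceq> 1" by auto
  have "v (x + y) \<preceq> max (v x) (v y)" by (rule lesssim_le[OF v_add]) (simp add: le_max_iff_disj)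
  moreover have "max (v x) (v y) \<preceq> 1" using h by (simp add: max_def)
  ultimately show "x + y \<in> {c. v c \<preceq> 1}" using lesssim_trans by (metis mem_Collect_eq zero_le_one)
  show "x * y \<in> {c. v c \<preceq> 1}" using lesssim_mult[OF h] by simp
  show "- x \<in> {c. v c \<preceq> 1}" using h by simp
next
  fix x show "x \<in> {c. v c \<preceq> 1} \<or> inverse x \<in> {c. v c \<preceq> 1}"
  proof (cases "v x \<le> 1")
    case True then show ?thesis by (auto intro: lesssim_le)
  next
    case False
    then have "inverse (v x) \<le> 1" by (intro inverse_le_1_iff[THEN iffD2]) auto
    then show ?thesis by (auto intro: lesssim_le)
  qed
qed

end

locale valued_ext = field_hom i + base: valued v + valued w
  for i :: "'e::field \<Rightarrow> 'f::field" and v :: "'e \<Rightarrow> 'h::linordered_field" and w :: "'f \<Rightarrow> 'h" +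
  assumes w_hom [simp]: "w (i c) = v c"


locale alg_closed_ext = valued_ext i v w
  for i :: "'e::alg_closed_field \<Rightarrow> 'f::field" and v :: "'e \<Rightarrow> 'h::linordered_field" and w :: "'f \<Rightarrow> 'h"

text \<open>The set \<open>{x. \<not> 1 \<preceq> w x}\<close> is the maximal ideal of the valuation
  ring \<open>{x. w x \<preceq> 1}\<close>, so the closure properties come from the ultrametric
  inequality and multiplicativity.\<close>

sublocale alg_closed_ext \<subseteq> place_extension i "{c. v c \<preceq> 1}" "{x. \<not> 1 \<preceq> w x}"
proof -
  interpret valuation_ring "{c. v c \<preceq> 1}" by (rule base.valuation_ring)
  have less: "w x < 1" if "\<not> 1 \<preceq> w x" for x using not_lesssim_less[OF that] by simp
  let ?R = "{c. v c \<preceq> 1}" and ?m = "{x. \<not> 1 \<preceq> w x}"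
  show "place_extension i ?R ?m"
  proof
    show "0 \<in> ?m" by (auto dest: lesssim_pos)
    show "1 \<notin> ?m" by simp
  next
    fix x y assume "x \<in> ?m" "y \<in> ?m"
    then have h: "\<not> 1 \<preceq> w x" "\<not> 1 \<preceq> w y" by auto
    have "\<not> 1 \<preceq> w (x + y)"
    proof
      assume "1 \<preceq> w (x + y)"
      then have "1 \<preceq> max (w x) (w y)" using lesssim_trans[OF _ lesssim_le[OF v_add]]
        by (simp add: le_max_iff_disj)
      then show False using h by (simp add: max_def split: if_splits)
    qed
    then show "x + y \<in> ?m" by simp
    have "\<not> 1 \<preceq> w (x * y)"
    proof
      assume a: "1 \<preceq> w (x * y)"
      have "w (x * y) \<le> w x * 1" using less[OF h(2)] by (simp add: mult_left_le)
      then show False using h a lesssim_trans[OF a lesssim_le] by simp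
    qed
    then show "x * y \<in> ?m" by simp
  next
    fix c x assume "c \<in> ?R" "x \<in> ?m"
    then have h: "v c \<preceq> 1" "\<not> 1 \<preceq> w x" by auto
    have "v c * w x \<preceq> 1 * w x" by (rule lesssim_mult) (use h in auto)
    then have "\<not> 1 \<preceq> w (i c * x)" using h lesssim_trans[of 1 "v c * w x" "w x"] by auto
    then show "i c * x \<in> ?m" by simp
  next
    fix c assume "c \<in> ?R" "inverse c \<notin> ?R"
    then have h: "\<not> inverse (v c) \<preceq> 1" by simp
    have "\<not> 1 \<preceq> v c"
    proof
      assume a: "1 \<preceq> v c"
      then have p: "0 < v c" using lesssim_pos zero_less_one by blast
      have "inverse (v c) * 1 \<preceq> inverse (v c) * v c" by (rule lesssim_mult_left[OF a]) simp
      then show False using h p by simp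
    qed
    then show "i c \<in> ?m" by simp
  qed
qed

section \<open>Leading terms\<close>

text \<open>
  The relation \<open>ok\<close> plays the role of a section of the value group of the base field over all positive
  values. It is total when the base field is trivially valued, and relates \<open>c\<close> to \<open>v c\<close> otherwise.
\<close>

locale tensor_place =
  K: alg_closed_ext i v w + P: maximal_place i "{c. v c \<preceq> 1}" "{x. \<not> 1 \<preceq> w x}" J +
  L: valued_ext j v w'
  for i :: "'e::alg_closed_field \<Rightarrow> 'f::field" and j :: "'e \<Rightarrow> 'g::field"
    and v :: "'e \<Rightarrow> 'h::linordered_field" and w :: "'f \<Rightarrow> 'h" and w' :: "'g \<Rightarrow> 'h" and J +
  fixes ok :: "'e \<Rightarrow> 'h \<Rightarrow> bool"
  assumes ok_ex: "0 < r \<Longrightarrow> \<exists>c. c \<noteq> 0 \<and> ok c r"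
    and ok_mult: "c \<noteq> 0 \<Longrightarrow> d \<noteq> 0 \<Longrightarrow> 0 < r \<Longrightarrow> 0 < s \<Longrightarrow> ok c r \<Longrightarrow> ok d s \<Longrightarrow> ok (c * d) (r * s)"
    and ok_inverse: "c \<noteq> 0 \<Longrightarrow> 0 < r \<Longrightarrow> ok c r \<Longrightarrow> ok (inverse c) (inverse r)"
    and ok_cong: "0 < r \<Longrightarrow> ok c r \<Longrightarrow> r \<asymp> s \<Longrightarrow> ok c s"
    and ok_self: "c \<noteq> 0 \<Longrightarrow> ok c (v c)"
    and ok_one: "c \<noteq> 0 \<Longrightarrow> ok c 1 \<Longrightarrow> 1 \<preceq> v c"
begin

text \<open>The place refines the valuation: if the value of \<open>x\<close> exceeded 1 by more
  than an infinitesimal, \<open>inverse x\<close> would be in \<open>m\<close> and hence in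
  \<open>J\<close>, which would put \<open>1\<close> in \<open>J\<close>.\<close>

lemma in_B_lesssim: assumes "x \<in> P.B" shows "w x \<preceq> 1"
proof (rule ccontr)
  assume n: "\<not> w x \<preceq> 1"
  then have x: "1 < w x" using not_lesssim_less[of "w x" 1] by simp
  then have x0: "x \<noteq> 0" by (auto)
  have "\<not> 1 \<preceq> inverse (w x)"
  proof
    assume "1 \<preceq> inverse (w x)"
    then have "w x * 1 \<preceq> w x * inverse (w x)" by (rule lesssim_mult_left) simp
    then show False using n x0 by simp
  qed
  then have "inverse x \<in> J" by (intro P.m_sub) simp
  then have "x * inverse x \<in> J" using P.BJ assms by blast
  then show False using x0 P.J_one by simp
qed

text \<open>Otherwise \<open>inverse c\<close> would lie in the valuation ring of the scalars and
  carry \<open>i c\<close> to \<open>1\<close> inside \<open>J\<close>. On scalars the place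
  therefore sees no more than the valuation.\<close>

lemma hom_in_J: assumes "i c \<in> J" shows "\<not> 1 \<preceq> v c"
proof
  assume a: "1 \<preceq> v c"
  then have p: "0 < v c" using lesssim_pos zero_less_one by blast
  have "inverse (v c) * 1 \<preceq> inverse (v c) * v c" by (rule lesssim_mult_left[OF a]) simp
  then have "i (inverse c) * i c \<in> J" using p by (intro P.J_scale assms) simp
  then show False using p P.J_one K.hom_eq_0_iff[of c] by (simp add: K.hom_inverse)
qed

lemma not_in_J_lesssim: "x \<notin> J \<Longrightarrow> 1 \<preceq> w x" using P.m_sub by blast

lemma not_in_J_inverse: "x \<notin> J \<Longrightarrow> inverse x \<in> P.B"
  using P.not_in_B_imp_inverse_in_J[of "inverse x"] by auto

text \<open>
  After rescaling by \<open>ok\<close>, \<open>f \<otimes> h\<close> is strictly lower than \<open>f0 \<otimes> h0\<close> at the place. This is only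
  meaningful for terms of the same norm.
\<close>

definition below :: "'f \<Rightarrow> 'g \<Rightarrow> 'f \<Rightarrow> 'g \<Rightarrow> bool" where
  "below f h f0 h0 \<longleftrightarrow> (\<exists>c. c \<noteq> 0 \<and> ok c (w' h / w' h0) \<and> i c * f / f0 \<in> J)"

text \<open>Norms decide first, and the place only breaks ties, in the manner of a lexicographic
  order.\<close>

definition leading :: "'a set \<Rightarrow> ('a \<Rightarrow> 'f) \<Rightarrow> ('a \<Rightarrow> 'g) \<Rightarrow> 'a \<Rightarrow> bool" where
  "leading A f h a0 \<longleftrightarrow> finite A \<and> a0 \<in> A \<and> f a0 \<noteq> 0 \<and> h a0 \<noteq> 0 \<and>
     (\<forall>a\<in>A - {a0}. w (f a) * w' (h a) \<preceq> w (f a0) * w' (h a0) \<and>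
        (w (f a0) * w' (h a0) \<preceq> w (f a) * w' (h a) \<longrightarrow> below (f a) (h a) (f a0) (h a0)))"

text \<open>Gaussian elimination on the matrix \<open>\<alpha>\<close> removes one term at a time.
  The pivot \<open>b\<close> is different from \<open>a0\<close> and has maximal place in its
  column; this keeps the corrections to the other terms low enough for \<open>a0\<close> to remain
  leading. Such a pivot exists at every stage, so the descent on \<open>card A\<close> ends in a
  contradiction.\<close>

lemma leading_not_null:
  assumes "leading A f h a0" "\<And>a. a \<in> A \<Longrightarrow> h a = (\<Sum>s\<in>S. j (\<alpha> a s) * z s)"
    "\<And>s. s \<in> S \<Longrightarrow> (\<Sum>a\<in>A. i (\<alpha> a s) * f a) = 0"
  shows False
  using assms
proof (induction "card A" arbitrary: A h \<alpha> rule: less_induct)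
  case less
  let ?n = "\<lambda>a. w (f a) * w' (h a)"
  have fin: "finite A" and o: "a0 \<in> A" and fo: "f a0 \<noteq> 0" and ho: "h a0 \<noteq> 0"
    and small: "\<And>a. a \<in> A \<Longrightarrow> ?n a \<preceq> ?n a0"
    and lead: "\<And>a. a \<in> A \<Longrightarrow> a \<noteq> a0 \<Longrightarrow> ?n a0 \<preceq> ?n a \<Longrightarrow> below (f a) (h a) (f a0) (h a0)"
  proof -
    show "finite A" "a0 \<in> A" "f a0 \<noteq> 0" "h a0 \<noteq> 0" using less.prems(1) by (simp_all add: leading_def)
    show "?n a \<preceq> ?n a0" if "a \<in> A" for a
      using less.prems(1) that by (cases "a = a0") (simp_all add: leading_def)
    show "below (f a) (h a) (f a0) (h a0)" if "a \<in> A" "a \<noteq> a0" "?n a0 \<preceq> ?n a" for a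
      using less.prems(1) that by (simp add: leading_def)
  qed
  have "\<exists>s\<in>S. \<alpha> a0 s \<noteq> 0"
  proof (rule ccontr)
    assume "\<not> ?thesis"
    then have "h a0 = 0" using less.prems(2)[OF o] by (simp add: L.hom_zero)
    then show False using ho by simp
  qed
  then obtain s where s: "s \<in> S" "\<alpha> a0 s \<noteq> 0" by blast
  define t where "t a = i (\<alpha> a s) * f a" for a
  define A' where "A' = {a\<in>A. t a \<noteq> 0}"
  have to: "a0 \<in> A'" using o s fo by (simp add: A'_def t_def K.hom_eq_0_iff)
  have finA': "finite A'" using fin by (simp add: A'_def)
  \<comment> \<open>Maximality is taken at the place and not in the norm: since \<open>B\<close> is
    a valuation ring, membership of quotients in \<open>B\<close> is a total preorder on the nonzero
    column entries.\<close>
  have "\<exists>b\<in>A'. \<forall>a\<in>A'. t a / t b \<in> P.B"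
  proof (rule finite_total_preorder_greatest[OF finA'])
    show "A' \<noteq> {}" using to by blast
    show "t a / t b \<in> P.B \<or> t b / t a \<in> P.B" for a b
      using P.J_B[OF P.not_in_B_imp_inverse_in_J[of "t a / t b"]] by auto
    show "t a / t c \<in> P.B" if "b \<in> A'" "t a / t b \<in> P.B" "t b / t c \<in> P.B" for a b c
      using P.B_mult[OF that(2,3)] that(1) by (simp add: A'_def)
  qed
  then obtain b0 where b0: "b0 \<in> A'" "\<And>a. a \<in> A' \<Longrightarrow> t a / t b0 \<in> P.B" by blast
  have sum_t: "sum t A' = 0"
  proof -
    have "sum t A' = sum t A" unfolding A'_def by (intro sum.mono_neutral_left) (auto simp: fin)
    then show ?thesis using less.prems(3)[OF s(1)] by (simp add: t_def)
  qed
  obtain b where b: "b \<in> A'" "b \<noteq> a0" "\<And>a. a \<in> A' \<Longrightarrow> t a / t b \<in> P.B"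
  proof (cases "b0 = a0")
    case False then show ?thesis using that b0 by blast
  next
    \<comment> \<open>If the maximum is at \<open>a0\<close>, the vanishing column sum makes the
      other quotients add up to \<open>-1\<close>, which is not in \<open>J\<close>. Hence some
      other term is equally high and can be the pivot.\<close>
    case True
    have ne: "t a0 \<noteq> 0" using to by (simp add: A'_def)
    have "(\<Sum>a\<in>A' - {a0}. t a / t a0) = - 1"
    proof -
      have "t a0 + sum t (A' - {a0}) = 0" using sum_t sum.remove[OF finA' to, of t] by simp
      then have "sum t (A' - {a0}) = - t a0" by (simp add: eq_neg_iff_add_eq_0 add.commute)
      then show ?thesis using ne by (simp add: sum_divide_distrib[symmetric])
    qed
    moreover have "- 1 \<notin> J" using P.J_uminus[of "- 1"] P.J_one by auto
    ultimately obtain a where a: "a \<in> A'" "a \<noteq> a0" "t a / t a0 \<notin> J" using P.J_sum[of "A' - {a0}" "\<lambda>a. t a / t a0"] by auto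
    have na: "t a \<noteq> 0" using a by (simp add: A'_def)
    have c: "t a0 / t a \<in> P.B" using not_in_J_inverse[OF a(3)] by simp
    have "t e / t a \<in> P.B" if "e \<in> A'" for e
      using P.B_mult[OF b0(2)[OF that] c] True ne by simp
    then show ?thesis using that a by blast
  qed
  have bA: "b \<in> A" and tb: "t b \<noteq> 0" using b by (auto simp: A'_def)
  have fb: "f b \<noteq> 0" and ab: "\<alpha> b s \<noteq> 0" using tb by (auto simp: t_def K.hom_zero)
  \<comment> \<open>The column relation says that \<open>f b\<close> is minus the sum of the
    \<open>i (d a) * f a\<close> with \<open>a\<close> other than \<open>b\<close>. Substituting
    this for \<open>f b\<close> in the tensor turns \<open>h a\<close> into
    \<open>h a - j (d a) * h b\<close>.\<close>
  define d where "d a = \<alpha> a s / \<alpha> b s" for a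
  have db: "d b = 1" using ab by (simp add: d_def)
  have dB: "i (d a) * f a / f b \<in> P.B" if "a \<in> A" for a
  proof -
    have "i (d a) * f a / f b = t a / t b" by (simp add: d_def t_def K.hom_divide)
    then show ?thesis using b(3)[of a] that P.B_zero by (cases "t a = 0") (auto simp: A'_def)
  qed
  have d_o: "d a0 \<noteq> 0" using s ab by (simp add: d_def)
  define h' where "h' a = h a - j (d a) * h b" for a
  define \<alpha>' where "\<alpha>' a s = \<alpha> a s - d a * \<alpha> b s" for a s
  let ?q = "\<lambda>a. w (f a) * (v (d a) * w' (h b))"
  have q: "?q a \<preceq> ?n b" if "a \<in> A" for a
  proof -
    have "w (i (d a) * f a / f b) * ?n b \<preceq> 1 * ?n b"
      by (rule lesssim_mult[OF in_B_lesssim[OF dB[OF that]]]) auto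
    then show ?thesis using fb by (simp add: ac_simps)
  qed
  have no_pos: "0 < ?n a0" using fo ho by simp
  have nbo: "?n b \<preceq> ?n a0" using small bA by blast
  have below_b: "below (f b) (h b) (f a0) (h a0)" if "?n a0 \<preceq> ?q a" "a \<in> A" for a
    using lead[OF bA b(2)] lesssim_trans[OF that(1) q[OF that(2)]] by simp
  have hb0: "h b \<noteq> 0" if "?n a0 \<preceq> ?q a" for a
    using lesssim_pos[OF that no_pos] by (auto)
  \<comment> \<open>If the correction at \<open>a0\<close> reached the norm of the leading term, the
    pivot would tie with \<open>a0\<close> and hence be below it. Together with the maximality of
    the pivot this puts the scalar \<open>c * d a0\<close> in \<open>J\<close>, although
    \<open>ok\<close> assigns it the value 1.\<close>
  have not_o: "\<not> ?n a0 \<preceq> ?q a0"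
  proof
    assume a: "?n a0 \<preceq> ?q a0"
    obtain c where c: "c \<noteq> 0" "ok c (w' (h b) / w' (h a0))" "i c * f b / f a0 \<in> J"
      using below_b[OF a o] by (auto simp: below_def)
    have "?q a0 \<preceq> ?n a0" using lesssim_trans[OF q[OF o] nbo] by simp
    then have e: "v (d a0) * w' (h b) \<asymp> w' (h a0)"
      by (intro simeq_cancel[of "w (f a0)", OF _ simeq_def[THEN iffD2, OF conjI]]) (use a fo in simp_all)
    have "ok (c * d a0) (w' (h b) / w' (h a0) * v (d a0))"
      using c d_o hb0[OF a] ho by (intro ok_mult ok_self) auto
    moreover have "w' (h b) / w' (h a0) * v (d a0) \<asymp> 1"
    proof -
      have "(v (d a0) * w' (h b)) / w' (h a0) \<asymp> w' (h a0) / w' (h a0)"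
        by (rule simeq_divide[OF _ _ _ _ e]) (use d_o hb0[OF a] ho in \<open>simp_all add: simeq_def\<close>)
      then show ?thesis using ho by (simp add: mult.commute)
    qed
    ultimately have "ok (c * d a0) 1"
      using d_o hb0[OF a] ho ok_cong[of "w' (h b) / w' (h a0) * v (d a0)" "c * d a0" 1] by simp
    then have "1 \<preceq> v (c * d a0)" using c d_o by (intro ok_one) auto
    moreover have "i (c * d a0) \<in> J"
      using P.BJ[OF dB[OF o] c(3)] fb fo by (simp add: K.hom_mult ac_simps)
    ultimately show False using hom_in_J by blast
  qed
  have h'o: "w' (h' a0) = w' (h a0)"
  proof -
    have "?q a0 < ?n a0" using not_lesssim_less[OF not_o] by simp
    then have "w' (j (d a0) * h b) < w' (h a0)" using fo by (simp add: mult_less_cancel_left_pos)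
    then show ?thesis unfolding h'_def by (rule L.v_diff_eq)
  qed
  have h'o0: "h' a0 \<noteq> 0" using L.v_pos[of "h' a0"] L.v_pos[of "h a0"] h'o ho by simp
  have "leading (A - {b}) f h' a0"
    unfolding leading_def
  proof (intro conjI ballI impI)
    fix a assume a: "a \<in> A - {b} - {a0}"
    let ?n' = "w (f a) * w' (h' a)"
    have "w' (h' a) \<le> max (w' (h a)) (v (d a) * w' (h b))"
      using L.v_diff[of "h a" "j (d a) * h b"] by (simp add: h'_def)
    then have "?n' \<le> w (f a) * max (w' (h a)) (v (d a) * w' (h b))" by (rule mult_left_mono) simp
    also have "\<dots> = max (?n a) (?q a)" by (simp add: max_mult_distrib_left)
    finally have n': "?n' \<preceq> max (?n a) (?q a)" by (rule lesssim_le) (simp add: le_max_iff_disj)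
    have qo: "?q a \<preceq> ?n a0" using lesssim_trans[OF q nbo] a by simp
    have "max (?n a) (?q a) \<preceq> ?n a0" using small[of a] qo a by (simp add: max_def)
    then have n'o: "?n' \<preceq> ?n a0" using lesssim_trans[OF n'] by simp
    then show "?n' \<preceq> w (f a0) * w' (h' a0)" by (simp add: h'o)
    assume "w (f a0) * w' (h' a0) \<preceq> ?n'"
    then have on': "?n a0 \<preceq> ?n'" by (simp add: h'o)
    have fa: "f a \<noteq> 0" and h'a: "h' a \<noteq> 0" using lesssim_pos[OF on' no_pos] by auto
    have "?n a0 \<preceq> max (?n a) (?q a)" using lesssim_trans[OF on' n'] by (simp add: le_max_iff_disj)
    \<comment> \<open>A tie of the new term stems from the old term or from its correction. In the
      first case the old scalar \<open>c\<close> still serves. In the second \<open>d a * c\<close>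
      does, because the quotient factors through \<open>f b\<close> into an element of
      \<open>B\<close> and one of \<open>J\<close>.\<close>
    then have "?n a0 \<preceq> ?n a \<or> ?n a0 \<preceq> ?q a" by (simp add: lesssim_max)
    then show "below (f a) (h' a) (f a0) (h' a0)"
    proof
      assume na: "?n a0 \<preceq> ?n a"
      obtain c where c: "c \<noteq> 0" "ok c (w' (h a) / w' (h a0))" "i c * f a / f a0 \<in> J"
        using lead[OF _ _ na] a by (auto simp: below_def)
      have ha: "h a \<noteq> 0" using lesssim_pos[OF na no_pos] by auto
      have "?n a \<asymp> ?n'" using lesssim_trans[OF _ na] lesssim_trans[OF _ on'] small[of a] n'o a
        by (auto simp: simeq_def)
      then have hh: "w' (h a) \<asymp> w' (h' a)" by (rule simeq_cancel[rotated]) (use fa in simp)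
      have "w' (h a) / w' (h a0) \<asymp> w' (h' a) / w' (h' a0)"
        unfolding h'o by (rule simeq_divide) (use hh ha h'a ho in \<open>auto simp: simeq_def\<close>)
      then have "ok c (w' (h' a) / w' (h' a0))"
        using ok_cong[OF _ c(2)] ha ho by simp
      then show ?thesis using c by (auto simp: below_def)
    next
      assume qa: "?n a0 \<preceq> ?q a"
      have aA: "a \<in> A" using a by blast
      obtain c where c: "c \<noteq> 0" "ok c (w' (h b) / w' (h a0))" "i c * f b / f a0 \<in> J"
        using below_b[OF qa aA] by (auto simp: below_def)
      have da: "d a \<noteq> 0" using lesssim_pos[OF qa no_pos] by (auto)
      have "?q a \<asymp> ?n'" using lesssim_trans[OF _ qa] lesssim_trans[OF _ on'] qo n'o a
        by (auto simp: simeq_def)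
      then have hh: "v (d a) * w' (h b) \<asymp> w' (h' a)" by (rule simeq_cancel[rotated]) (use fa in simp)
      have "(v (d a) * w' (h b)) / w' (h a0) \<asymp> w' (h' a) / w' (h' a0)"
        unfolding h'o by (rule simeq_divide) (use hh da hb0[OF qa] h'a ho in \<open>auto simp: simeq_def\<close>)
      moreover have "ok (d a * c) (v (d a) * (w' (h b) / w' (h a0)))"
        using c da hb0[OF qa] ho by (intro ok_mult ok_self) auto
      ultimately have "ok (d a * c) (w' (h' a) / w' (h' a0))"
        using da hb0[OF qa] ho ok_cong[of "v (d a) * (w' (h b) / w' (h a0))" "d a * c"] by simp
      moreover have "i (d a * c) * f a / f a0 \<in> J"
        using P.BJ[OF dB[OF aA] c(3)] fb fo by (simp add: K.hom_mult ac_simps)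
      ultimately show ?thesis using c da unfolding below_def by (intro exI[of _ "d a * c"]) auto
    qed
  qed (use fin o b fo h'o0 in auto)
  moreover have "h' a = (\<Sum>s\<in>S. j (\<alpha>' a s) * z s)" if "a \<in> A - {b}" for a
    using that bA by (simp add: h'_def \<alpha>'_def less.prems(2) L.hom_diff L.hom_mult sum_distrib_left
        algebra_simps sum_subtractf)
  moreover have "(\<Sum>a\<in>A - {b}. i (\<alpha>' a s') * f a) = 0" if "s' \<in> S" for s'
  proof -
    have "(\<Sum>a\<in>A - {b}. i (\<alpha>' a s') * f a) = (\<Sum>a\<in>A. i (\<alpha>' a s') * f a)"
      using sum.remove[OF fin bA, of "\<lambda>a. i (\<alpha>' a s') * f a"] by (simp add: \<alpha>'_def db K.hom_zero)
    also have "\<dots> = (\<Sum>a\<in>A. i (\<alpha> a s') * f a) - i (\<alpha> b s') / i (\<alpha> b s) * (\<Sum>a\<in>A. i (\<alpha> a s) * f a)"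
      by (simp add: \<alpha>'_def d_def K.hom_diff K.hom_mult K.hom_divide sum_distrib_left algebra_simps sum_subtractf)
    finally show ?thesis using less.prems(3) that s by simp
  qed
  moreover have "card (A - {b}) < card A" using fin bA by (rule card_Diff1_less)
  ultimately show False using less.hyps by blast
qed

lemma leading_Plus:
  assumes "leading A f h a" "finite C"
    "\<And>c. c \<in> C \<Longrightarrow> \<not> w (f a) * w' (h a) \<preceq> w (u c) * w' (t c)"
  shows "leading (A <+> C) (case_sum f u) (case_sum h t) (Inl a)"
proof -
  have "w (u c) * w' (t c) \<preceq> w (f a) * w' (h a)" if "c \<in> C" for c
    using assms(3)[OF that] lesssim_linear[of "w (u c) * w' (t c)" "w (f a) * w' (h a)"] by simp
  then show ?thesis using assms unfolding leading_def by (auto simp: Plus_def)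
qed

text \<open>Norms multiply, so a product ties with the leading product only if both factors tie. The
  rescaled quotients then lie in \<open>B\<close>, one of them lies in \<open>J\<close> unless both
  factors are leading, and the scalars multiply.\<close>

lemma leading_prod:
  assumes A: "leading A x y a0" and A': "leading A' x' y' b0"
  shows "leading (A \<times> A') (\<lambda>(a, b). x a * x' b) (\<lambda>(a, b). y a * y' b) (a0, b0)"
proof -
  have *: "w (x a) * w' (y a) \<preceq> w (x a0) * w' (y a0)"
    if "leading A x y a0" "a \<in> A" for A :: "'z set" and x y a a0
    using that by (cases "a = a0") (simp_all add: leading_def)
  \<comment> \<open>With the witness \<open>c = 1\<close> the leading term is treated on the same
    footing as the terms tied with it.\<close>
  have **: "\<exists>c. c \<noteq> 0 \<and> ok c (w' (y a) / w' (y a0)) \<and> i c * x a / x a0 \<in> P.B \<and>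
      (a \<noteq> a0 \<longrightarrow> i c * x a / x a0 \<in> J)"
    if l: "leading A x y a0" and a: "a \<in> A" and n: "w (x a0) * w' (y a0) \<preceq> w (x a) * w' (y a)"
    for A :: "'z set" and x y a a0
  proof (cases "a = a0")
    case True
    have "x a0 \<noteq> 0" "y a0 \<noteq> 0" using l by (simp_all add: leading_def)
    then show ?thesis using True ok_self[of 1] P.B_one by (intro exI[of _ 1]) (simp add: K.hom_one)
  next
    case False
    then have "below (x a) (y a) (x a0) (y a0)" using l a n by (simp add: leading_def)
    then show ?thesis using P.J_B unfolding below_def by blast
  qed
  let ?n = "\<lambda>a. w (x a) * w' (y a)" and ?n' = "\<lambda>b. w (x' b) * w' (y' b)"
  have nz: "x a0 \<noteq> 0" "y a0 \<noteq> 0" "x' b0 \<noteq> 0" "y' b0 \<noteq> 0"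
    using A A' by (simp_all add: leading_def)
  have e: "w (x a * x' b) * w' (y a * y' b) = ?n a * ?n' b" for a b by (simp add: ac_simps)
  have main: "w (x a * x' b) * w' (y a * y' b) \<preceq> w (x a0 * x' b0) * w' (y a0 * y' b0) \<and>
      (w (x a0 * x' b0) * w' (y a0 * y' b0) \<preceq> w (x a * x' b) * w' (y a * y' b) \<longrightarrow>
        below (x a * x' b) (y a * y' b) (x a0 * x' b0) (y a0 * y' b0))"
    if ab: "a \<in> A" "b \<in> A'" "(a, b) \<noteq> (a0, b0)" for a b
    unfolding e
  proof (intro conjI impI)
    show "?n a * ?n' b \<preceq> ?n a0 * ?n' b0"
      by (rule lesssim_mult) (use *[OF A ab(1)] *[OF A' ab(2)] in auto)
    assume h: "?n a0 * ?n' b0 \<preceq> ?n a * ?n' b"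
    have "?n a * ?n' b \<preceq> ?n a * ?n' b0" by (rule lesssim_mult_left[OF *[OF A' ab(2)]]) simp
    then have "?n' b0 * ?n a0 \<preceq> ?n' b0 * ?n a"
      using lesssim_trans[OF h] by (simp only: mult.commute[of "?n' b0"]) simp
    then have na: "?n a0 \<preceq> ?n a" by (rule lesssim_cancel[rotated]) (use nz in simp)
    have "?n a * ?n' b \<preceq> ?n a0 * ?n' b" by (rule lesssim_mult) (use *[OF A ab(1)] in auto)
    then have "?n a0 * ?n' b0 \<preceq> ?n a0 * ?n' b" using lesssim_trans[OF h] by simp
    then have nb: "?n' b0 \<preceq> ?n' b" by (rule lesssim_cancel[rotated]) (use nz in simp)
    obtain c where c: "c \<noteq> 0" "ok c (w' (y a) / w' (y a0))" "i c * x a / x a0 \<in> P.B"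
      "a \<noteq> a0 \<longrightarrow> i c * x a / x a0 \<in> J" using **[OF A ab(1) na] by blast
    obtain d where d: "d \<noteq> 0" "ok d (w' (y' b) / w' (y' b0))" "i d * x' b / x' b0 \<in> P.B"
      "b \<noteq> b0 \<longrightarrow> i d * x' b / x' b0 \<in> J" using **[OF A' ab(2) nb] by blast
    have pos: "0 < ?n a" "0 < ?n' b"
      by (rule lesssim_pos[OF na], use nz in simp, rule lesssim_pos[OF nb], use nz in simp)
    then have y: "y a \<noteq> 0" "y' b \<noteq> 0" by auto
    have "ok (c * d) (w' (y a) / w' (y a0) * (w' (y' b) / w' (y' b0)))"
      using c d y nz by (intro ok_mult) auto
    then have ok: "ok (c * d) (w' (y a * y' b) / w' (y a0 * y' b0))" by simp
    have BJ: "p * q \<in> J" if "p \<in> P.B" "q \<in> P.B" "p \<in> J \<or> q \<in> J" for p q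
      using that P.BJ[of p q] P.BJ[of q p] by (auto simp: mult.commute)
    have "i c * x a / x a0 \<in> J \<or> i d * x' b / x' b0 \<in> J" using ab(3) c(4) d(4) by blast
    then have "(i c * x a / x a0) * (i d * x' b / x' b0) \<in> J" by (rule BJ[OF c(3) d(3)])
    then have "i (c * d) * (x a * x' b) / (x a0 * x' b0) \<in> J" by (simp add: K.hom_mult ac_simps)
    then show "below (x a * x' b) (y a * y' b) (x a0 * x' b0) (y a0 * y' b0)"
      unfolding below_def using ok c(1) d(1) by (intro exI[of _ "c * d"]) auto
  qed
  show ?thesis unfolding leading_def
    using A A' nz main by (auto simp: leading_def simp del: K.v_mult L.v_mult)
qed

text \<open>
  Among the terms of maximal norm choose one of maximal place; subtracting from the others their
  residues relative to it makes them strictly lower in the place, without creating new maximal terms.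
\<close>

lemma leading_reduce:
  fixes x :: "'a \<Rightarrow> 'f" and y :: "'a \<Rightarrow> 'g"
  assumes fin: "finite A" and pos: "0 < \<sigma>" and small: "\<And>a. a \<in> A \<Longrightarrow> w (x a) * w' (y a) \<preceq> \<sigma>"
    and a1: "a1 \<in> A" "\<sigma> \<preceq> w (x a1) * w' (y a1)"
  obtains a0 \<beta> x' y' where "a0 \<in> A" "\<sigma> \<preceq> w (x a0) * w' (y a0)" "\<beta> a0 = 0"
    "\<And>a. x' a = x a - i (\<beta> a) * x a0"
    "\<And>a. y' a = (if a = a0 then y a0 + (\<Sum>b\<in>A. j (\<beta> b) * y b) else y a)"
    "\<And>a. a \<in> A \<Longrightarrow> w (x' a) * w' (y' a) \<preceq> \<sigma>"
    "\<And>a. a \<in> A \<Longrightarrow> a \<noteq> a0 \<Longrightarrow> \<sigma> \<preceq> w (x' a) * w' (y' a) \<Longrightarrow> \<sigma> \<preceq> w (x a) * w' (y a)"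
    "\<sigma> \<preceq> w (x' a0) * w' (y' a0) \<Longrightarrow> leading A x' y' a0"
proof -
  let ?n = "\<lambda>a. w (x a) * w' (y a)"
  define M where "M = {a\<in>A. \<sigma> \<preceq> ?n a}"
  have finM: "finite M" using fin by (simp add: M_def)
  have nz: "x a \<noteq> 0 \<and> y a \<noteq> 0" if "a \<in> M" for a
    using lesssim_pos[of \<sigma> "?n a"] pos that by (auto simp: M_def)
  \<comment> \<open>The terms are compared at the place after their second factors have been
    rescaled. Two scalars that are \<open>ok\<close> for the same positive value differ by a unit of
    the valuation ring, so the choice of \<open>c\<close> does not affect membership in
    \<open>B\<close>.\<close>
  define leq where "leq a b \<longleftrightarrow> (\<exists>c. c \<noteq> 0 \<and> ok c (w' (y a) / w' (y b)) \<and> i c * x a / x b \<in> P.B)" for a b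
  have le_total: "leq a b \<or> leq b a" if ab: "a \<in> M" "b \<in> M" for a b
  proof -
    obtain c where c: "c \<noteq> 0" "ok c (w' (y a) / w' (y b))"
      using ok_ex[of "w' (y a) / w' (y b)"] nz ab by auto
    show ?thesis
    proof (cases "i c * x a / x b \<in> P.B")
      case True then show ?thesis using c by (auto simp: leq_def)
    next
      case False
      have "inverse (i c * x a / x b) \<in> P.B" using P.J_B[OF P.not_in_B_imp_inverse_in_J[OF False]] .
      moreover have "inverse (i c * x a / x b) = i (inverse c) * x b / x a"
        by (simp add: K.hom_inverse divide_inverse ac_simps)
      moreover have "ok (inverse c) (w' (y b) / w' (y a))"
        using ok_inverse[OF c(1) _ c(2)] nz ab by simp
      ultimately have "leq b a" unfolding leq_def using c(1) by (intro exI[of _ "inverse c"]) simp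
      then show ?thesis ..
    qed
  qed
  have le_trans: "leq a c" if abc: "a \<in> M" "b \<in> M" "c \<in> M" "leq a b" "leq b c" for a b c
  proof -
    obtain d where d: "d \<noteq> 0" "ok d (w' (y a) / w' (y b))" "i d * x a / x b \<in> P.B"
      using abc by (auto simp: leq_def)
    obtain e where e: "e \<noteq> 0" "ok e (w' (y b) / w' (y c))" "i e * x b / x c \<in> P.B"
      using abc by (auto simp: leq_def)
    have "ok (d * e) (w' (y a) / w' (y b) * (w' (y b) / w' (y c)))"
      using d e nz abc by (intro ok_mult) auto
    moreover have "i (d * e) * x a / x c \<in> P.B"
      using P.B_mult[OF d(3) e(3)] nz[OF abc(2)] by (simp add: K.hom_mult ac_simps)
    ultimately show ?thesis unfolding leq_def using d e nz[OF abc(2)] by (intro exI[of _ "d * e"]) auto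
  qed
  have "M \<noteq> {}" using a1 by (auto simp: M_def)
  then have "\<exists>b\<in>M. \<forall>a\<in>M. leq a b"
    by (rule finite_total_preorder_greatest[OF finM _ le_total le_trans])
  then obtain a0 where a0: "a0 \<in> M" "\<And>a. a \<in> M \<Longrightarrow> leq a a0" by blast
  have nz0: "x a0 \<noteq> 0" "y a0 \<noteq> 0" using nz a0 by auto
  have "\<exists>b. \<forall>a. (a \<notin> M - {a0} \<longrightarrow> b a = 0) \<and> (a \<in> M - {a0} \<longrightarrow>
      below (x a - i (b a) * x a0) (y a) (x a0) (y a0) \<and> v (b a) * w (x a0) \<preceq> w (x a))"
  proof (rule choice, rule allI)
    fix a
    show "\<exists>b. (a \<notin> M - {a0} \<longrightarrow> b = 0) \<and> (a \<in> M - {a0} \<longrightarrow>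
      below (x a - i b * x a0) (y a) (x a0) (y a0) \<and> v b * w (x a0) \<preceq> w (x a))"
    proof (cases "a \<in> M - {a0}")
      case False then show ?thesis by auto
    next
      case True
      then obtain c where c: "c \<noteq> 0" "ok c (w' (y a) / w' (y a0))" "i c * x a / x a0 \<in> P.B"
        using a0(2)[of a] by (auto simp: leq_def)
      have ic: "i c \<noteq> 0" using c K.hom_eq_0_iff by simp
      show ?thesis
      proof (cases "i c * x a / x a0 \<in> J")
        case J: True
        then have "below (x a - i 0 * x a0) (y a) (x a0) (y a0)"
          using c by (auto simp: below_def K.hom_zero)
        moreover have "v 0 * w (x a0) \<preceq> w (x a)"
          by (auto intro: lesssim_le)
        ultimately show ?thesis using True by blast
      next
        case nJ: False
        \<comment> \<open>The equality of residue fields is used here: the residue of the rescaled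
          quotient is that of a scalar \<open>b\<close>, and undoing the rescaling gives the
          coefficient \<open>b / c\<close>. A quotient outside \<open>J\<close> has value at least 1
          up to infinitesimals, so this subtraction does not raise the norm; quotients in
          \<open>J\<close> get the coefficient 0 instead.\<close>
        obtain b u where b: "v b \<preceq> 1" "u \<in> J" "i c * x a / x a0 = i b + u"
          using P.B_E[OF c(3)] by blast
        have "i c * (x a - i (b / c) * x a0) / x a0 = u"
          using b(3) ic nz0 by (simp add: K.hom_divide field_simps)
        then have "below (x a - i (b / c) * x a0) (y a) (x a0) (y a0)"
          using c b(2) by (auto simp: below_def)
        moreover have "v (b / c) * w (x a0) \<preceq> w (x a)"
        proof -
          have "1 \<preceq> v c * w (x a) / w (x a0)" using not_in_J_lesssim[OF nJ] by simp
          then have "v b \<preceq> v c * w (x a) / w (x a0)" using lesssim_trans[OF b(1)] by simp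
          then have "w (x a0) / v c * v b \<preceq> w (x a0) / v c * (v c * w (x a) / w (x a0))"
            by (rule lesssim_mult_left) simp
          then show ?thesis using c(1) nz0 by (simp add: ac_simps)
        qed
        ultimately show ?thesis using True by blast
      qed
    qed
  qed
  then obtain \<beta> where \<beta>: "\<And>a. a \<notin> M - {a0} \<Longrightarrow> \<beta> a = 0"
    "\<And>a. a \<in> M - {a0} \<Longrightarrow> below (x a - i (\<beta> a) * x a0) (y a) (x a0) (y a0)"
    "\<And>a. a \<in> M - {a0} \<Longrightarrow> v (\<beta> a) * w (x a0) \<preceq> w (x a)" by blast
  define x' where "x' a = x a - i (\<beta> a) * x a0" for a
  define y' where "y' a = (if a = a0 then y a0 + (\<Sum>b\<in>A. j (\<beta> b) * y b) else y a)" for a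
  have \<beta>0: "\<beta> a0 = 0" using \<beta>(1) by simp
  have x'0: "x' a0 = x a0" by (simp add: x'_def \<beta>0 K.hom_zero)
  have a0A: "a0 \<in> A" and a0n: "\<sigma> \<preceq> ?n a0" using a0 by (auto simp: M_def)
  have x'le: "w (x' a) \<preceq> w (x a)" for a
  proof (cases "a \<in> M - {a0}")
    case True
    have "w (x' a) \<le> max (w (x a)) (v (\<beta> a) * w (x a0))"
      using K.v_diff[of "x a" "i (\<beta> a) * x a0"] by (simp add: x'_def)
    then have "w (x' a) \<preceq> max (w (x a)) (v (\<beta> a) * w (x a0))"
      by (rule lesssim_le) (simp add: le_max_iff_disj)
    moreover have "max (w (x a)) (v (\<beta> a) * w (x a0)) \<preceq> w (x a)"
      using \<beta>(3)[OF True] by (simp add: max_def)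
    ultimately show ?thesis by (rule lesssim_trans) simp
  qed (simp add: x'_def \<beta>(1) K.hom_zero)
  have n'le: "w (x' a) * w' (y' a) \<preceq> ?n a" if "a \<noteq> a0" for a
    using lesssim_mult[OF x'le[of a], of "w' (y a)" "w' (y a)"] that by (simp add: y'_def)
  have beta_y: "w (x a0) * w' (j (\<beta> b) * y b) \<preceq> \<sigma>" if b: "b \<in> A" for b
  proof (cases "b \<in> M - {a0}")
    case True
    have "(v (\<beta> b) * w (x a0)) * w' (y b) \<preceq> ?n b"
      by (rule lesssim_mult) (use \<beta>(3)[OF True] in auto)
    then show ?thesis using lesssim_trans[OF _ small[OF b]] pos by (simp add: ac_simps)
  next
    case False
    then have "w (x a0) * w' (j (\<beta> b) * y b) = 0" by (simp add: \<beta>(1))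
    then show ?thesis using lesssim_le[of "w (x a0) * w' (j (\<beta> b) * y b)" \<sigma>] pos by (simp only: less_imp_le)
  qed
  have n'0: "w (x a0) * w' (y' a0) \<preceq> \<sigma>"
  proof -
    have "w' (y' a0) \<le> w' (y a0) \<or> w' (y' a0) \<le> w' (\<Sum>b\<in>A. j (\<beta> b) * y b)"
      using L.v_add[of "y a0" "\<Sum>b\<in>A. j (\<beta> b) * y b"] by (simp add: y'_def le_max_iff_disj)
    then have "w (x a0) * w' (y' a0) \<preceq> ?n a0 \<or>
        w (x a0) * w' (y' a0) \<preceq> w (x a0) * w' (\<Sum>b\<in>A. j (\<beta> b) * y b)"
      by (auto intro!: lesssim_le mult_left_mono)
    moreover have "w (x a0) * w' (\<Sum>b\<in>A. j (\<beta> b) * y b) \<preceq> \<sigma>"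
      by (rule L.v_sum_lesssim[OF beta_y]) (use pos in auto)
    ultimately show ?thesis
    proof (elim disjE)
      assume "w (x a0) * w' (y' a0) \<preceq> ?n a0"
      then show ?thesis by (rule lesssim_trans[OF _ small[OF a0A]]) (use pos in simp)
    next
      assume "w (x a0) * w' (\<Sum>b\<in>A. j (\<beta> b) * y b) \<preceq> \<sigma>"
        "w (x a0) * w' (y' a0) \<preceq> w (x a0) * w' (\<Sum>b\<in>A. j (\<beta> b) * y b)"
      from this(2,1) show ?thesis by (rule lesssim_trans) (use pos in simp)
    qed
  qed
  show ?thesis
  proof (rule that[OF a0A a0n \<beta>0 x'_def y'_def])
    show s': "w (x' a) * w' (y' a) \<preceq> \<sigma>" if "a \<in> A" for a
      using lesssim_trans[OF n'le small[OF that]] n'0 pos x'0 by (cases "a = a0") auto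
    show restrict_max: "\<sigma> \<preceq> ?n a" if "a \<in> A" "a \<noteq> a0" "\<sigma> \<preceq> w (x' a) * w' (y' a)" for a
      using lesssim_trans[OF that(3) n'le[OF that(2)]] by simp
    \<comment> \<open>The term \<open>a0\<close> receives all corrections in its second factor and
      may lose norm through them; \<open>l\<close> excludes this.\<close>
    assume l: "\<sigma> \<preceq> w (x' a0) * w' (y' a0)"
    have y'0: "y' a0 \<noteq> 0" using lesssim_pos[OF l pos] by auto
    have "w (x a0) * w' (y a0) \<asymp> w (x a0) * w' (y' a0)"
      unfolding simeq_def using lesssim_trans[OF small[OF a0A] l] lesssim_trans[OF n'0 a0n] x'0 by simp
    then have yy: "w' (y a0) \<asymp> w' (y' a0)"
      by (rule simeq_cancel[rotated]) (use nz0 in simp)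
    show "leading A x' y' a0"
      unfolding leading_def
    proof (intro conjI ballI impI)
      fix a assume a: "a \<in> A - {a0}"
      show "w (x' a) * w' (y' a) \<preceq> w (x' a0) * w' (y' a0)"
        using lesssim_trans[OF s' l] a by simp
      assume "w (x' a0) * w' (y' a0) \<preceq> w (x' a) * w' (y' a)"
      then have "\<sigma> \<preceq> w (x' a) * w' (y' a)" using lesssim_trans[OF l] by simp
      then have aM: "a \<in> M - {a0}" using a restrict_max by (auto simp: M_def)
      obtain c where c: "c \<noteq> 0" "ok c (w' (y a) / w' (y a0))" "i c * x' a / x a0 \<in> J"
        using \<beta>(2)[OF aM] by (auto simp: below_def x'_def)
      have "w' (y a) / w' (y a0) \<asymp> w' (y a) / w' (y' a0)"
        by (rule simeq_divide) (use nz aM nz0 y'0 yy in \<open>auto simp: simeq_def\<close>)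
      then have "ok c (w' (y a) / w' (y' a0))" using ok_cong[OF _ c(2)] nz aM nz0 by simp
      then show "below (x' a) (y' a) (x' a0) (y' a0)"
        using c a unfolding below_def x'0 by (auto simp: y'_def)
    qed (use fin a0A x'0 nz0 y'0 in auto)
  qed
qed

end

section \<open>Ultrapowers of fields\<close>

text \<open>Zorn's lemma for the reversed order gives a minimal proper filter below
  \<open>sequentially\<close>; it decides every \<open>P\<close>, because \<open>P\<close> can be
  added unless its negation already holds eventually. Lying below \<open>sequentially\<close> turns
  sequences such as \<open>1 / Suc l\<close> into infinitesimals.\<close>

lemma ex_ultrafilter:
  "\<exists>U::nat filter. U \<noteq> bot \<and> U \<le> sequentially \<and> (\<forall>P. eventually P U \<or> eventually (\<lambda>n. \<not> P n) U)"
proof -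
  define A where "A = {F::nat filter. F \<noteq> bot \<and> F \<le> sequentially}"
  have "\<exists>m\<in>A. \<forall>a\<in>A. m \<ge> a \<longrightarrow> a = m"
  proof (rule predicate_Zorn)
    show "partial_order_on A (relation_of (\<ge>) A)"
      by (auto simp: partial_order_on_def preorder_on_def relation_of_def refl_on_def
          intro!: transI antisymI)
  next
    fix C assume C: "C \<in> Chains (relation_of (\<ge>) A)"
    have CA: "C \<subseteq> A" and tot: "\<And>F G. F \<in> C \<Longrightarrow> G \<in> C \<Longrightarrow> F \<le> G \<or> G \<le> F"
      using C by (auto simp: Chains_def relation_of_def)
    show "\<exists>u\<in>A. \<forall>a\<in>C. a \<ge> u"
    proof (cases "C = {}")
      case True
      then show ?thesis by (auto simp: A_def intro!: exI[of _ sequentially])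
    next
      case False
      have "eventually P (Inf C) \<longleftrightarrow> (\<exists>F\<in>C. eventually P F)" for P
      proof (rule eventually_Inf_base[OF False])
        fix F G assume "F \<in> C" "G \<in> C"
        then show "\<exists>x\<in>C. x \<le> inf F G" using tot[of F G] by (auto intro: bexI)
      qed
      then have "\<not> eventually (\<lambda>_. False) (Inf C)" using CA by (auto simp: A_def trivial_limit_def)
      moreover have "Inf C \<le> sequentially" using False CA by (auto simp: A_def intro: Inf_lower2)
      ultimately have "Inf C \<in> A" by (auto simp: A_def trivial_limit_def)
      then show ?thesis by (auto intro: Inf_lower)
    qed
  qed
  then obtain U where U: "U \<in> A" "\<And>F. F \<in> A \<Longrightarrow> F \<le> U \<Longrightarrow> F = U" by blast
  have "eventually P U \<or> eventually (\<lambda>n. \<not> P n) U" for P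
  proof (cases "inf U (principal {n. P n}) = bot")
    case True
    then have "eventually (\<lambda>n. False) (inf U (principal {n. P n}))" by simp
    then show ?thesis by (simp add: eventually_inf_principal)
  next
    case False
    then have "inf U (principal {n. P n}) = U"
      using U by (auto simp: A_def intro: le_infI1)
    moreover have "eventually P (inf U (principal {n. P n}))" by (simp add: eventually_inf_principal)
    ultimately have "eventually P U" by simp
    then show ?thesis ..
  qed
  then show ?thesis using U(1) by (auto simp: A_def)
qed

definition ultra :: "nat filter" where
  "ultra = (SOME U. U \<noteq> bot \<and> U \<le> sequentially \<and> (\<forall>P. eventually P U \<or> eventually (\<lambda>n. \<not> P n) U))"

lemma ultra_nontrivial: "ultra \<noteq> bot"
  and ultra_le: "ultra \<le> sequentially"
  and ultra_cases: "eventually P ultra \<or> eventually (\<lambda>n. \<not> P n) ultra"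
proof -
  have *: "ultra \<noteq> bot \<and> ultra \<le> sequentially \<and>
      (\<forall>P. eventually P ultra \<or> eventually (\<lambda>n. \<not> P n) ultra)"
    unfolding ultra_def by (rule someI_ex[OF ex_ultrafilter])
  show "ultra \<noteq> bot" using * by (rule conjunct1)
  show "ultra \<le> sequentially" using * by (elim conjE)
  show "eventually P ultra \<or> eventually (\<lambda>n. \<not> P n) ultra" using * by (elim conjE allE)
qed

lemma ultra_False [simp]: "\<not> eventually (\<lambda>n. False) ultra"
  using ultra_nontrivial by (simp add: trivial_limit_def)

lemma ultra_not: "\<not> eventually P ultra \<longleftrightarrow> eventually (\<lambda>n. \<not> P n) ultra"
proof
  show "\<not> eventually P ultra \<Longrightarrow> eventually (\<lambda>n. \<not> P n) ultra" using ultra_cases[of P] by simp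
  assume n: "eventually (\<lambda>n. \<not> P n) ultra"
  show "\<not> eventually P ultra"
  proof
    assume "eventually P ultra"
    then have "eventually (\<lambda>n. False) ultra" using n by (rule eventually_elim2) simp
    then show False by simp
  qed
qed

lemma ultra_disj: "eventually (\<lambda>n. P n \<or> Q n) ultra \<longleftrightarrow> eventually P ultra \<or> eventually Q ultra"
proof
  assume h: "eventually (\<lambda>n. P n \<or> Q n) ultra"
  show "eventually P ultra \<or> eventually Q ultra"
  proof (rule disjE[OF ultra_cases[of P]])
    assume "eventually (\<lambda>n. \<not> P n) ultra"
    with h have "eventually Q ultra" by (rule eventually_elim2) simp
    then show ?thesis ..
  qed simp
next
  assume "eventually P ultra \<or> eventually Q ultra"
  then show "eventually (\<lambda>n. P n \<or> Q n) ultra"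
    by (elim disjE) (erule eventually_mono, simp)+
qed

quotient_type 'a ultrapower = "nat \<Rightarrow> 'a" / "\<lambda>x y. eventually (\<lambda>n. x n = y n) ultra"
  morphisms rep_ultrapower ultraclass
proof (rule equivpI)
  show "reflp (\<lambda>x y :: nat \<Rightarrow> 'a. eventually (\<lambda>n. x n = y n) ultra)" by (simp add: reflp_def)
  show "symp (\<lambda>x y :: nat \<Rightarrow> 'a. eventually (\<lambda>n. x n = y n) ultra)"
    by (rule sympI) (erule eventually_mono, simp)
  show "transp (\<lambda>x y :: nat \<Rightarrow> 'a. eventually (\<lambda>n. x n = y n) ultra)"
    by (rule transpI) (erule (1) eventually_elim2, simp)
qed

lemma ultraclass_eq_iff: "ultraclass x = ultraclass y \<longleftrightarrow> eventually (\<lambda>n. x n = y n) ultra"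
  by (rule ultrapower.abs_eq_iff)

lemma ultraclass_exhaust: obtains x where "a = ultraclass x"
proof
  show "a = ultraclass (rep_ultrapower a)" by (rule Quotient3_abs_rep[OF Quotient3_ultrapower, symmetric])
qed

lift_definition ultramap :: "('a \<Rightarrow> 'b) \<Rightarrow> 'a ultrapower \<Rightarrow> 'b ultrapower" is "\<lambda>f x n. f (x n)"
  by (erule eventually_mono) simp

lemma ultramap_ultraclass [simp]: "ultramap f (ultraclass x) = ultraclass (\<lambda>n. f (x n))"
  by (rule ultramap.abs_eq)

instantiation ultrapower :: (field) field
begin

lift_definition zero_ultrapower :: "'a ultrapower" is "\<lambda>_. 0" .
lift_definition one_ultrapower :: "'a ultrapower" is "\<lambda>_. 1" .
lift_definition plus_ultrapower :: "'a ultrapower \<Rightarrow> 'a ultrapower \<Rightarrow> 'a ultrapower"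
  is "\<lambda>x y n. x n + y n" by (erule (1) eventually_elim2) simp
lift_definition minus_ultrapower :: "'a ultrapower \<Rightarrow> 'a ultrapower \<Rightarrow> 'a ultrapower"
  is "\<lambda>x y n. x n - y n" by (erule (1) eventually_elim2) simp
lift_definition times_ultrapower :: "'a ultrapower \<Rightarrow> 'a ultrapower \<Rightarrow> 'a ultrapower"
  is "\<lambda>x y n. x n * y n" by (erule (1) eventually_elim2) simp
lift_definition divide_ultrapower :: "'a ultrapower \<Rightarrow> 'a ultrapower \<Rightarrow> 'a ultrapower"
  is "\<lambda>x y n. x n / y n" by (erule (1) eventually_elim2) simp
lift_definition uminus_ultrapower :: "'a ultrapower \<Rightarrow> 'a ultrapower"
  is "\<lambda>x n. - x n" by (erule eventually_mono) simp
lift_definition inverse_ultrapower :: "'a ultrapower \<Rightarrow> 'a ultrapower"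
  is "\<lambda>x n. inverse (x n)" by (erule eventually_mono) simp

instance
proof
  fix a b c :: "'a ultrapower"
  show "a * b * c = a * (b * c)" by transfer (simp add: mult.assoc)
  show "a * b = b * a" by transfer (simp add: mult.commute)
  show "1 * a = a" by transfer simp
  show "a + b + c = a + (b + c)" by transfer (simp add: add.assoc)
  show "a + b = b + a" by transfer (simp add: add.commute)
  show "0 + a = a" by transfer simp
  show "- a + a = 0" by transfer simp
  show "a - b = a + - b" by transfer simp
  show "(a + b) * c = a * c + b * c" by transfer (simp add: distrib_right)
  show "(0::'a ultrapower) \<noteq> 1" by transfer simp
  show "a \<noteq> 0 \<Longrightarrow> inverse a * a = 1" by transfer (simp add: ultra_not, erule eventually_mono, simp)
  show "a div b = a * inverse b" by transfer (simp add: divide_inverse)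
  show "inverse 0 = (0::'a ultrapower)" by transfer simp
qed

end

lemmas ultraclass_simps [simp] =
  plus_ultrapower.abs_eq minus_ultrapower.abs_eq times_ultrapower.abs_eq divide_ultrapower.abs_eq
  uminus_ultrapower.abs_eq inverse_ultrapower.abs_eq

lemma ultraclass_eq_0_iff: "ultraclass x = 0 \<longleftrightarrow> eventually (\<lambda>n. x n = 0) ultra"
  by (simp add: zero_ultrapower_def ultraclass_eq_iff)

lemma ultraclass_power [simp]: "ultraclass x ^ k = ultraclass (\<lambda>n. x n ^ k)"
  by (induction k) (simp_all add: one_ultrapower_def)

lemma ultraclass_sum: "(\<Sum>a\<in>A. ultraclass (x a)) = ultraclass (\<lambda>n. \<Sum>a\<in>A. x a n)"
  by (induction A rule: infinite_finite_induct) (simp_all add: zero_ultrapower_def)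

text \<open>Roots are chosen componentwise. Where the leading coefficient vanishes the choice is
  arbitrary, but these components form a set outside the ultrafilter.\<close>

instance ultrapower :: (alg_closed_field) alg_closed_field
proof intro_classes
  fix n and f :: "nat \<Rightarrow> 'a ultrapower"
  assume n: "n > 0" and f: "f n \<noteq> 0"
  have "\<exists>F. \<forall>k. f k = ultraclass (F k)" by (rule choice) (metis ultraclass_exhaust)
  then obtain F where F: "\<And>k. f k = ultraclass (F k)" by blast
  have "\<exists>x. F n l \<noteq> 0 \<longrightarrow> (\<Sum>k\<le>n. F k l * x ^ k) = 0" for l
    using alg_closed[OF n, of "\<lambda>k. F k l"] by blast
  then obtain x where x: "\<And>l. F n l \<noteq> 0 \<Longrightarrow> (\<Sum>k\<le>n. F k l * x l ^ k) = 0" by metis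
  have "(\<Sum>k\<le>n. f k * ultraclass x ^ k) = ultraclass (\<lambda>l. \<Sum>k\<le>n. F k l * x l ^ k)"
    by (simp add: F ultraclass_sum)
  also have "\<dots> = 0"
  proof -
    have "eventually (\<lambda>l. F n l \<noteq> 0) ultra" using f by (simp add: F ultraclass_eq_0_iff ultra_not)
    then show ?thesis unfolding ultraclass_eq_0_iff by (rule eventually_mono) (rule x)
  qed
  finally show "\<exists>x. (\<Sum>k\<le>n. f k * x ^ k) = 0" by blast
qed

instantiation ultrapower :: (linordered_field) linordered_field
begin

lift_definition less_eq_ultrapower :: "'a ultrapower \<Rightarrow> 'a ultrapower \<Rightarrow> bool"
  is "\<lambda>x y. eventually (\<lambda>n. x n \<le> y n) ultra"
  by (rule eventually_subst) (erule (1) eventually_elim2, simp)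
lift_definition less_ultrapower :: "'a ultrapower \<Rightarrow> 'a ultrapower \<Rightarrow> bool"
  is "\<lambda>x y. eventually (\<lambda>n. x n < y n) ultra"
  by (rule eventually_subst) (erule (1) eventually_elim2, simp)
lift_definition abs_ultrapower :: "'a ultrapower \<Rightarrow> 'a ultrapower"
  is "\<lambda>x n. \<bar>x n\<bar>" by (erule eventually_mono) simp
lift_definition sgn_ultrapower :: "'a ultrapower \<Rightarrow> 'a ultrapower"
  is "\<lambda>x n. sgn (x n)" by (erule eventually_mono) simp

instance
proof
  fix a b c :: "'a ultrapower"
  show "a < b \<longleftrightarrow> a \<le> b \<and> \<not> b \<le> a"
    by transfer (unfold ultra_not not_le, blast intro: eventually_mono less_imp_le)
  show "a \<le> a" by transfer simp
  show "a \<le> b \<Longrightarrow> b \<le> c \<Longrightarrow> a \<le> c" by transfer (erule (1) eventually_elim2, simp)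
  show "a \<le> b \<Longrightarrow> b \<le> a \<Longrightarrow> a = b" by transfer (erule (1) eventually_elim2, simp)
  show "a \<le> b \<or> b \<le> a" by transfer (unfold ultra_disj[symmetric], simp add: linear)
  show "a \<le> b \<Longrightarrow> c + a \<le> c + b" by transfer (erule eventually_mono, simp)
  show "a < b \<Longrightarrow> 0 < c \<Longrightarrow> c * a < c * b"
    by transfer (erule (1) eventually_elim2, simp)
  show "\<bar>a\<bar> = (if a < 0 then - a else a)"
  proof (cases "a < 0")
    case True
    then have "\<bar>a\<bar> = - a" by transfer (erule eventually_mono, simp)
    then show ?thesis using True by simp
  next
    case False
    then have "\<bar>a\<bar> = a" by transfer (unfold ultra_not not_less, erule eventually_mono, simp)
    then show ?thesis using False by simp
  qed
  show "sgn a = (if a = 0 then 0 else if 0 < a then 1 else - 1)"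
  proof -
    have "sgn a = 1" if "0 < a" using that by transfer (erule eventually_mono, simp)
    moreover have "sgn a = - 1" if "a \<noteq> 0" "\<not> 0 < a"
      using that by transfer (unfold ultra_not, erule (1) eventually_elim2, simp)
    moreover have "sgn (0::'a ultrapower) = 0" by transfer simp
    ultimately show ?thesis by auto
  qed
qed

end

section \<open>Leading presentations in the ultrapower\<close>

text \<open>The witness may vary with the component; as there are finitely many candidates, one of
  them serves on a set of the ultrafilter. This is one reason for freezing the number of
  terms.\<close>

lemma ultra_finite_bex:
  "finite A \<Longrightarrow> eventually (\<lambda>n. \<exists>a\<in>A. P a n) ultra \<longleftrightarrow> (\<exists>a\<in>A. eventually (P a) ultra)"
  by (induction A rule: finite_induct) (simp_all add: ultra_disj)

lemma of_nat_ultrapower: "of_nat n = ultraclass (\<lambda>_. of_nat n)"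
  by (induction n) (simp_all add: zero_ultrapower_def one_ultrapower_def)

lemma lesssim_ultraclass:
  "ultraclass Xs \<preceq> ultraclass Ys \<longleftrightarrow>
     (\<forall>k::nat. eventually (\<lambda>l. of_nat k * Xs l \<le> of_nat (Suc k) * Ys l) ultra)"
  unfolding lesssim_def of_nat_ultrapower times_ultrapower.abs_eq less_eq_ultrapower.abs_eq ..

text \<open>The relative errors \<open>1 / Suc l\<close> become infinitesimal, so approximate
  optimality in the components turns into optimality in the ultrapower.\<close>

lemma lesssim_limit:
  fixes s :: real
  assumes "0 < s" "\<And>l. Xs l \<le> s * (1 + 1 / real (Suc l))"
  shows "ultraclass Xs \<preceq> ultraclass (\<lambda>_. s)"
  unfolding lesssim_ultraclass
proof
  fix k :: nat
  have "eventually (\<lambda>l. k \<le> l) ultra"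
    using ultra_le eventually_ge_at_top[of k] unfolding le_filter_def by blast
  then show "eventually (\<lambda>l. real k * Xs l \<le> real (Suc k) * s) ultra"
  proof (rule eventually_mono)
    fix l assume l: "k \<le> l"
    have "real k * Xs l \<le> real k * (s * (1 + 1 / real (Suc l)))"
      using assms(2) by (intro mult_left_mono) auto
    also have "\<dots> = s * (real k + real k / real (Suc l))" by (simp add: field_simps)
    also have "\<dots> \<le> s * (real k + 1)" using l assms(1) by (intro mult_left_mono add_left_mono) auto
    finally show "real k * Xs l \<le> real (Suc k) * s" by (simp add: mult.commute add.commute)
  qed
qed

text \<open>A gap between standard reals is not bridged by infinitesimals, by the Archimedean
  property. This is how conclusions return from the ultrapower to the reals.\<close>

lemma not_lesssim_const:
  fixes r s :: real
  assumes "r < s" "0 \<le> r"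
  shows "\<not> ultraclass (\<lambda>_. s) \<preceq> ultraclass (\<lambda>_. r)"
proof
  assume h: "ultraclass (\<lambda>_. s) \<preceq> ultraclass (\<lambda>_. r)"
  obtain k :: nat where k: "r / (s - r) < real k" using reals_Archimedean2 by blast
  have "real k * s \<le> real (Suc k) * r"
    using h unfolding lesssim_ultraclass by (simp only: eventually_const[OF ultra_nontrivial])
  then have "real k * (s - r) \<le> r" by (simp add: algebra_simps)
  then show False using k assms by (simp add: field_simps)
qed

lemma field_hom_ultramap: assumes "field_hom i" shows "field_hom (ultramap i)"
proof -
  interpret field_hom i by fact
  show ?thesis
  proof
    fix x y
    show "ultramap i (x + y) = ultramap i x + ultramap i y"
      by (transfer fixing: i) (simp add: hom_add)
    show "ultramap i (x * y) = ultramap i x * ultramap i y"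
      by (transfer fixing: i) (simp add: hom_mult)
    show "ultramap i 1 = 1" by (transfer fixing: i) (simp add: hom_one)
  qed
qed

lemma valued_ultramap: assumes "valued v" shows "valued (ultramap v)"
proof -
  interpret valued v by fact
  show ?thesis
  proof
    fix x y
    show "0 \<le> ultramap v x" by (transfer fixing: v) simp
    show "ultramap v x = 0 \<longleftrightarrow> x = 0" by (transfer fixing: v) simp
    show "ultramap v (x * y) = ultramap v x * ultramap v y" by (transfer fixing: v) simp
    show "ultramap v (x + y) \<le> max (ultramap v x) (ultramap v y)"
    proof -
      have "ultramap v (x + y) \<le> ultramap v x \<or> ultramap v (x + y) \<le> ultramap v y"
        by (transfer fixing: v) (unfold ultra_disj[symmetric], simp add: v_add flip: le_max_iff_disj)
      then show ?thesis by (simp add: le_max_iff_disj)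
    qed
  qed
qed

lemma valued_ext_ultramap:
  assumes "valued_ext i v w" shows "valued_ext (ultramap i) (ultramap v) (ultramap w)"
proof -
  interpret valued_ext i v w by fact
  interpret u: field_hom "ultramap i" by (rule field_hom_ultramap) unfold_locales
  interpret v: valued "ultramap v" by (rule valued_ultramap) unfold_locales
  interpret w: valued "ultramap w" by (rule valued_ultramap) unfold_locales
  show ?thesis
  proof
    show "ultramap w (ultramap i c) = ultramap v c" for c by (transfer fixing: i v w) simp
  qed
qed

lemma (in valued) v_power: "v (x ^ n) = v x ^ n"
  by (induction n) simp_all

lemma (in valued) v_power_int: "v (x powi n) = v x powi n"
  by (simp add: power_int_def v_power)

text \<open>A root of high order of a scalar with value above 1 has a value strictly between 1 and
  \<open>1 + e\<close>. Its integer powers then meet every interval from \<open>r\<close> to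
  \<open>r * (1 + e)\<close>; the exponent is the logarithm of \<open>r\<close> rounded up.\<close>

lemma dense_values:
  fixes v :: "'k::alg_closed_field \<Rightarrow> real"
  assumes "valued v" "a \<noteq> 0" "v a \<noteq> 1" "0 < r" "0 < e"
  shows "\<exists>c. c \<noteq> 0 \<and> r \<le> v c \<and> v c \<le> r * (1 + e)"
proof -
  interpret valued v by fact
  obtain b where b: "b \<noteq> 0" "1 < v b"
  proof (cases "1 < v a")
    case True then show ?thesis using that assms by blast
  next
    case False
    then have "1 < v (inverse a)" using assms by (simp add: one_less_inverse)
    then show ?thesis using that[of "inverse a"] assms by simp
  qed
  obtain q :: nat where q: "v b < (1 + e) ^ q"
    using real_arch_pow[of "1 + e" "v b"] assms by auto
  have q0: "q > 0" using q b by (cases q) auto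
  obtain d where d: "d ^ q = b" using nth_root_exists[OF q0] by blast
  have dq: "v d ^ q = v b" using d v_power[of d q] by simp
  have d1: "1 < v d"
  proof (rule ccontr)
    assume "\<not> 1 < v d"
    then have "v d ^ q \<le> 1" by (simp add: power_le_one)
    then show False using dq b by simp
  qed
  have de: "v d < 1 + e"
  proof (rule ccontr)
    assume "\<not> v d < 1 + e"
    then have "(1 + e) ^ q \<le> v d ^ q" using assms by (intro power_mono) auto
    then show False using dq q by simp
  qed
  define p where "p = \<lceil>log (v d) r\<rceil>"
  have d0: "d \<noteq> 0" using d1 by auto
  have e: "v (d powi p) = v d powr p"
    using d0 by (simp add: v_power_int powr_real_of_int')
  have lr: "r = v d powr (log (v d) r)"
    by (rule powr_log_cancel[symmetric]) (use d1 assms(4) in auto)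
  have "v d powr (log (v d) r) \<le> v d powr p" using d1 by (intro powr_mono) (auto simp: p_def)
  then have "r \<le> v (d powi p)" using lr by (simp add: e)
  moreover have "v d powr p \<le> v d powr (log (v d) r + 1)"
    using d1 by (intro powr_mono) (auto simp: p_def ceiling_correct less_imp_le)
  then have "v (d powi p) \<le> r * v d" using d1 lr by (simp add: e powr_add)
  then have "v (d powi p) \<le> r * (1 + e)" using de assms by (smt (verit) mult_left_mono)
  ultimately show ?thesis using d0 by (intro exI[of _ "d powi p"]) (simp add: power_int_eq_0_iff)
qed

text \<open>The first alternative is the trivially valued case (its bound \<open>c\<close> hides the
  parameter): no scalar of value near \<open>r\<close> need exist there, and the relation is made
  total.\<close>

definition value_section :: "('k::field \<Rightarrow> real) \<Rightarrow> 'k ultrapower \<Rightarrow> real ultrapower \<Rightarrow> bool" where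
  "value_section v c r \<longleftrightarrow> (\<forall>c. c \<noteq> 0 \<longrightarrow> v c = 1) \<or> ultramap v c \<asymp> r"

lemma value_section_ex:
  fixes v :: "'k::alg_closed_field \<Rightarrow> real"
  assumes v: "valued v" and r: "0 < r"
  shows "\<exists>c. c \<noteq> 0 \<and> value_section v c r"
proof (cases "\<forall>c. c \<noteq> 0 \<longrightarrow> v c = 1")
  case True
  then show ?thesis by (intro exI[of _ 1]) (simp add: value_section_def)
next
  case False
  then obtain a where a: "a \<noteq> 0" "v a \<noteq> 1" by blast
  obtain Xs where Xs: "r = ultraclass Xs" by (rule ultraclass_exhaust)
  have pos: "eventually (\<lambda>l. 0 < Xs l) ultra"
    using r by (simp add: Xs zero_ultrapower_def less_ultrapower.abs_eq)
  have "\<exists>c. c \<noteq> 0 \<and> (0 < Xs l \<longrightarrow> Xs l \<le> v c \<and> v c \<le> Xs l * (1 + 1 / real (Suc l)))" for l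
    using dense_values[OF v a, of "Xs l" "1 / real (Suc l)"] by (cases "0 < Xs l") (auto intro: exI[of _ 1])
  then obtain c where c: "\<And>l. c l \<noteq> 0"
    "\<And>l. 0 < Xs l \<Longrightarrow> Xs l \<le> v (c l) \<and> v (c l) \<le> Xs l * (1 + 1 / real (Suc l))" by metis
  interpret u: valued "ultramap v" by (rule valued_ultramap[OF v])
  have c0: "ultraclass c \<noteq> 0" using c by (simp add: ultraclass_eq_0_iff)
  have "r \<le> ultramap v (ultraclass c)"
    using pos by (simp add: Xs less_eq_ultrapower.abs_eq) (erule eventually_mono, simp add: c)
  then have 1: "r \<preceq> ultramap v (ultraclass c)" by (rule lesssim_le) (rule u.v_nonneg)
  have "ultraclass (\<lambda>l. v (c l) / Xs l) \<preceq> ultraclass (\<lambda>_. 1)"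
  proof -
    \<comment> \<open>The default value 1 keeps the bound valid in the components where
      \<open>Xs l\<close> is not positive, which the ultrafilter ignores.\<close>
    have "ultraclass (\<lambda>l. if 0 < Xs l then v (c l) / Xs l else 1) \<preceq> ultraclass (\<lambda>_. 1)"
      by (rule lesssim_limit) (use c in \<open>auto simp: field_simps\<close>)
    moreover have "ultraclass (\<lambda>l. if 0 < Xs l then v (c l) / Xs l else 1) = ultraclass (\<lambda>l. v (c l) / Xs l)"
      unfolding ultraclass_eq_iff using pos by (rule eventually_mono) simp
    ultimately show ?thesis by simp
  qed
  then have "ultramap v (ultraclass c) / r \<preceq> 1" by (simp add: Xs one_ultrapower_def)
  then have "r * (ultramap v (ultraclass c) / r) \<preceq> r * 1" by (rule lesssim_mult_left) (use r in simp)
  then have "ultramap v (ultraclass c) \<preceq> r" using r by simp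
  then show ?thesis using 1 c0 by (intro exI[of _ "ultraclass c"]) (simp add: value_section_def simeq_def)
qed

lemma ex_tensor_place:
  fixes i :: "'k::alg_closed_field \<Rightarrow> 'a::field" and j :: "'k \<Rightarrow> 'b::field" and v :: "'k \<Rightarrow> real"
  assumes "valued_ext i v w" "valued_ext j v w'"
  shows "\<exists>J. tensor_place (ultramap i) (ultramap j) (ultramap v) (ultramap w) (ultramap w') J (value_section v)"
proof -
  interpret K: alg_closed_ext "ultramap i" "ultramap v" "ultramap w"
    using valued_ext_ultramap[OF assms(1)] by (simp add: alg_closed_ext_def)
  interpret L: valued_ext "ultramap j" "ultramap v" "ultramap w'"
    by (rule valued_ext_ultramap[OF assms(2)])
  have v: "valued v" using assms(1) by (simp add: valued_ext_def)
  obtain J where J: "K.place_ideal J" "\<And>J'. K.place_ideal J' \<Longrightarrow> J \<subseteq> J' \<Longrightarrow> J' = J"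
    by (rule K.maximal_place_ideal) blast
  interpret maximal_place "ultramap i" "{c. ultramap v c \<preceq> 1}" "{x. \<not> 1 \<preceq> ultramap w x}" J
    by unfold_locales (use J in auto)
  \<comment> \<open>Over trivially valued scalars the relation carries no information, and
    \<open>ok_one\<close> holds because every nonzero scalar of the ultrapower still has value
    1.\<close>
  have triv: "ultramap v c = 1" if "\<forall>c. c \<noteq> 0 \<longrightarrow> v c = 1" "c \<noteq> 0" for c
    using that(2) by (transfer fixing: v) (unfold ultra_not, erule eventually_mono, use that(1) in simp)
  have "tensor_place (ultramap i) (ultramap j) (ultramap v) (ultramap w) (ultramap w') J (value_section v)"
  proof
    fix c d :: "'k ultrapower" and r s :: "real ultrapower"
    show "0 < r \<Longrightarrow> \<exists>c. c \<noteq> 0 \<and> value_section v c r" by (rule value_section_ex[OF v])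
    show "c \<noteq> 0 \<Longrightarrow> value_section v c (ultramap v c)" by (simp add: value_section_def simeq_def)
    show "c \<noteq> 0 \<Longrightarrow> value_section v c 1 \<Longrightarrow> 1 \<preceq> ultramap v c"
      by (auto simp: value_section_def simeq_def triv)
    show "value_section v c s" if "0 < r" "value_section v c r" "r \<asymp> s"
      using that simeq_pos[OF that(3)] lesssim_trans[of "ultramap v c" r s] lesssim_trans[of s r "ultramap v c"]
      by (auto simp: value_section_def simeq_def)
    show "value_section v (c * d) (r * s)" if "0 < r" "0 < s" "value_section v c r" "value_section v d s"
      using that by (auto simp: value_section_def simeq_def intro!: lesssim_mult)
    show "value_section v (inverse c) (inverse r)" if "c \<noteq> 0" "0 < r" "value_section v c r"
      using that simeq_divide[of 1 1 "ultramap v c" r]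
      by (auto simp: value_section_def simeq_def inverse_eq_divide)
  qed
  then show ?thesis by blast
qed

text \<open>
  \<open>tensor_null\<close> is the matrix criterion for \<open>\<Sum>a\<in>A. f a \<otimes> h a = 0\<close>. The number of auxiliary elements
  is bounded in terms of \<open>A\<close>, so the criterion passes to ultrapowers.
\<close>

definition tensor_null ::
    "('k \<Rightarrow> 'a::field) \<Rightarrow> ('k \<Rightarrow> 'b::field) \<Rightarrow> 'c set \<Rightarrow> ('c \<Rightarrow> 'a) \<Rightarrow> ('c \<Rightarrow> 'b) \<Rightarrow> bool" where
  "tensor_null i j A f h \<longleftrightarrow> (\<exists>\<alpha> z. (\<forall>a\<in>A. h a = (\<Sum>s\<in>A. j (\<alpha> a s) * z s)) \<and>
     (\<forall>s\<in>A. (\<Sum>a\<in>A. i (\<alpha> a s) * f a) = 0))"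

lemma tensor_null_ultraclass:
  assumes "\<And>l. tensor_null i j A (\<lambda>a. f a l) (\<lambda>a. h a l)"
  shows "tensor_null (ultramap i) (ultramap j) A (\<lambda>a. ultraclass (f a)) (\<lambda>a. ultraclass (h a))"
proof -
  have "\<forall>l. \<exists>\<alpha> z. (\<forall>a\<in>A. h a l = (\<Sum>s\<in>A. j (\<alpha> a s) * z s)) \<and>
      (\<forall>s\<in>A. (\<Sum>a\<in>A. i (\<alpha> a s) * f a l) = 0)"
    using assms unfolding tensor_null_def by (rule allI)
  from choice[OF this] obtain \<alpha> where "\<forall>l. \<exists>z. (\<forall>a\<in>A. h a l = (\<Sum>s\<in>A. j (\<alpha> l a s) * z s)) \<and>
      (\<forall>s\<in>A. (\<Sum>a\<in>A. i (\<alpha> l a s) * f a l) = 0)" ..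
  from choice[OF this] obtain z where "\<forall>l. (\<forall>a\<in>A. h a l = (\<Sum>s\<in>A. j (\<alpha> l a s) * z l s)) \<and>
      (\<forall>s\<in>A. (\<Sum>a\<in>A. i (\<alpha> l a s) * f a l) = 0)" ..
  then show ?thesis unfolding tensor_null_def
    by (intro exI[of _ "\<lambda>a s. ultraclass (\<lambda>l. \<alpha> l a s)"] exI[of _ "\<lambda>s. ultraclass (\<lambda>l. z l s)"])
      (simp add: ultraclass_sum ultraclass_eq_iff ultraclass_eq_0_iff)
qed

text \<open>The elimination step of \<open>leading_reduce\<close>, which does not change the tensor \<open>\<Sum>a<n. x a \<otimes> y a\<close>.\<close>

definition reduction_closed ::
    "('k \<Rightarrow> 'a::field) \<Rightarrow> ('k::field \<Rightarrow> 'b::field) \<Rightarrow> nat \<Rightarrow> ((nat \<Rightarrow> 'a) \<times> (nat \<Rightarrow> 'b)) set \<Rightarrow> bool" where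
  "reduction_closed i j n S \<longleftrightarrow> (\<forall>x y a0 \<beta>. (x, y) \<in> S \<longrightarrow> a0 < n \<longrightarrow> \<beta> a0 = 0 \<longrightarrow>
     (\<lambda>a. x a - i (\<beta> a) * x a0, \<lambda>a. if a = a0 then y a0 + (\<Sum>b<n. j (\<beta> b) * y b) else y a) \<in> S)"

text \<open>The positive number \<open>s\<close> is the infimum over \<open>S\<close> of the largest
  norm of a term. The set \<open>S\<close> is kept abstract, since it need not consist of all
  presentations of a tensor.\<close>

definition minimal_cost ::
    "('a \<Rightarrow> real) \<Rightarrow> ('b \<Rightarrow> real) \<Rightarrow> nat \<Rightarrow> ((nat \<Rightarrow> 'a) \<times> (nat \<Rightarrow> 'b)) set \<Rightarrow> real \<Rightarrow> bool" where
  "minimal_cost w w' n S s \<longleftrightarrow> 0 < s \<and>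
     (\<forall>x y. (x, y) \<in> S \<longrightarrow> (\<exists>a<n. s \<le> w (x a) * w' (y a))) \<and>
     (\<forall>e>0. \<exists>x y. (x, y) \<in> S \<and> (\<forall>a<n. w (x a) * w' (y a) \<le> s * (1 + e)))"

text \<open>Among the sequences that are optimal up to infinitesimals, one with the fewest maximal
  terms is chosen. Elimination creates no maximal terms, so by minimality it destroys none either.
  In particular \<open>a0\<close> stays maximal, the condition under which
  \<open>leading_reduce\<close> makes it leading.\<close>

lemma leading_presentation:
  fixes w :: "'a::field \<Rightarrow> real" and w' :: "'b::field \<Rightarrow> real" and v :: "'k::alg_closed_field \<Rightarrow> real"
  assumes "tensor_place (ultramap i) (ultramap j) (ultramap v) (ultramap w) (ultramap w') J ok"
    and S: "reduction_closed i j n S" and min: "minimal_cost w w' n S s"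
  obtains x y a where "\<And>l. (\<lambda>a. x a l, \<lambda>a. y a l) \<in> S"
    "tensor_place.leading (ultramap i) (ultramap w) (ultramap w') J ok {..<n}
       (\<lambda>a. ultraclass (x a)) (\<lambda>a. ultraclass (y a)) a"
    "ultraclass (\<lambda>_. s) \<preceq> ultramap w (ultraclass (x a)) * ultramap w' (ultraclass (y a))"
proof -
  interpret tensor_place "ultramap i" "ultramap j" "ultramap v" "ultramap w" "ultramap w'" J ok by fact
  have s: "0 < s" and lower: "\<And>x y. (x, y) \<in> S \<Longrightarrow> \<exists>a<n. s \<le> w (x a) * w' (y a)"
    and approx: "\<And>e. 0 < e \<Longrightarrow> \<exists>x y. (x, y) \<in> S \<and> (\<forall>a<n. w (x a) * w' (y a) \<le> s * (1 + e))"
    using min by (simp_all add: minimal_cost_def)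
  let ?n = "\<lambda>x y a. ultramap w (ultraclass (x a)) * ultramap w' (ultraclass (y a))"
  let ?s = "ultraclass (\<lambda>_. s)"
  define good where "good x y \<longleftrightarrow> (\<forall>l. (\<lambda>a. x a l, \<lambda>a. y a l) \<in> S) \<and> (\<forall>a<n. ?n x y a \<preceq> ?s)" for x y
  define M where "M x y = {a. a < n \<and> ?s \<preceq> ?n x y a}" for x y
  have s0: "0 < ?s" using s by (simp add: zero_ultrapower_def less_ultrapower.abs_eq)
  have "\<exists>x y. good x y"
  proof -
    have "\<forall>l. \<exists>p. p \<in> S \<and> (\<forall>a<n. w (fst p a) * w' (snd p a) \<le> s * (1 + 1 / real (Suc l)))"
      using approx by (metis fst_conv snd_conv of_nat_0_less_iff zero_less_Suc zero_less_divide_1_iff)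
    then obtain p where p: "\<And>l. p l \<in> S"
      "\<And>l a. a < n \<Longrightarrow> w (fst (p l) a) * w' (snd (p l) a) \<le> s * (1 + 1 / real (Suc l))" by metis
    have "good (\<lambda>a l. fst (p l) a) (\<lambda>a l. snd (p l) a)"
      unfolding good_def using p by (auto intro!: lesssim_limit s)
    then show ?thesis by blast
  qed
  then have "\<exists>p. good (fst p) (snd p)" by auto
  then obtain p where "good (fst p) (snd p)"
    "\<And>q. good (fst q) (snd q) \<Longrightarrow> card (M (fst p) (snd p)) \<le> card (M (fst q) (snd q))"
    using ex_has_least_nat[of "\<lambda>p. good (fst p) (snd p)" _ "\<lambda>p. card (M (fst p) (snd p))"] by metis
  then obtain x y where g: "good x y" and least: "\<And>x' y'. good x' y' \<Longrightarrow> card (M x y) \<le> card (M x' y')"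
    by (metis fst_conv snd_conv)
  have "\<exists>a<n. ?s \<preceq> ?n x y a"
  proof -
    have "eventually (\<lambda>l. \<exists>a\<in>{..<n}. s \<le> w (x a l) * w' (y a l)) ultra"
      using g lower by (intro always_eventually) (force simp: good_def)
    then have "\<exists>a\<in>{..<n}. eventually (\<lambda>l. s \<le> w (x a l) * w' (y a l)) ultra"
      by (simp only: ultra_finite_bex[OF finite_lessThan])
    then obtain a where "a < n" "eventually (\<lambda>l. s \<le> w (x a l) * w' (y a l)) ultra" by auto
    then have a: "a < n" "?s \<le> ?n x y a" by (simp_all add: less_eq_ultrapower.abs_eq)
    have "?s \<preceq> ?n x y a"
      by (rule lesssim_le[OF a(2)]) (intro mult_nonneg_nonneg K.v_nonneg L.v_nonneg)
    then show ?thesis using a(1) by blast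
  qed
  then obtain a1 where a1: "a1 < n" "?s \<preceq> ?n x y a1" by blast
  have small: "?n x y a \<preceq> ?s" if "a \<in> {..<n}" for a using g that unfolding good_def by blast
  have a1': "a1 \<in> {..<n}" using a1(1) by simp
  show ?thesis
  proof (rule leading_reduce[where x = "\<lambda>a. ultraclass (x a)" and y = "\<lambda>a. ultraclass (y a)", OF finite_lessThan s0 small a1' a1(2)])
    fix a0 \<beta> x' y' assume r: "a0 \<in> {..<n}" "?s \<preceq> ?n x y a0" "\<beta> a0 = 0"
      "\<And>a. x' a = ultraclass (x a) - ultramap i (\<beta> a) * ultraclass (x a0)"
      "\<And>a. y' a = (if a = a0 then ultraclass (y a0) + (\<Sum>b<n. ultramap j (\<beta> b) * ultraclass (y b)) else ultraclass (y a))"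
      "\<And>a. a \<in> {..<n} \<Longrightarrow> ultramap w (x' a) * ultramap w' (y' a) \<preceq> ?s"
      "\<And>a. a \<in> {..<n} \<Longrightarrow> a \<noteq> a0 \<Longrightarrow> ?s \<preceq> ultramap w (x' a) * ultramap w' (y' a) \<Longrightarrow> ?s \<preceq> ?n x y a"
      "?s \<preceq> ultramap w (x' a0) * ultramap w' (y' a0) \<Longrightarrow> leading {..<n} x' y' a0"
    have "\<exists>b. \<forall>a. ultraclass (b a) = \<beta> a" by (rule choice) (metis ultraclass_exhaust)
    then obtain b0 where b0: "\<And>a. ultraclass (b0 a) = \<beta> a" by blast
    \<comment> \<open>\<open>reduction_closed\<close> requires the coefficient at \<open>a0\<close>
      to vanish in every component, whereas \<open>r(3)\<close> yields this only on a set of the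
      ultrafilter; hence the explicit 0.\<close>
    define b where "b a = (if a = a0 then (\<lambda>_. 0) else b0 a)" for a
    have b: "ultraclass (b a) = \<beta> a" for a
      using r(3) b0 by (simp add: b_def zero_ultrapower_def)
    define Xs where "Xs a l = x a l - i (b a l) * x a0 l" for a l
    define Ys where "Ys a l = (if a = a0 then y a0 l + (\<Sum>c<n. j (b c l) * y c l) else y a l)" for a l
    have Xs: "ultraclass (Xs a) = x' a" for a by (simp add: r(4) b[symmetric] Xs_def[abs_def])
    have Ys: "ultraclass (Ys a) = y' a" for a
      by (simp add: r(5) b[symmetric] Ys_def[abs_def] ultraclass_sum)
    have XYs: "(\<lambda>a. Xs a l, \<lambda>a. Ys a l) \<in> S" for l
    proof -
      have "(\<lambda>a. x a l, \<lambda>a. y a l) \<in> S" using g by (simp add: good_def)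
      then show ?thesis
        using S r(1) unfolding reduction_closed_def Xs_def Ys_def
        by (auto simp: b_def dest!: spec[of _ "\<lambda>a. x a l"] spec[of _ "\<lambda>a. y a l"] spec[of _ a0] spec[of _ "\<lambda>a. b a l"])
    qed
    have "good Xs Ys" unfolding good_def Xs Ys using XYs r(6) by auto
    then have le: "card (M x y) \<le> card (M Xs Ys)" by (rule least)
    have "M Xs Ys \<subseteq> M x y" using r(2,7) by (auto simp: M_def Xs Ys)
    moreover have "finite (M x y)" by (simp add: M_def)
    ultimately have "M Xs Ys = M x y" using le by (simp add: card_seteq)
    moreover have "a0 \<in> M x y" using r(1,2) by (simp add: M_def)
    ultimately have max: "?s \<preceq> ultramap w (x' a0) * ultramap w' (y' a0)" by (auto simp: M_def Xs Ys)
    show thesis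
    proof (rule that)
      show "(\<lambda>a. Xs a l, \<lambda>a. Ys a l) \<in> S" for l by (rule XYs)
      show "leading {..<n} (\<lambda>a. ultraclass (Xs a)) (\<lambda>a. ultraclass (Ys a)) a0"
        using r(8)[OF max] by (simp add: Xs Ys)
      show "?s \<preceq> ultramap w (ultraclass (Xs a0)) * ultramap w' (ultraclass (Ys a0))"
        using max by (simp only: Xs Ys)
    qed
  qed
qed

text \<open>The set \<open>C\<close> lists the terms of another presentation of the product, with a
  sign. If all of them were smaller than \<open>s * s'\<close>, the product of two leading terms
  would still lead after they are added, against \<open>leading_not_null\<close>.\<close>

lemma tensor_product_bound:
  fixes w :: "'a::field \<Rightarrow> real" and w' :: "'b::field \<Rightarrow> real" and v :: "'k::alg_closed_field \<Rightarrow> real"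
    and u :: "'c \<Rightarrow> 'a" and t :: "'c \<Rightarrow> 'b"
  assumes K: "valued_ext i v w" and L: "valued_ext j v w'"
    and S: "reduction_closed i j n S" and s: "minimal_cost w w' n S s"
    and S': "reduction_closed i j n' S'" and s': "minimal_cost w w' n' S' s'"
    and fin: "finite C"
    and null: "\<And>x y x' y'. (x, y) \<in> S \<Longrightarrow> (x', y') \<in> S' \<Longrightarrow>
      tensor_null i j (({..<n} \<times> {..<n'}) <+> C)
        (case_sum (\<lambda>(a, b). x a * x' b) u) (case_sum (\<lambda>(a, b). y a * y' b) t)"
  shows "\<exists>c\<in>C. s * s' \<le> w (u c) * w' (t c)"
proof (rule ccontr)
  assume "\<not> ?thesis"
  then have small: "\<And>c. c \<in> C \<Longrightarrow> w (u c) * w' (t c) < s * s'" by force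
  obtain J where J: "tensor_place (ultramap i) (ultramap j) (ultramap v) (ultramap w) (ultramap w') J (value_section v)"
    using ex_tensor_place[OF K L] by blast
  interpret tensor_place "ultramap i" "ultramap j" "ultramap v" "ultramap w" "ultramap w'" J "value_section v"
    by (rule J)
  interpret w: valued w using K by (simp add: valued_ext_def)
  interpret w': valued w' using L by (simp add: valued_ext_def)
  obtain x y a where x: "\<And>l. (\<lambda>a. x a l, \<lambda>a. y a l) \<in> S"
    "leading {..<n} (\<lambda>a. ultraclass (x a)) (\<lambda>a. ultraclass (y a)) a"
    "ultraclass (\<lambda>_. s) \<preceq> ultramap w (ultraclass (x a)) * ultramap w' (ultraclass (y a))"
    using leading_presentation[OF J S s] by metis
  obtain x' y' a' where x': "\<And>l. (\<lambda>a. x' a l, \<lambda>a. y' a l) \<in> S'"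
    "leading {..<n'} (\<lambda>a. ultraclass (x' a)) (\<lambda>a. ultraclass (y' a)) a'"
    "ultraclass (\<lambda>_. s') \<preceq> ultramap w (ultraclass (x' a')) * ultramap w' (ultraclass (y' a'))"
    using leading_presentation[OF J S' s'] by metis
  let ?A = "({..<n} \<times> {..<n'}) <+> C"
  let ?f = "case_sum (\<lambda>(a, b). ultraclass (x a) * ultraclass (x' b)) (\<lambda>c. ultraclass (\<lambda>_. u c))"
  let ?h = "case_sum (\<lambda>(a, b). ultraclass (y a) * ultraclass (y' b)) (\<lambda>c. ultraclass (\<lambda>_. t c))"
  have "leading ?A ?f ?h (Inl (a, a'))"
  proof (rule leading_Plus[OF leading_prod[OF x(2) x'(2)] fin])
    fix c assume c: "c \<in> C"
    let ?P = "ultramap w (ultraclass (x a) * ultraclass (x' a')) * ultramap w' (ultraclass (y a) * ultraclass (y' a'))"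
    have e: "?P = (ultramap w (ultraclass (x a)) * ultramap w' (ultraclass (y a))) *
        (ultramap w (ultraclass (x' a')) * ultramap w' (ultraclass (y' a')))"
      by (simp only: K.v_mult L.v_mult ac_simps)
    have "ultraclass (\<lambda>_. s) * ultraclass (\<lambda>_. s') \<preceq> ?P"
      unfolding e by (rule lesssim_mult[OF x(3) x'(3)])
        (use s' in \<open>auto simp: minimal_cost_def zero_ultrapower_def less_eq_ultrapower.abs_eq\<close>)
    then have P: "ultraclass (\<lambda>_. s * s') \<preceq> ?P" by simp
    have "\<not> ?P \<preceq> ultraclass (\<lambda>_. w (u c) * w' (t c))"
    proof
      assume "?P \<preceq> ultraclass (\<lambda>_. w (u c) * w' (t c))"
      then have "ultraclass (\<lambda>_. s * s') \<preceq> ultraclass (\<lambda>_. w (u c) * w' (t c))"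
        by (rule lesssim_trans[OF P]) (simp add: zero_ultrapower_def less_eq_ultrapower.abs_eq)
      then show False using not_lesssim_const[OF small[OF c]] by simp
    qed
    then show "\<not> ultramap w (case (a, a') of (a, b) \<Rightarrow> ultraclass (x a) * ultraclass (x' b)) *
       ultramap w' (case (a, a') of (a, b) \<Rightarrow> ultraclass (y a) * ultraclass (y' b)) \<preceq>
       ultramap w (ultraclass (\<lambda>_. u c)) * ultramap w' (ultraclass (\<lambda>_. t c))"
      by simp
  qed
  moreover have "tensor_null (ultramap i) (ultramap j) ?A ?f ?h"
  proof -
    define f where "f = case_sum (\<lambda>(a, b) l. x a l * x' b l) (\<lambda>c l. u c)"
    define h where "h = case_sum (\<lambda>(a, b) l. y a l * y' b l) (\<lambda>c l. t c)"
    have "tensor_null i j ?A (\<lambda>a. f a l) (\<lambda>a. h a l)" for l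
    proof -
      have "(\<lambda>a. f a l) = case_sum (\<lambda>(a, b). x a l * x' b l) u"
        "(\<lambda>a. h a l) = case_sum (\<lambda>(a, b). y a l * y' b l) t"
        by (auto simp: f_def h_def fun_eq_iff split: sum.split)
      then show ?thesis using null[OF x(1)[of l] x'(1)[of l]] by simp
    qed
    then have "tensor_null (ultramap i) (ultramap j) ?A (\<lambda>a. ultraclass (f a)) (\<lambda>a. ultraclass (h a))"
      by (rule tensor_null_ultraclass)
    moreover have "(\<lambda>a. ultraclass (f a)) = ?f" "(\<lambda>a. ultraclass (h a)) = ?h"
      by (auto simp: f_def h_def fun_eq_iff split: sum.split)
    ultimately show ?thesis by simp
  qed
  then obtain \<alpha> z where "\<forall>a\<in>?A. ?h a = (\<Sum>s\<in>?A. ultramap j (\<alpha> a s) * z s)"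
    "\<forall>s\<in>?A. (\<Sum>a\<in>?A. ultramap i (\<alpha> a s) * ?f a) = 0"
    unfolding tensor_null_def by blast
  ultimately show False using leading_not_null[where A = ?A and f = ?f and h = ?h and S = ?A and \<alpha> = \<alpha> and z = z] by blast
qed

section \<open>The tensor product\<close>

lemma frag_induct [case_names zero of diff]:
  assumes "P 0" "\<And>x. P (frag_of x)" "\<And>a b. P a \<Longrightarrow> P b \<Longrightarrow> P (a - b)"
  shows "P c"
  by (rule frag_induction[of c UNIV]) (use assms in auto)

abbreviation pair_mult (infixl \<open>\<star>\<close> 70) where
  "f \<star> g \<equiv> f \<otimes>\<^bsub>pair_ring\<^esub> g"

lemma pair_ring_simps [simp]:
  "carrier pair_ring = UNIV" "\<one>\<^bsub>pair_ring\<^esub> = frag_of (1, 1)" "\<zero>\<^bsub>pair_ring\<^esub> = 0"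
  "f \<oplus>\<^bsub>pair_ring\<^esub> g = f + g"
  by (simp_all add: pair_ring_def)

lemma pair_ring_mult_of [simp]: "frag_of (x, y) \<star> frag_of (x', y') = frag_of (x * x', y * y')"
  by (simp add: pair_ring_def)

lemma pair_ring_mult_diff_left: "(f - f') \<star> g = f \<star> g - f' \<star> g"
  by (simp add: pair_ring_def frag_extend_diff)

lemma pair_ring_mult_add_left: "(f + f') \<star> g = f \<star> g + f' \<star> g"
  by (simp add: pair_ring_def frag_extend_add)

lemma pair_ring_mult_zero_left: "0 \<star> g = 0"
  by (simp add: pair_ring_def)

lemma pair_ring_mult_zero_of: "frag_of p \<star> 0 = 0"
  by (cases p) (simp add: pair_ring_def)

lemma pair_ring_mult_of_diff:
  "frag_of p \<star> (g - g') = frag_of p \<star> g - frag_of p \<star> g'"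
  by (cases p) (simp add: pair_ring_def frag_extend_diff)

text \<open>The definition makes additivity immediate in the left factor only; commutativity will
  transfer it to the right one.\<close>

lemma pair_ring_mult_commute: "f \<star> g = g \<star> f"
proof (induction f rule: frag_induct)
  case zero
  show ?case
    by (induction g rule: frag_induct)
      (simp_all add: pair_ring_mult_zero_left pair_ring_mult_zero_of pair_ring_mult_diff_left)
next
  case (of p)
  show ?case
  proof (induction g rule: frag_induct)
    case zero show ?case by (simp add: pair_ring_mult_zero_left pair_ring_mult_zero_of)
  next
    case (of q) show ?case by (cases p; cases q) (simp add: mult.commute)
  next
    case (diff a b) then show ?case by (simp add: pair_ring_mult_of_diff pair_ring_mult_diff_left)
  qed
next
  case (diff a b)
  have "g \<star> (a - b) = g \<star> a - g \<star> b"
  proof (induction g rule: frag_induct)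
    case zero show ?case by (simp add: pair_ring_mult_zero_left)
  next
    case (of q) show ?case by (rule pair_ring_mult_of_diff)
  next
    case (diff c d) then show ?case by (simp add: pair_ring_mult_diff_left)
  qed
  then show ?case using diff by (simp add: pair_ring_mult_diff_left)
qed

lemma pair_ring_mult_diff_right: "g \<star> (f - f') = g \<star> f - g \<star> f'"
  using pair_ring_mult_diff_left[of f f' g] by (simp only: pair_ring_mult_commute[of g])

lemma pair_ring_mult_zero_right: "g \<star> 0 = 0"
  using pair_ring_mult_zero_left[of g] by (simp only: pair_ring_mult_commute[of g])

lemma pair_ring_mult_assoc:
  "(f \<star> g) \<star> h = f \<star> (g \<star> h)"
proof (induction f rule: frag_induct)
  case zero show ?case by (simp add: pair_ring_mult_zero_left)
next
  case (of p)
  show ?case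
  proof (induction g rule: frag_induct)
    case zero show ?case by (simp add: pair_ring_mult_zero_left pair_ring_mult_zero_right)
  next
    case (of q)
    show ?case
    proof (induction h rule: frag_induct)
      case zero show ?case by (simp add: pair_ring_mult_zero_right)
    next
      case (of r) show ?case by (cases p; cases q; cases r) (simp add: mult.assoc)
    next
      case (diff c d) then show ?case by (simp add: pair_ring_mult_diff_right)
    qed
  next
    case (diff c d) then show ?case by (simp add: pair_ring_mult_diff_right pair_ring_mult_diff_left)
  qed
next
  case (diff c d) then show ?case by (simp add: pair_ring_mult_diff_left)
qed

lemma pair_ring_one: "frag_of (1, 1) \<star> f = f"
proof (induction f rule: frag_induct)
  case zero show ?case by (simp add: pair_ring_mult_zero_right)
next
  case (of p) show ?case by (cases p) simp
next
  case (diff a b) then show ?case by (simp add: pair_ring_mult_diff_right)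
qed

lemma cring_pair_ring: "cring (pair_ring :: ('a::comm_ring_1 \<times> 'b::comm_ring_1 \<Rightarrow>\<^sub>0 int) ring)"
proof (rule cringI)
  show "abelian_group (pair_ring :: ('a \<times> 'b \<Rightarrow>\<^sub>0 int) ring)"
  proof (rule abelian_groupI)
    fix x :: "'a \<times> 'b \<Rightarrow>\<^sub>0 int"
    show "\<exists>y\<in>carrier pair_ring. y \<oplus>\<^bsub>pair_ring\<^esub> x = \<zero>\<^bsub>pair_ring\<^esub>"
      by (rule bexI[of _ "- x"]) simp_all
  qed (simp_all add: ac_simps)
  show "comm_monoid (pair_ring :: ('a \<times> 'b \<Rightarrow>\<^sub>0 int) ring)"
    by (rule comm_monoidI) (simp_all add: pair_ring_mult_assoc pair_ring_one, rule pair_ring_mult_commute)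
qed (simp add: pair_ring_mult_add_left)

lemma pair_ring_uminus: "inv\<^bsub>add_monoid pair_ring\<^esub> f = - f"
proof -
  interpret cring "pair_ring :: ('a \<times> 'b \<Rightarrow>\<^sub>0 int) ring" by (rule cring_pair_ring)
  have "\<ominus>\<^bsub>pair_ring\<^esub> f = - f" by (rule minus_equality) simp_all
  then show ?thesis by (simp add: a_inv_def)
qed

section \<open>The ideal generated by the bilinearity relations\<close>

lemma tensor_subgroup_closed:
  shows tensor_subgroup_zero: "0 \<in> tensor_subgroup i j"
    and tensor_subgroup_incl: "f \<in> tensor_relations i j \<Longrightarrow> f \<in> tensor_subgroup i j"
    and tensor_subgroup_uminus_rel: "f \<in> tensor_relations i j \<Longrightarrow> - f \<in> tensor_subgroup i j"
    and tensor_subgroup_add: "f \<in> tensor_subgroup i j \<Longrightarrow> g \<in> tensor_subgroup i j \<Longrightarrow> f + g \<in> tensor_subgroup i j"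
proof -
  have one: "\<one>\<^bsub>add_monoid pair_ring\<^esub> = 0" by simp
  show "0 \<in> tensor_subgroup i j"
    using generate.one[of "add_monoid pair_ring" "tensor_relations i j"]
    unfolding tensor_subgroup_def one .
  show "f \<in> tensor_relations i j \<Longrightarrow> f \<in> tensor_subgroup i j"
    unfolding tensor_subgroup_def by (rule generate.incl)
  show "f \<in> tensor_relations i j \<Longrightarrow> - f \<in> tensor_subgroup i j"
    unfolding tensor_subgroup_def pair_ring_uminus[symmetric] by (rule generate.inv)
  have mult: "f \<otimes>\<^bsub>add_monoid pair_ring\<^esub> g = f + g" by simp
  show "f \<in> tensor_subgroup i j \<Longrightarrow> g \<in> tensor_subgroup i j \<Longrightarrow> f + g \<in> tensor_subgroup i j"
    unfolding tensor_subgroup_def mult[symmetric] by (rule generate.eng)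
qed

lemma tensor_subgroup_induct [consumes 1, case_names zero rel uminus add]:
  assumes "f \<in> tensor_subgroup i j" "P 0" "\<And>f. f \<in> tensor_relations i j \<Longrightarrow> P f"
    "\<And>f. f \<in> tensor_relations i j \<Longrightarrow> P (- f)" "\<And>f g. P f \<Longrightarrow> P g \<Longrightarrow> P (f + g)"
  shows "P f"
  using assms(1) unfolding tensor_subgroup_def
proof (induction rule: generate.induct)
  case one
  then show ?case using assms(2) by simp
next
  case (incl h)
  then show ?case by (rule assms(3))
next
  case (inv h)
  then show ?case unfolding pair_ring_uminus by (rule assms(4))
next
  case (eng h1 h2)
  then show ?case using assms(5) by simp
qed

lemma tensor_subgroup_uminus: "f \<in> tensor_subgroup i j \<Longrightarrow> - f \<in> tensor_subgroup i j"
proof (induction rule: tensor_subgroup_induct)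
  case (add f g)
  then show ?case using tensor_subgroup_add[of "- f" i j "- g"] by (simp add: add.commute)
qed (simp_all add: tensor_subgroup_zero tensor_subgroup_uminus_rel tensor_subgroup_incl)

text \<open>Each of the three kinds of relation is stable under componentwise multiplication by a
  pair; this is what makes the generated subgroup an ideal.\<close>

lemma tensor_relations_mult: "f \<in> tensor_relations i j \<Longrightarrow> frag_of p \<star> f \<in> tensor_relations i j"
proof (cases p)
  case (Pair a b)
  assume "f \<in> tensor_relations i j"
  then consider
    x x' y where "f = frag_of (x + x', y) - frag_of (x, y) - frag_of (x', y)"
  | x y y' where "f = frag_of (x, y + y') - frag_of (x, y) - frag_of (x, y')"
  | c x y where "f = frag_of (i c * x, y) - frag_of (x, j c * y)"
    unfolding tensor_relations_def by blast
  then show ?thesis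
  proof cases
    case 1
    then show ?thesis unfolding tensor_relations_def
      by (simp add: Pair pair_ring_mult_diff_right distrib_left) blast
  next
    case 2
    then show ?thesis unfolding tensor_relations_def
      by (simp add: Pair pair_ring_mult_diff_right distrib_left) blast
  next
    case 3
    then have "frag_of p \<star> f = frag_of (i c * (a * x), b * y) - frag_of (a * x, j c * (b * y))"
      by (simp add: Pair pair_ring_mult_diff_right mult.left_commute)
    then show ?thesis unfolding tensor_relations_def by blast
  qed
qed

lemma tensor_subgroup_mult:
  assumes "f \<in> tensor_subgroup i j" shows "g \<star> f \<in> tensor_subgroup i j"
proof (induction g rule: frag_induct)
  case zero show ?case by (simp add: pair_ring_mult_zero_left tensor_subgroup_zero)
next
  case (diff a b)
  then show ?case
    using tensor_subgroup_add[OF diff(1) tensor_subgroup_uminus[OF diff(2)]]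
    by (simp add: pair_ring_mult_diff_left)
next
  case (of p)
  show ?case using assms
  proof (induction rule: tensor_subgroup_induct)
    case zero show ?case by (simp add: pair_ring_mult_zero_right tensor_subgroup_zero)
  next
    case (rel f) then show ?case by (intro tensor_subgroup_incl tensor_relations_mult)
  next
    case (uminus f)
    then show ?case
      using tensor_subgroup_uminus_rel[OF tensor_relations_mult[of f i j p]] pair_ring_mult_diff_right[of "frag_of p" 0 f]
      by (simp add: pair_ring_mult_zero_right)
  next
    case (add f g)
    have "frag_of p \<star> (f + g) = frag_of p \<star> f + frag_of p \<star> g"
      using pair_ring_mult_add_left[of f g "frag_of p"] by (simp only: pair_ring_mult_commute[of "frag_of p"])
    then show ?case using add by (simp add: tensor_subgroup_add)
  qed
qed

lemma tensor_subgroup_ideal: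
  fixes i :: "'k \<Rightarrow> 'b::comm_ring_1" and j :: "'k \<Rightarrow> 'c::comm_ring_1"
  shows "ideal (tensor_subgroup i j) pair_ring"
proof (rule idealI)
  show "ring (pair_ring :: ('b \<times> 'c \<Rightarrow>\<^sub>0 int) ring)" using cring_pair_ring by (rule cring.axioms(1))
  show "subgroup (tensor_subgroup i j) (add_monoid pair_ring)"
    by (rule subgroup.intro)
      (simp_all only: pair_ring_uminus tensor_subgroup_uminus, simp_all add: tensor_subgroup_add tensor_subgroup_zero)
  fix a x :: "'b \<times> 'c \<Rightarrow>\<^sub>0 int" assume a: "a \<in> tensor_subgroup i j"
  show "x \<star> a \<in> tensor_subgroup i j" by (rule tensor_subgroup_mult[OF a])
  then show "a \<star> x \<in> tensor_subgroup i j" by (simp only: pair_ring_mult_commute[of a])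
qed

lemma cring_tensor_ring: "cring (tensor_ring i j)"
  unfolding tensor_ring_def by (rule ideal.quotient_is_cring[OF tensor_subgroup_ideal cring_pair_ring])

section \<open>Classes of formal sums and pure tensors\<close>

definition tensor_class where
  "tensor_class i j f = tensor_subgroup i j +>\<^bsub>pair_ring\<^esub> f"

lemma tensor_class_hom: "tensor_class i j \<in> ring_hom pair_ring (tensor_ring i j)"
  unfolding tensor_class_def tensor_ring_def by (rule ideal.rcos_ring_hom[OF tensor_subgroup_ideal])

lemma pure_tensor_class: "pure_tensor i j x y = tensor_class i j (frag_of (x, y))"
  by (simp add: pure_tensor_def tensor_class_def)

lemma tensor_class_simps:
  "tensor_class i j (f + g) = tensor_class i j f \<oplus>\<^bsub>tensor_ring i j\<^esub> tensor_class i j g"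
  "tensor_class i j (f \<star> g) = tensor_class i j f \<otimes>\<^bsub>tensor_ring i j\<^esub> tensor_class i j g"
  "tensor_class i j f \<in> carrier (tensor_ring i j)"
  "tensor_class i j (frag_of (1, 1)) = \<one>\<^bsub>tensor_ring i j\<^esub>"
  using ring_hom_add[OF tensor_class_hom, of f g] ring_hom_mult[OF tensor_class_hom, of f g]
    ring_hom_closed[OF tensor_class_hom, of f] ring_hom_one[OF tensor_class_hom]
  by simp_all

lemma tensor_class_eq_iff: "tensor_class i j f = tensor_class i j g \<longleftrightarrow> f - g \<in> tensor_subgroup i j"
proof -
  interpret ideal "tensor_subgroup i j" pair_ring by (rule tensor_subgroup_ideal)
  have "f \<ominus>\<^bsub>pair_ring\<^esub> g = f - g"
    using pair_ring_uminus[of g] by (simp add: a_minus_def a_inv_def)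
  then show ?thesis
    unfolding tensor_class_def
    using quotient_eq_iff_same_a_r_cos[OF is_ideal, of f g] by simp
qed

lemma tensor_class_zero: "tensor_class i j 0 = \<zero>\<^bsub>tensor_ring i j\<^esub>"
proof -
  interpret ideal "tensor_subgroup i j" pair_ring by (rule tensor_subgroup_ideal)
  interpret T: cring "tensor_ring i j" by (rule cring_tensor_ring)
  show ?thesis
    using tensor_class_simps(1)[of i j 0 0] T.add.l_cancel_one[of "tensor_class i j 0" "tensor_class i j 0"]
    by (simp add: tensor_class_simps(3))
qed

lemma tensor_class_exhaust:
  assumes "z \<in> carrier (tensor_ring i j)" obtains f where "z = tensor_class i j f"
  using assms unfolding tensor_ring_def FactRing_def A_RCOSETS_def' tensor_class_def by auto

lemma tensor_class_uminus: "tensor_class i j (- f) = \<ominus>\<^bsub>tensor_ring i j\<^esub> tensor_class i j f"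
proof -
  interpret T: cring "tensor_ring i j" by (rule cring_tensor_ring)
  show ?thesis
    by (rule T.minus_equality[symmetric])
      (simp_all add: tensor_class_simps tensor_class_zero[symmetric] flip: tensor_class_simps(1))
qed

lemma finsum_tensor_class:
  "finite A \<Longrightarrow> (\<Oplus>\<^bsub>tensor_ring i j\<^esub>a\<in>A. tensor_class i j (f a)) = tensor_class i j (\<Sum>a\<in>A. f a)"
proof (induction A rule: finite_induct)
  interpret T: cring "tensor_ring i j" by (rule cring_tensor_ring)
  case empty
  show ?case by (simp add: tensor_class_zero)
next
  interpret T: cring "tensor_ring i j" by (rule cring_tensor_ring)
  case (insert a A)
  then show ?case by (simp add: T.finsum_insert tensor_class_simps Pi_def)
qed

lemma pure_tensor_closed [simp]: "pure_tensor i j x y \<in> carrier (tensor_ring i j)"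
  by (simp add: pure_tensor_class tensor_class_simps)

lemma pure_tensor_add_left:
  "pure_tensor i j (x + x') y = pure_tensor i j x y \<oplus>\<^bsub>tensor_ring i j\<^esub> pure_tensor i j x' y"
proof -
  have "frag_of (x + x', y) - frag_of (x, y) - frag_of (x', y) \<in> tensor_subgroup i j"
    by (rule tensor_subgroup_incl) (unfold tensor_relations_def, blast)
  then show ?thesis
    by (simp add: pure_tensor_class tensor_class_eq_iff diff_diff_eq flip: tensor_class_simps(1))
qed

lemma pure_tensor_add_right:
  "pure_tensor i j x (y + y') = pure_tensor i j x y \<oplus>\<^bsub>tensor_ring i j\<^esub> pure_tensor i j x y'"
proof -
  have "frag_of (x, y + y') - frag_of (x, y) - frag_of (x, y') \<in> tensor_subgroup i j"
    by (rule tensor_subgroup_incl) (unfold tensor_relations_def, blast)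
  then show ?thesis
    by (simp add: pure_tensor_class tensor_class_eq_iff diff_diff_eq flip: tensor_class_simps(1))
qed

lemma pure_tensor_scale: "pure_tensor i j (i c * x) y = pure_tensor i j x (j c * y)"
proof -
  have "frag_of (i c * x, y) - frag_of (x, j c * y) \<in> tensor_subgroup i j"
    by (rule tensor_subgroup_incl) (unfold tensor_relations_def, blast)
  then show ?thesis by (simp add: pure_tensor_class tensor_class_eq_iff)
qed

lemma pure_tensor_mult:
  "pure_tensor i j x y \<otimes>\<^bsub>tensor_ring i j\<^esub> pure_tensor i j x' y' = pure_tensor i j (x * x') (y * y')"
  by (simp add: pure_tensor_class flip: tensor_class_simps(2))

lemma pure_tensor_one: "pure_tensor i j 1 1 = \<one>\<^bsub>tensor_ring i j\<^esub>"
  by (simp add: pure_tensor_class tensor_class_simps)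

lemma pure_tensor_zero_left [simp]: "pure_tensor i j 0 y = \<zero>\<^bsub>tensor_ring i j\<^esub>"
proof -
  interpret T: cring "tensor_ring i j" by (rule cring_tensor_ring)
  show ?thesis using pure_tensor_add_left[of i j 0 0 y] T.add.l_cancel_one[of "pure_tensor i j 0 y" "pure_tensor i j 0 y"]
    by simp
qed

lemma pure_tensor_zero_right [simp]: "pure_tensor i j x 0 = \<zero>\<^bsub>tensor_ring i j\<^esub>"
proof -
  interpret T: cring "tensor_ring i j" by (rule cring_tensor_ring)
  show ?thesis using pure_tensor_add_right[of i j x 0 0] T.add.l_cancel_one[of "pure_tensor i j x 0" "pure_tensor i j x 0"]
    by simp
qed

lemma pure_tensor_uminus_left: "pure_tensor i j (- x) y = \<ominus>\<^bsub>tensor_ring i j\<^esub> pure_tensor i j x y"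
proof -
  interpret T: cring "tensor_ring i j" by (rule cring_tensor_ring)
  show ?thesis by (rule T.minus_equality[symmetric]) (simp_all flip: pure_tensor_add_left)
qed

lemma pure_tensor_uminus_right: "pure_tensor i j x (- y) = \<ominus>\<^bsub>tensor_ring i j\<^esub> pure_tensor i j x y"
proof -
  interpret T: cring "tensor_ring i j" by (rule cring_tensor_ring)
  show ?thesis by (rule T.minus_equality[symmetric]) (simp_all flip: pure_tensor_add_right)
qed

text \<open>Signs are absorbed into the first factors, so that every class is a plain sum of pure
  tensors.\<close>

lemma tensor_class_map_uminus:
  "tensor_class i j (\<Sum>p\<leftarrow>ps. frag_of (- fst p, snd p)) = tensor_class i j (- (\<Sum>p\<leftarrow>ps. frag_of p))"
proof (induction ps)
  case (Cons p ps)
  have "tensor_class i j (frag_of (- fst p, snd p)) = tensor_class i j (- frag_of p)"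
    using pure_tensor_uminus_left[of i j "fst p" "snd p"]
    by (simp add: pure_tensor_class tensor_class_uminus)
  moreover have "- (\<Sum>p\<leftarrow>p # ps. frag_of p) = - frag_of p + - (\<Sum>p\<leftarrow>ps. frag_of p)"
    by simp
  ultimately show ?case
    using Cons.IH tensor_class_simps(1)[of i j "frag_of (- fst p, snd p)" "\<Sum>p\<leftarrow>ps. frag_of (- fst p, snd p)"]
      tensor_class_simps(1)[of i j "- frag_of p" "- (\<Sum>p\<leftarrow>ps. frag_of p)"]
    by (simp only: list.map sum_list.Cons)
qed simp

lemma tensor_presentation:
  assumes "z \<in> carrier (tensor_ring i j)"
  shows "\<exists>(n::nat) x y. 0 < n \<and> z = (\<Oplus>\<^bsub>tensor_ring i j\<^esub>m\<in>{..<n}. pure_tensor i j (x m) (y m))"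
proof -
  obtain f where z: "z = tensor_class i j f" using assms by (rule tensor_class_exhaust)
  have "\<exists>ps. ps \<noteq> [] \<and> tensor_class i j f = tensor_class i j (\<Sum>p\<leftarrow>ps. frag_of p)"
  proof (induction f rule: frag_induct)
    case zero
    have "frag_of (0, 0) \<in> tensor_subgroup i j"
      using pure_tensor_zero_left[of i j 0] tensor_class_zero[of i j]
        tensor_class_eq_iff[of i j "frag_of (0, 0)" 0] by (simp add: pure_tensor_class)
    then have "tensor_class i j 0 = tensor_class i j (\<Sum>p\<leftarrow>[(0, 0)]. frag_of p)"
      using tensor_subgroup_uminus[of "frag_of (0, 0)" i j] by (simp add: tensor_class_eq_iff)
    then show ?case by blast
  next
    case (of p)
    have "tensor_class i j (frag_of p) = tensor_class i j (\<Sum>p\<leftarrow>[p]. frag_of p)" by simp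
    then show ?case by blast
  next
    case (diff a b)
    obtain ps where ps: "ps \<noteq> []" "tensor_class i j a = tensor_class i j (\<Sum>p\<leftarrow>ps. frag_of p)"
      using diff(1) by blast
    obtain qs where qs: "tensor_class i j b = tensor_class i j (\<Sum>p\<leftarrow>qs. frag_of p)"
      using diff(2) by blast
    have "tensor_class i j (\<Sum>p\<leftarrow>ps @ map (\<lambda>p. (- fst p, snd p)) qs. frag_of p) =
        tensor_class i j (\<Sum>p\<leftarrow>ps. frag_of p) \<oplus>\<^bsub>tensor_ring i j\<^esub>
        tensor_class i j (\<Sum>p\<leftarrow>qs. frag_of (- fst p, snd p))"
      by (simp add: tensor_class_simps(1) comp_def)
    also have "\<dots> = tensor_class i j a \<oplus>\<^bsub>tensor_ring i j\<^esub> tensor_class i j (- b)"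
      by (simp add: tensor_class_map_uminus ps(2) qs tensor_class_uminus)
    also have "\<dots> = tensor_class i j (a - b)"
      by (simp flip: tensor_class_simps(1))
    finally have "tensor_class i j (a - b) =
        tensor_class i j (\<Sum>p\<leftarrow>ps @ map (\<lambda>p. (- fst p, snd p)) qs. frag_of p)" ..
    moreover have "ps @ map (\<lambda>p. (- fst p, snd p)) qs \<noteq> []" using ps(1) by simp
    ultimately show ?case by (intro exI[of _ "ps @ map (\<lambda>p. (- fst p, snd p)) qs"] conjI)
  qed
  then obtain ps where ps: "ps \<noteq> []" "z = tensor_class i j (\<Sum>p\<leftarrow>ps. frag_of p)"
    using z by blast
  have "(\<Sum>p\<leftarrow>ps. frag_of p) = (\<Sum>m<length ps. frag_of (fst (ps ! m), snd (ps ! m)))"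
    by (simp add: sum_list_sum_nth atLeast0LessThan)
  then have "z = (\<Oplus>\<^bsub>tensor_ring i j\<^esub>m\<in>{..<length ps}. pure_tensor i j (fst (ps ! m)) (snd (ps ! m)))"
    using ps(2) by (simp only: pure_tensor_class finsum_tensor_class[OF finite_lessThan])
  then show ?thesis using ps(1)
    by (intro exI[of _ "length ps"] exI[of _ "\<lambda>m. fst (ps ! m)"] exI[of _ "\<lambda>m. snd (ps ! m)"]) simp
qed

text \<open>The universal property applied to a vanishing sum: \<open>\<phi>\<close> extends to the
  free abelian group, and the extension kills the relations.\<close>

lemma tensor_functional:
  fixes \<phi> :: "'a::comm_ring_1 \<times> 'b::comm_ring_1 \<Rightarrow> 'c::field"
  assumes "\<And>x x' y. \<phi> (x + x', y) = \<phi> (x, y) + \<phi> (x', y)"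
    "\<And>x y y'. \<phi> (x, y + y') = \<phi> (x, y) + \<phi> (x, y')"
    "\<And>c x y. \<phi> (i c * x, y) = \<phi> (x, j c * y)"
    "finite A" "(\<Oplus>\<^bsub>tensor_ring i j\<^esub>a\<in>A. pure_tensor i j (f a) (h a)) = \<zero>\<^bsub>tensor_ring i j\<^esub>"
  shows "(\<Sum>a\<in>A. \<phi> (f a, h a)) = 0"
proof -
  interpret G: cring "ring_of_type_algebra :: 'c ring" by (rule cring_from_type_algebra)
  have \<phi>: "\<phi> ` UNIV \<subseteq> carrier ring_of_type_algebra"
    by (simp add: ring_of_type_algebra_def)
  obtain e where e: "e \<in> hom (free_Abelian_group UNIV) (add_monoid (ring_of_type_algebra :: 'c ring))"
    "\<And>p. p \<in> UNIV \<Longrightarrow> e (frag_of p) = \<phi> p"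
    by (rule G.add.free_Abelian_group_universal[OF \<phi>]) (erule that, simp)
  have add: "e (a + b) = e a + e b" for a b
    using hom_mult[OF e(1), of a b] by (simp add: ring_of_type_algebra_def)
  have zero: "e 0 = 0"
  proof (rule add_cancel_right_right[THEN iffD1])
    show "e 0 = e 0 + e 0" using add[of 0 0] by (simp only: add_0)
  qed
  have uminus_e: "e (- a) = - e a" for a
    using add[of "- a" a] zero by (simp add: eq_neg_iff_add_eq_0)
  have diff: "e (a - b) = e a - e b" for a b using add[of a "- b"] uminus_e by simp
  have e_rel: "e f = 0" if "f \<in> tensor_relations i j" for f
    using that unfolding tensor_relations_def
    by (elim UnE CollectE exE conjE) (simp_all add: diff e(2)[OF UNIV_I] assms(1-3))
  have ker: "e g = 0" if "g \<in> tensor_subgroup i j" for g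
    using that
  proof (induction rule: tensor_subgroup_induct)
    case (rel f) then show ?case by (rule e_rel)
  next
    case (uminus f) then show ?case using e_rel[of f] uminus_e[of f] by simp
  qed (simp_all add: zero add)
  have "tensor_class i j (\<Sum>a\<in>A. frag_of (f a, h a)) = tensor_class i j 0"
    using assms(4,5) by (simp add: pure_tensor_class finsum_tensor_class tensor_class_zero)
  then have "e (\<Sum>a\<in>A. frag_of (f a, h a)) = 0" using ker by (simp add: tensor_class_eq_iff)
  moreover have "e (\<Sum>a\<in>A. g a) = (\<Sum>a\<in>A. e (g a))" for g
    by (induction A rule: infinite_finite_induct) (simp_all add: zero add)
  ultimately show ?thesis by (simp add: e(2)[OF UNIV_I])
qed

text \<open>The auxiliary family is \<open>h\<close> itself. The entries of \<open>\<alpha>\<close>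
  are coordinates of \<open>h a\<close> in a basis chosen among the values of \<open>h\<close>, and
  the column sums vanish because each coordinate functional induces a map from the tensor product to
  the first field.\<close>

lemma tensor_null_of_sum_zero:
  fixes i :: "'k::field \<Rightarrow> 'a::field" and j :: "'k \<Rightarrow> 'b::field"
  assumes i: "field_hom i" and j: "field_hom j" and fin: "finite A"
    and zero: "(\<Oplus>\<^bsub>tensor_ring i j\<^esub>a\<in>A. pure_tensor i j (f a) (h a)) = \<zero>\<^bsub>tensor_ring i j\<^esub>"
  shows "tensor_null i j A f h"
proof -
  interpret i: field_hom i by fact
  interpret j: field_hom j by fact
  interpret V: vector_space "\<lambda>c y. j c * y"
    by unfold_locales (simp_all add: j.hom_add j.hom_mult j.hom_one algebra_simps)
  obtain S where S: "S \<subseteq> h ` A" "V.independent S" "h ` A \<subseteq> V.span S"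
    by (rule V.maximal_independent_subset)
  \<comment> \<open>Injectivity on \<open>A0\<close> lets the basis vectors be indexed by elements
    of \<open>A\<close>, the index set prescribed by \<open>tensor_null\<close>.\<close>
  obtain A0 where A0: "A0 \<subseteq> A" "inj_on h A0" "S = h ` A0"
    using S(1) unfolding subset_image_inj by blast
  \<comment> \<open>The coordinate functionals have to be defined on the whole second field, so the
    basis of the span is extended.\<close>
  define E where "E = V.extend_basis S"
  have E: "S \<subseteq> E" "V.independent E" "V.span E = UNIV"
    using V.extend_basis_superset[OF S(2)] V.independent_extend_basis[OF S(2)] V.span_extend_basis[OF S(2)]
    by (simp_all add: E_def)
  have finS: "finite S" using S(1) fin finite_surj by blast
  define \<alpha> where "\<alpha> a s = (if s \<in> A0 then V.representation E (h a) (h s) else 0)" for a s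
  have "h a = (\<Sum>s\<in>A. j (\<alpha> a s) * h s)" if a: "a \<in> A" for a
  proof -
    have ha: "h a \<in> V.span S" using S(3) a by blast
    have "(\<Sum>s\<in>A. j (\<alpha> a s) * h s) = (\<Sum>s\<in>A0. j (\<alpha> a s) * h s)"
      by (rule sum.mono_neutral_right) (use fin A0 in \<open>auto simp: \<alpha>_def j.hom_zero\<close>)
    also have "\<dots> = (\<Sum>b\<in>S. j (V.representation E (h a) b) * b)"
      unfolding A0(3) sum.reindex[OF A0(2)] by (simp add: \<alpha>_def)
    also have "\<dots> = (\<Sum>b\<in>S. j (V.representation S (h a) b) * b)"
      using V.representation_extend[OF E(2) ha E(1)] by simp
    also have "\<dots> = h a" by (rule V.sum_representation_eq[OF S(2) ha finS]) simp
    finally show ?thesis by simp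
  qed
  moreover have "(\<Sum>a\<in>A. i (\<alpha> a s) * f a) = 0" if s: "s \<in> A" for s
  proof (cases "s \<in> A0")
    case True
    define \<mu> where "\<mu> y = V.representation E y (h s)" for y
    have \<mu>_add: "\<mu> (y + y') = \<mu> y + \<mu> y'" for y y'
      unfolding \<mu>_def using V.representation_add[OF E(2), of y' y] by (simp add: E(3))
    have \<mu>_scale: "\<mu> (y * j c) = c * \<mu> y" for c y
      unfolding \<mu>_def using V.representation_scale[OF E(2), of y c] by (simp add: E(3) mult.commute[of y])
    define \<phi> where "\<phi> p = i (\<mu> (snd p)) * fst p" for p
    have "(\<Sum>a\<in>A. \<phi> (f a, h a)) = 0"
      by (rule tensor_functional[OF _ _ _ fin zero])
        (simp_all add: \<phi>_def \<mu>_add \<mu>_scale i.hom_add i.hom_mult algebra_simps)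
    then show ?thesis using True by (simp add: \<phi>_def \<mu>_def \<alpha>_def)
  qed (simp add: \<alpha>_def i.hom_zero)
  ultimately show ?thesis unfolding tensor_null_def by blast
qed

section \<open>Fraction fields\<close>

context domain
begin

lemma fraction_eq_iff:
  assumes "a \<in> carrier R" "b \<in> carrier R - {\<zero>}" "c \<in> carrier R" "d \<in> carrier R - {\<zero>}"
  shows "fraction R a b = fraction R c d \<longleftrightarrow> a \<otimes> d = c \<otimes> b"
proof
  assume "fraction R a b = fraction R c d"
  moreover have "(a, b) \<in> fraction R a b" using assms by (simp add: fraction_def)
  ultimately show "a \<otimes> d = c \<otimes> b" by (simp add: fraction_def)
next
  have sub: "fraction R a b \<subseteq> fraction R c d"
    if h: "a \<in> carrier R" "b \<in> carrier R - {\<zero>}" "c \<in> carrier R" "d \<in> carrier R - {\<zero>}" "a \<otimes> d = c \<otimes> b"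
    for a b c d
  proof
    fix p assume "p \<in> fraction R a b"
    then obtain e f where p: "p = (e, f)" "e \<in> carrier R" "f \<in> carrier R - {\<zero>}" "a \<otimes> f = e \<otimes> b"
      by (auto simp: fraction_def)
    have "b \<otimes> (c \<otimes> f) = (c \<otimes> b) \<otimes> f" using h(1-4) p(2,3) by (simp add: m_ac)
    also have "\<dots> = (a \<otimes> d) \<otimes> f" by (simp add: h(5))
    also have "\<dots> = (a \<otimes> f) \<otimes> d" using h(1-4) p(2,3) by (simp add: m_ac)
    also have "\<dots> = (e \<otimes> b) \<otimes> d" by (simp add: p(4))
    also have "\<dots> = b \<otimes> (e \<otimes> d)" using h(1-4) p(2,3) by (simp add: m_ac)
    finally have "c \<otimes> f = e \<otimes> d" using h p m_lcancel[of b] by simp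
    then show "p \<in> fraction R c d" using p by (simp add: fraction_def)
  qed
  assume "a \<otimes> d = c \<otimes> b"
  then show "fraction R a b = fraction R c d"
    using sub[of a b c d] sub[of c d a b] assms by auto
qed

lemma fraction_self: "a \<in> carrier R \<Longrightarrow> b \<in> carrier R - {\<zero>} \<Longrightarrow> (a, b) \<in> fraction R a b"
  by (simp add: fraction_def)

lemma fractionE:
  assumes "p \<in> fraction R a b"
  obtains c d where "p = (c, d)" "c \<in> carrier R" "d \<in> carrier R - {\<zero>}" "a \<otimes> d = c \<otimes> b"
  using assms by (auto simp: fraction_def)

lemma mult_nonzero: "b \<in> carrier R - {\<zero>} \<Longrightarrow> d \<in> carrier R - {\<zero>} \<Longrightarrow> b \<otimes> d \<in> carrier R - {\<zero>}"
  using integral by auto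

lemma fraction_mult:
  assumes "a \<in> carrier R" "b \<in> carrier R - {\<zero>}" "c \<in> carrier R" "d \<in> carrier R - {\<zero>}"
  shows "fraction R a b \<otimes>\<^bsub>fraction_field R\<^esub> fraction R c d = fraction R (a \<otimes> c) (b \<otimes> d)"
proof -
  have "fraction R (fst p \<otimes> fst q) (snd p \<otimes> snd q) = fraction R (a \<otimes> c) (b \<otimes> d)"
    if pq: "p \<in> fraction R a b" "q \<in> fraction R c d" for p q
  proof -
    obtain e f where p: "p = (e, f)" "e \<in> carrier R" "f \<in> carrier R - {\<zero>}" "a \<otimes> f = e \<otimes> b"
      using pq(1) by (rule fractionE)
    obtain g h where q: "q = (g, h)" "g \<in> carrier R" "h \<in> carrier R - {\<zero>}" "c \<otimes> h = g \<otimes> d"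
      using pq(2) by (rule fractionE)
    have "(e \<otimes> g) \<otimes> (b \<otimes> d) = (e \<otimes> b) \<otimes> (g \<otimes> d)" using assms p(2,3) q(2,3) by (simp add: m_ac)
    also have "\<dots> = (a \<otimes> f) \<otimes> (c \<otimes> h)" by (simp add: p(4) q(4))
    also have "\<dots> = (a \<otimes> c) \<otimes> (f \<otimes> h)" using assms p(2,3) q(2,3) by (simp add: m_ac)
    finally show ?thesis using assms p q mult_nonzero by (simp add: fraction_eq_iff)
  qed
  then show ?thesis
    unfolding fraction_field_def using fraction_self[OF assms(1,2)] fraction_self[OF assms(3,4)] by simp blast
qed

lemma fraction_add:
  assumes "a \<in> carrier R" "b \<in> carrier R - {\<zero>}" "c \<in> carrier R" "d \<in> carrier R - {\<zero>}"
  shows "fraction R a b \<oplus>\<^bsub>fraction_field R\<^esub> fraction R c d = fraction R (a \<otimes> d \<oplus> c \<otimes> b) (b \<otimes> d)"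
proof -
  have "fraction R (fst p \<otimes> snd q \<oplus> fst q \<otimes> snd p) (snd p \<otimes> snd q) = fraction R (a \<otimes> d \<oplus> c \<otimes> b) (b \<otimes> d)"
    if pq: "p \<in> fraction R a b" "q \<in> fraction R c d" for p q
  proof -
    obtain e f where p: "p = (e, f)" "e \<in> carrier R" "f \<in> carrier R - {\<zero>}" "a \<otimes> f = e \<otimes> b"
      using pq(1) by (rule fractionE)
    obtain g h where q: "q = (g, h)" "g \<in> carrier R" "h \<in> carrier R - {\<zero>}" "c \<otimes> h = g \<otimes> d"
      using pq(2) by (rule fractionE)
    have "(e \<otimes> h \<oplus> g \<otimes> f) \<otimes> (b \<otimes> d) = (e \<otimes> b) \<otimes> (h \<otimes> d) \<oplus> (g \<otimes> d) \<otimes> (f \<otimes> b)"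
      using assms p(2,3) q(2,3) by (simp add: l_distr r_distr m_ac)
    also have "\<dots> = (a \<otimes> f) \<otimes> (h \<otimes> d) \<oplus> (c \<otimes> h) \<otimes> (f \<otimes> b)" by (simp add: p(4) q(4))
    also have "\<dots> = (a \<otimes> d \<oplus> c \<otimes> b) \<otimes> (f \<otimes> h)"
      using assms p(2,3) q(2,3) by (simp add: l_distr r_distr m_ac)
    finally show ?thesis using assms p q mult_nonzero by (simp add: fraction_eq_iff)
  qed
  then show ?thesis
    unfolding fraction_field_def using fraction_self[OF assms(1,2)] fraction_self[OF assms(3,4)] by simp blast
qed

lemma fraction_field_simps:
  "\<one>\<^bsub>fraction_field R\<^esub> = fraction R \<one> \<one>" "\<zero>\<^bsub>fraction_field R\<^esub> = fraction R \<zero> \<one>"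
  by (simp_all add: fraction_field_def)

lemma fraction_closed:
  "a \<in> carrier R \<Longrightarrow> b \<in> carrier R - {\<zero>} \<Longrightarrow> fraction R a b \<in> carrier (fraction_field R)"
  by (auto simp: fraction_field_def)

lemma fraction_fieldE:
  assumes "x \<in> carrier (fraction_field R)"
  obtains a b where "x = fraction R a b" "a \<in> carrier R" "b \<in> carrier R - {\<zero>}"
  using assms by (auto simp: fraction_field_def)

lemma fraction_eq_zero_iff:
  assumes "a \<in> carrier R" "b \<in> carrier R - {\<zero>}"
  shows "fraction R a b = \<zero>\<^bsub>fraction_field R\<^esub> \<longleftrightarrow> a = \<zero>"
  using assms by (simp add: fraction_field_simps fraction_eq_iff)

lemma field_fraction_field: "field (fraction_field R)"
proof -
  let ?F = "fraction_field R"
  have one: "\<one> \<in> carrier R - {\<zero>}" by simp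
  note [simp] = fraction_mult fraction_add fraction_closed mult_nonzero[simplified] fraction_field_simps
  have "cring ?F"
  proof (rule cringI)
    show "abelian_group ?F"
    proof (rule abelian_groupI)
      fix x y assume "x \<in> carrier ?F" "y \<in> carrier ?F"
      then obtain a b c d where h: "x = fraction R a b" "a \<in> carrier R" "b \<in> carrier R - {\<zero>}"
        "y = fraction R c d" "c \<in> carrier R" "d \<in> carrier R - {\<zero>}" by (metis fraction_fieldE)
      show "x \<oplus>\<^bsub>?F\<^esub> y \<in> carrier ?F" using h mult_nonzero[OF h(3,6)] by simp
      show "x \<oplus>\<^bsub>?F\<^esub> y = y \<oplus>\<^bsub>?F\<^esub> x" using h by (simp add: m_comm a_comm)
      fix z assume "z \<in> carrier ?F"
      then obtain e f where z: "z = fraction R e f" "e \<in> carrier R" "f \<in> carrier R - {\<zero>}"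
        by (rule fraction_fieldE)
      have "x \<oplus>\<^bsub>?F\<^esub> y \<oplus>\<^bsub>?F\<^esub> z = fraction R ((a \<otimes> d \<oplus> c \<otimes> b) \<otimes> f \<oplus> e \<otimes> (b \<otimes> d)) (b \<otimes> d \<otimes> f)"
        using h z mult_nonzero by simp
      also have "\<dots> = fraction R (a \<otimes> (d \<otimes> f) \<oplus> (c \<otimes> f \<oplus> e \<otimes> d) \<otimes> b) (b \<otimes> (d \<otimes> f))"
        using h z by (simp add: l_distr r_distr a_assoc m_ac)
      also have "\<dots> = x \<oplus>\<^bsub>?F\<^esub> (y \<oplus>\<^bsub>?F\<^esub> z)" using h z mult_nonzero by simp
      finally show "x \<oplus>\<^bsub>?F\<^esub> y \<oplus>\<^bsub>?F\<^esub> z = x \<oplus>\<^bsub>?F\<^esub> (y \<oplus>\<^bsub>?F\<^esub> z)" .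
    next
      show "\<zero>\<^bsub>?F\<^esub> \<in> carrier ?F" by simp
    next
      fix x assume "x \<in> carrier ?F"
      then obtain a b where h: "x = fraction R a b" "a \<in> carrier R" "b \<in> carrier R - {\<zero>}"
        by (rule fraction_fieldE)
      show "\<zero>\<^bsub>?F\<^esub> \<oplus>\<^bsub>?F\<^esub> x = x" using h by simp
      have "fraction R (\<ominus> a) b \<oplus>\<^bsub>?F\<^esub> x = fraction R (\<ominus> a \<otimes> b \<oplus> a \<otimes> b) (b \<otimes> b)" using h by simp
      also have "\<ominus> a \<otimes> b \<oplus> a \<otimes> b = \<zero>" using h by (simp add: l_distr[symmetric] l_neg)
      also have "fraction R \<zero> (b \<otimes> b) = \<zero>\<^bsub>?F\<^esub>"
        using h mult_nonzero[OF h(3,3)] by (simp add: fraction_eq_iff)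
      finally show "\<exists>y\<in>carrier ?F. y \<oplus>\<^bsub>?F\<^esub> x = \<zero>\<^bsub>?F\<^esub>" using h by (intro bexI[of _ "fraction R (\<ominus> a) b"]) simp_all
    qed
    show "comm_monoid ?F"
    proof (rule comm_monoidI)
      fix x y assume "x \<in> carrier ?F" "y \<in> carrier ?F"
      then obtain a b c d where h: "x = fraction R a b" "a \<in> carrier R" "b \<in> carrier R - {\<zero>}"
        "y = fraction R c d" "c \<in> carrier R" "d \<in> carrier R - {\<zero>}" by (metis fraction_fieldE)
      show "x \<otimes>\<^bsub>?F\<^esub> y \<in> carrier ?F" using h mult_nonzero[OF h(3,6)] by simp
      show "x \<otimes>\<^bsub>?F\<^esub> y = y \<otimes>\<^bsub>?F\<^esub> x" using h by (simp add: m_comm)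
      fix z assume "z \<in> carrier ?F"
      then obtain e f where z: "z = fraction R e f" "e \<in> carrier R" "f \<in> carrier R - {\<zero>}"
        by (rule fraction_fieldE)
      show "x \<otimes>\<^bsub>?F\<^esub> y \<otimes>\<^bsub>?F\<^esub> z = x \<otimes>\<^bsub>?F\<^esub> (y \<otimes>\<^bsub>?F\<^esub> z)" using h z mult_nonzero by (simp add: m_assoc)
    next
      show "\<one>\<^bsub>?F\<^esub> \<in> carrier ?F" by simp
    next
      fix x assume "x \<in> carrier ?F"
      then obtain a b where h: "x = fraction R a b" "a \<in> carrier R" "b \<in> carrier R - {\<zero>}"
        by (rule fraction_fieldE)
      show "\<one>\<^bsub>?F\<^esub> \<otimes>\<^bsub>?F\<^esub> x = x" using h by simp
    qed
  next
    fix x y z assume "x \<in> carrier ?F" "y \<in> carrier ?F" and "z \<in> carrier ?F"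
    then obtain a b c d e f where h: "x = fraction R a b" "a \<in> carrier R" "b \<in> carrier R - {\<zero>}"
      "y = fraction R c d" "c \<in> carrier R" "d \<in> carrier R - {\<zero>}"
      "z = fraction R e f" "e \<in> carrier R" "f \<in> carrier R - {\<zero>}" by (metis fraction_fieldE)
    have "(x \<oplus>\<^bsub>?F\<^esub> y) \<otimes>\<^bsub>?F\<^esub> z = fraction R ((a \<otimes> d \<oplus> c \<otimes> b) \<otimes> e) (b \<otimes> d \<otimes> f)"
      using h mult_nonzero by simp
    also have "\<dots> = fraction R (a \<otimes> e \<otimes> (d \<otimes> f) \<oplus> c \<otimes> e \<otimes> (b \<otimes> f)) (b \<otimes> f \<otimes> (d \<otimes> f))"
      using h mult_nonzero integral by (subst fraction_eq_iff) (auto simp: l_distr r_distr m_ac)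
    also have "\<dots> = x \<otimes>\<^bsub>?F\<^esub> z \<oplus>\<^bsub>?F\<^esub> y \<otimes>\<^bsub>?F\<^esub> z" using h mult_nonzero by simp
    finally show "(x \<oplus>\<^bsub>?F\<^esub> y) \<otimes>\<^bsub>?F\<^esub> z = x \<otimes>\<^bsub>?F\<^esub> z \<oplus>\<^bsub>?F\<^esub> y \<otimes>\<^bsub>?F\<^esub> z" .
  qed
  then interpret F: cring ?F .
  show ?thesis
  proof (rule F.cring_fieldI2)
    show "\<zero>\<^bsub>?F\<^esub> \<noteq> \<one>\<^bsub>?F\<^esub>" by (simp add: fraction_eq_iff)
    fix x assume x: "x \<in> carrier ?F" "x \<noteq> \<zero>\<^bsub>?F\<^esub>"
    then obtain a b where h: "x = fraction R a b" "a \<in> carrier R" "b \<in> carrier R - {\<zero>}"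
      by (meson fraction_fieldE)
    have a: "a \<in> carrier R - {\<zero>}" using x h fraction_eq_zero_iff[OF h(2,3)] by auto
    have "x \<otimes>\<^bsub>?F\<^esub> fraction R b a = fraction R (a \<otimes> b) (b \<otimes> a)" using h a by simp
    also have "\<dots> = \<one>\<^bsub>?F\<^esub>"
      using h a mult_nonzero[OF h(3) a] by (simp add: fraction_eq_iff m_comm)
    finally show "\<exists>y\<in>carrier ?F. x \<otimes>\<^bsub>?F\<^esub> y = \<one>\<^bsub>?F\<^esub>"
      using h a by (intro bexI[of _ "fraction R b a"]) simp_all
  qed
qed

lemma fraction_hom: "(\<lambda>a. fraction R a \<one>) \<in> ring_hom R (fraction_field R)"
  by (rule ring_hom_memI) (simp_all add: fraction_closed fraction_mult fraction_add fraction_field_simps)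

text \<open>Multiplicativity applied to \<open>a \<otimes> d = c \<otimes> b\<close> makes
  \<open>N a / N b\<close> independent of the representative that \<open>SOME\<close> picks.\<close>

lemma fraction_field_valuation:
  fixes N :: "'a \<Rightarrow> real"
  assumes nonneg: "\<And>a. a \<in> carrier R \<Longrightarrow> 0 \<le> N a"
    and zero: "\<And>a. a \<in> carrier R \<Longrightarrow> N a = 0 \<longleftrightarrow> a = \<zero>"
    and mult: "\<And>a b. a \<in> carrier R \<Longrightarrow> b \<in> carrier R \<Longrightarrow> N (a \<otimes> b) = N a * N b"
    and add: "\<And>a b. a \<in> carrier R \<Longrightarrow> b \<in> carrier R \<Longrightarrow> N (a \<oplus> b) \<le> max (N a) (N b)"
  shows "\<exists>w. standard_valued_field (fraction_field R) w \<and> (\<forall>a\<in>carrier R. w (fraction R a \<one>) = N a)"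
proof -
  define w where "w U = (let p = SOME p. p \<in> U in N (fst p) / N (snd p))" for U
  have pos: "0 < N b" if "b \<in> carrier R - {\<zero>}" for b
    using nonneg[of b] zero[of b] that by auto
  have w: "w (fraction R a b) = N a / N b" if h: "a \<in> carrier R" "b \<in> carrier R - {\<zero>}" for a b
  proof -
    define p where "p = (SOME p. p \<in> fraction R a b)"
    have "p \<in> fraction R a b" unfolding p_def using fraction_self[OF h] by (rule someI)
    then obtain c d where p: "p = (c, d)" "c \<in> carrier R" "d \<in> carrier R - {\<zero>}" "a \<otimes> d = c \<otimes> b"
      by (rule fractionE)
    have "N a * N d = N c * N b" using mult[of a d] mult[of c b] h p by simp
    then show ?thesis using pos[OF h(2)] pos[OF p(3)]
      by (simp add: w_def flip: p_def) (simp add: p(1) field_simps)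
  qed
  have one: "N \<one> = 1" using mult[of \<one> \<one>] pos[of \<one>] by simp
  have "standard_valued_field (fraction_field R) w"
  proof (rule standard_valued_field.intro[OF field_fraction_field])
    show "standard_valued_field_axioms (fraction_field R) w"
    proof
      fix x y assume "x \<in> carrier (fraction_field R)" "y \<in> carrier (fraction_field R)"
      then obtain a b c d where h: "x = fraction R a b" "a \<in> carrier R" "b \<in> carrier R - {\<zero>}"
        "y = fraction R c d" "c \<in> carrier R" "d \<in> carrier R - {\<zero>}" by (metis fraction_fieldE)
      show "0 \<le> w x" using h nonneg pos by (simp add: w less_imp_le)
      show "w x = 0 \<longleftrightarrow> x = \<zero>\<^bsub>fraction_field R\<^esub>"
        using h zero pos[OF h(3)] by (simp add: w fraction_eq_zero_iff)
      show "w (x \<otimes>\<^bsub>fraction_field R\<^esub> y) = w x * w y"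
        using h mult_nonzero[OF h(3,6)] by (simp add: w fraction_mult mult)
      have "N (a \<otimes> d \<oplus> c \<otimes> b) \<le> max (N a * N d) (N c * N b)"
        using add[of "a \<otimes> d" "c \<otimes> b"] h by (simp add: mult)
      then show "w (x \<oplus>\<^bsub>fraction_field R\<^esub> y) \<le> max (w x) (w y)"
        using h mult_nonzero[OF h(3,6)] pos[OF h(3)] pos[OF h(6)]
        by (auto simp: w fraction_add mult le_max_iff_disj field_simps)
    qed
  qed
  moreover have "w (fraction R a \<one>) = N a" if "a \<in> carrier R" for a using w that one by simp
  ultimately show ?thesis by blast
qed

end

section \<open>The tensor seminorm\<close>

text \<open>Arbitrary index sets allow sums and products of presentations to be indexed by disjoint
  unions and products, without renumbering.\<close>

definition tensor_sum where
  "tensor_sum i j A x y = tensor_class i j (\<Sum>a\<in>A. frag_of (x a, y a))"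

lemma lessThan_one: "{..<1::nat} = {0}"
  by auto

lemma finsum_pure_tensor:
  "finite A \<Longrightarrow> (\<Oplus>\<^bsub>tensor_ring i j\<^esub>a\<in>A. pure_tensor i j (x a) (y a)) = tensor_sum i j A x y"
  by (simp add: tensor_sum_def pure_tensor_class finsum_tensor_class)

lemma tensor_sum_closed: "tensor_sum i j A x y \<in> carrier (tensor_ring i j)"
  by (simp add: tensor_sum_def tensor_class_simps)

lemma tensor_sum_singleton: "tensor_sum i j {a} x y = pure_tensor i j (x a) (y a)"
  by (simp add: tensor_sum_def pure_tensor_class)

lemma tensor_sum_reindex:
  "bij_betw g B A \<Longrightarrow> tensor_sum i j B (\<lambda>b. x (g b)) (\<lambda>b. y (g b)) = tensor_sum i j A x y"
  unfolding tensor_sum_def using sum.reindex_bij_betw[of g B A "\<lambda>a. frag_of (x a, y a)"] by simp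

lemma tensor_sum_Plus:
  "finite A \<Longrightarrow> finite C \<Longrightarrow> tensor_sum i j (A <+> C) (case_sum x u) (case_sum y t) =
     tensor_sum i j A x y \<oplus>\<^bsub>tensor_ring i j\<^esub> tensor_sum i j C u t"
  by (simp add: tensor_sum_def sum.Plus flip: tensor_class_simps(1))

lemma pair_ring_sum_left: "(\<Sum>a\<in>A. f a) \<star> g = (\<Sum>a\<in>A. f a \<star> g)"
  by (induction A rule: infinite_finite_induct) (simp_all add: pair_ring_mult_zero_left pair_ring_mult_add_left)

lemma pair_ring_sum_right: "g \<star> (\<Sum>a\<in>A. f a) = (\<Sum>a\<in>A. g \<star> f a)"
  using pair_ring_sum_left[of f A g] by (simp only: pair_ring_mult_commute[of g])

lemma tensor_sum_times:
  "tensor_sum i j (A \<times> B) (\<lambda>(a, b). x a * x' b) (\<lambda>(a, b). y a * y' b) =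
     tensor_sum i j A x y \<otimes>\<^bsub>tensor_ring i j\<^esub> tensor_sum i j B x' y'"
proof -
  have "(\<Sum>p\<in>A \<times> B. frag_of (case p of (a, b) \<Rightarrow> x a * x' b, case p of (a, b) \<Rightarrow> y a * y' b)) =
      (\<Sum>(a, b)\<in>A \<times> B. frag_of (x a, y a) \<star> frag_of (x' b, y' b))"
    by (rule sum.cong) auto
  also have "\<dots> = (\<Sum>a\<in>A. frag_of (x a, y a)) \<star> (\<Sum>b\<in>B. frag_of (x' b, y' b))"
    by (unfold pair_ring_sum_left, unfold pair_ring_sum_right, rule sum.cartesian_product[symmetric])
  finally show ?thesis by (simp add: tensor_sum_def tensor_class_simps(2))
qed

lemma tensor_sum_uminus:
  assumes "finite A"
  shows "tensor_sum i j A x (\<lambda>a. - y a) = \<ominus>\<^bsub>tensor_ring i j\<^esub> tensor_sum i j A x y"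
proof -
  interpret T: cring "tensor_ring i j" by (rule cring_tensor_ring)
  have "tensor_sum i j A x (\<lambda>a. - y a) \<oplus>\<^bsub>tensor_ring i j\<^esub> tensor_sum i j A x y = \<zero>\<^bsub>tensor_ring i j\<^esub>"
    using assms
  proof (induction A rule: finite_induct)
    case empty
    show ?case by (simp add: tensor_sum_def tensor_class_zero flip: tensor_class_simps(1))
  next
    case (insert a A)
    have ins: "tensor_sum i j (insert a A) x y = pure_tensor i j (x a) (y a) \<oplus>\<^bsub>tensor_ring i j\<^esub> tensor_sum i j A x y" for y
      using insert by (simp add: tensor_sum_def pure_tensor_class tensor_class_simps(1))
    have "tensor_sum i j (insert a A) x (\<lambda>a. - y a) \<oplus>\<^bsub>tensor_ring i j\<^esub> tensor_sum i j (insert a A) x y =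
      (pure_tensor i j (x a) (- y a) \<oplus>\<^bsub>tensor_ring i j\<^esub> pure_tensor i j (x a) (y a)) \<oplus>\<^bsub>tensor_ring i j\<^esub>
      (tensor_sum i j A x (\<lambda>a. - y a) \<oplus>\<^bsub>tensor_ring i j\<^esub> tensor_sum i j A x y)"
      unfolding ins by (simp add: tensor_sum_closed T.a_ac)
    then show ?case by (simp add: insert.IH pure_tensor_uminus_right T.l_neg)
  qed
  then show ?thesis using T.minus_equality tensor_sum_closed by metis
qed

lemma pure_tensor_sum_right:
  "finite A \<Longrightarrow> pure_tensor i j x (\<Sum>a\<in>A. f a) = (\<Oplus>\<^bsub>tensor_ring i j\<^esub>a\<in>A. pure_tensor i j x (f a))"
proof (induction A rule: finite_induct)
  interpret T: cring "tensor_ring i j" by (rule cring_tensor_ring)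
  case empty
  show ?case by simp
next
  interpret T: cring "tensor_ring i j" by (rule cring_tensor_ring)
  case (insert a A)
  then show ?case by (simp add: T.finsum_insert pure_tensor_add_right Pi_def)
qed

locale standard_tensor = K: valued_ext i v w + L: valued_ext j v w'
  for i :: "'k::alg_closed_field \<Rightarrow> 'a::field" and j :: "'k \<Rightarrow> 'b::field"
    and v :: "'k \<Rightarrow> real" and w :: "'a \<Rightarrow> real" and w' :: "'b \<Rightarrow> real"
begin

sublocale T: cring "tensor_ring i j" by (rule cring_tensor_ring)

abbreviation "A \<equiv> tensor_ring i j"
abbreviation "N \<equiv> tensor_seminorm i j w w'"

definition presentations :: "nat \<Rightarrow> ('a \<times> 'b \<Rightarrow>\<^sub>0 int) set \<Rightarrow> ((nat \<Rightarrow> 'a) \<times> (nat \<Rightarrow> 'b)) set" where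
  "presentations n z = {(x, y). z = tensor_sum i j {..<n} x y}"

definition cost :: "nat \<Rightarrow> (nat \<Rightarrow> 'a) \<times> (nat \<Rightarrow> 'b) \<Rightarrow> real" where
  "cost n p = Max ((\<lambda>m. w (fst p m) * w' (snd p m)) ` {..<n})"

lemma cost_less_iff: "0 < n \<Longrightarrow> cost n (x, y) < r \<longleftrightarrow> (\<forall>m<n. w (x m) * w' (y m) < r)"
  unfolding cost_def by (subst Max_less_iff) auto

lemma cost_nonneg: assumes "0 < n" shows "0 \<le> cost n p"
proof -
  have "w (fst p 0) * w' (snd p 0) \<le> cost n p" unfolding cost_def using assms by (intro Max_ge) auto
  then show ?thesis by (rule order_trans[rotated]) simp
qed

lemma seminorm_altdef: "N z = Inf {cost n p | n p. 0 < n \<and> p \<in> presentations n z}"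
  unfolding tensor_seminorm_def cost_def presentations_def
  by (rule arg_cong[where f = Inf]) (auto simp: finsum_pure_tensor)

lemma presentations_nonempty:
  assumes "z \<in> carrier A" shows "\<exists>n p. 0 < n \<and> p \<in> presentations n z"
  using tensor_presentation[OF assms] by (auto simp: presentations_def finsum_pure_tensor)

lemma seminorm_bdd: "bdd_below {cost n p | n p. 0 < n \<and> p \<in> presentations n z}"
  by (rule bdd_belowI[of _ 0]) (auto simp: cost_nonneg)

lemma seminorm_less_iff:
  assumes "z \<in> carrier A"
  shows "N z < r \<longleftrightarrow> (\<exists>(n::nat) x y. 0 < n \<and> z = tensor_sum i j {..<n} x y \<and> (\<forall>m<n. w (x m) * w' (y m) < r))"
proof -
  have "N z < r \<longleftrightarrow> (\<exists>c\<in>{cost n p | n p. 0 < n \<and> p \<in> presentations n z}. c < r)"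
    unfolding seminorm_altdef
    by (rule cInf_less_iff) (use presentations_nonempty[OF assms] seminorm_bdd in auto)
  also have "\<dots> \<longleftrightarrow> (\<exists>n x y. 0 < n \<and> (x, y) \<in> presentations n z \<and> cost n (x, y) < r)" by auto
  finally show ?thesis by (simp add: presentations_def cost_less_iff cong: conj_cong)
qed

lemma seminorm_lessE:
  assumes "z \<in> carrier A" "N z < r"
  obtains n :: nat and x y where "z = tensor_sum i j {..<n} x y" "\<forall>m<n. w (x m) * w' (y m) < r"
  using assms(2) unfolding seminorm_less_iff[OF assms(1)] by blast

lemma seminorm_nonneg: "z \<in> carrier A \<Longrightarrow> 0 \<le> N z"
  unfolding seminorm_altdef
  by (rule cInf_greatest) (use presentations_nonempty[of z] in \<open>auto simp: cost_nonneg\<close>)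

text \<open>The index set is renumbered by an initial segment of the naturals. The empty sum is
  replaced by the single term \<open>0 \<otimes> 0\<close>, and \<open>0 < r\<close> covers that
  case.\<close>

lemma seminorm_lessI:
  assumes "finite B" "\<And>b. b \<in> B \<Longrightarrow> w (x b) * w' (y b) < r" "0 < r"
  shows "N (tensor_sum i j B x y) < r"
proof (cases "B = {}")
  case True
  have "tensor_sum i j B x y = tensor_sum i j {..<1::nat} (\<lambda>_. 0) (\<lambda>_. 0)"
    unfolding lessThan_one tensor_sum_singleton by (simp add: True tensor_sum_def tensor_class_zero)
  then show ?thesis unfolding seminorm_less_iff[OF tensor_sum_closed]
    using assms(3) by (intro exI[of _ 1] exI[of _ "\<lambda>_. 0"]) simp
next
  case False
  obtain g where g: "bij_betw g {0..<card B} B" using ex_bij_betw_nat_finite[OF assms(1)] by blast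
  have "tensor_sum i j B x y = tensor_sum i j {..<card B} (\<lambda>b. x (g b)) (\<lambda>b. y (g b))"
    using tensor_sum_reindex[of g "{..<card B}" B i j x y] g by (simp add: atLeast0LessThan)
  moreover have "g m \<in> B" if "m < card B" for m using g that by (auto simp: bij_betw_def)
  moreover have "0 < card B" using False assms(1) by (simp add: card_gt_0_iff)
  ultimately show ?thesis unfolding seminorm_less_iff[OF tensor_sum_closed] using assms(2) by metis
qed

lemma seminorm_pure_le: "N (pure_tensor i j x y) \<le> w x * w' y"
proof (rule dense_ge)
  fix r assume r: "w x * w' y < r"
  have "0 \<le> w x * w' y" by simp
  then have "0 < r" using r by linarith
  then have "N (tensor_sum i j {()} (\<lambda>_. x) (\<lambda>_. y)) < r" using r by (intro seminorm_lessI) auto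
  then show "N (pure_tensor i j x y) \<le> r" by (simp add: tensor_sum_singleton)
qed

lemma seminorm_add:
  assumes z: "z \<in> carrier A" and z': "z' \<in> carrier A"
  shows "N (z \<oplus>\<^bsub>A\<^esub> z') \<le> max (N z) (N z')"
proof (rule dense_ge)
  fix r assume r: "max (N z) (N z') < r"
  then have r0: "0 < r" using seminorm_nonneg[OF z] by auto
  have "N z < r" using r by simp
  then obtain n :: nat and x y where x: "z = tensor_sum i j {..<n} x y" "\<forall>m<n. w (x m) * w' (y m) < r"
    by (rule seminorm_lessE[OF z])
  have "N z' < r" using r by simp
  then obtain n' :: nat and x' y' where x': "z' = tensor_sum i j {..<n'} x' y'" "\<forall>m<n'. w (x' m) * w' (y' m) < r"
    by (rule seminorm_lessE[OF z'])
  have "z \<oplus>\<^bsub>A\<^esub> z' = tensor_sum i j ({..<n} <+> {..<n'}) (case_sum x x') (case_sum y y')"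
    by (simp add: tensor_sum_Plus x x')
  also have "N \<dots> < r" by (rule seminorm_lessI) (use x(2) x'(2) r0 in auto)
  finally show "N (z \<oplus>\<^bsub>A\<^esub> z') \<le> r" by simp
qed

lemma seminorm_uminus:
  assumes z: "z \<in> carrier A" shows "N (\<ominus>\<^bsub>A\<^esub> z) = N z"
proof -
  have "N (\<ominus>\<^bsub>A\<^esub> z) \<le> N z" if z: "z \<in> carrier A" for z
  proof (rule dense_ge)
    fix r assume r: "N z < r"
    then have r0: "0 < r" using seminorm_nonneg[OF z] by simp
    have "N z < r" using r by simp
    then obtain n :: nat and x y where x: "z = tensor_sum i j {..<n} x y" "\<forall>m<n. w (x m) * w' (y m) < r"
      by (rule seminorm_lessE[OF z])
    have "\<ominus>\<^bsub>A\<^esub> z = tensor_sum i j {..<n} x (\<lambda>m. - y m)" by (simp add: x tensor_sum_uminus)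
    also have "N \<dots> < r" by (rule seminorm_lessI) (use x(2) r0 in auto)
    finally show "N (\<ominus>\<^bsub>A\<^esub> z) \<le> r" by simp
  qed
  from this[OF z] this[of "\<ominus>\<^bsub>A\<^esub> z"] show ?thesis using z by simp
qed

lemma seminorm_mult_le:
  assumes z: "z \<in> carrier A" and z': "z' \<in> carrier A"
  shows "N (z \<otimes>\<^bsub>A\<^esub> z') \<le> N z * N z'"
proof (rule ccontr)
  assume "\<not> ?thesis"
  then have less: "N z * N z' < N (z \<otimes>\<^bsub>A\<^esub> z')" by simp
  note nonneg = seminorm_nonneg[OF z] seminorm_nonneg[OF z']
  \<comment> \<open>This \<open>e\<close> is small enough for \<open>(N z + e) * (N z' + e)\<close>
    to stay at most the norm of the product; the cap 1 bounds the quadratic term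
    \<open>e * e\<close> by \<open>e\<close>.\<close>
  define e where "e = min 1 ((N (z \<otimes>\<^bsub>A\<^esub> z') - N z * N z') / (N z + N z' + 1))"
  have e: "0 < e" "e \<le> 1" using less nonneg by (auto simp: e_def)
  have "e * (N z + N z' + e) \<le> e * (N z + N z' + 1)" using e nonneg by (intro mult_left_mono) auto
  also have "\<dots> \<le> (N (z \<otimes>\<^bsub>A\<^esub> z') - N z * N z') / (N z + N z' + 1) * (N z + N z' + 1)"
    using nonneg by (intro mult_right_mono) (auto simp: e_def)
  also have "\<dots> = N (z \<otimes>\<^bsub>A\<^esub> z') - N z * N z'" using nonneg by simp
  finally have le: "(N z + e) * (N z' + e) \<le> N (z \<otimes>\<^bsub>A\<^esub> z')" by (simp add: algebra_simps)
  have "N z < N z + e" using e by simp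
  then obtain n :: nat and x y where x: "z = tensor_sum i j {..<n} x y" "\<forall>m<n. w (x m) * w' (y m) < N z + e"
    by (rule seminorm_lessE[OF z])
  have "N z' < N z' + e" using e by simp
  then obtain n' :: nat and x' y' where x': "z' = tensor_sum i j {..<n'} x' y'" "\<forall>m<n'. w (x' m) * w' (y' m) < N z' + e"
    by (rule seminorm_lessE[OF z'])
  have zz': "z \<otimes>\<^bsub>A\<^esub> z' =
      tensor_sum i j ({..<n} \<times> {..<n'}) (\<lambda>(a, b). x a * x' b) (\<lambda>(a, b). y a * y' b)"
    unfolding tensor_sum_times x(1)[symmetric] x'(1)[symmetric] ..
  have "N (z \<otimes>\<^bsub>A\<^esub> z') < (N z + e) * (N z' + e)"
    unfolding zz'
  proof (rule seminorm_lessI)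
    show "0 < (N z + e) * (N z' + e)" using e nonneg by (intro mult_pos_pos) auto
    fix p assume "p \<in> {..<n} \<times> {..<n'}"
    then obtain a b where p: "p = (a, b)" "a < n" "b < n'" by auto
    have "(w (x a) * w' (y a)) * (w (x' b) * w' (y' b)) < (N z + e) * (N z' + e)"
      by (rule mult_strict_mono'[OF x(2)[rule_format, OF p(2)] x'(2)[rule_format, OF p(3)]]) simp_all
    then show "w (case p of (a, b) \<Rightarrow> x a * x' b) * w' (case p of (a, b) \<Rightarrow> y a * y' b) < (N z + e) * (N z' + e)"
      by (simp add: p ac_simps)
  qed simp
  then show False using le by simp
qed

text \<open>The scalar in each subtracted term is moved across the tensor sign; these terms then all
  have first factor \<open>x a0\<close> and are compensated together in the second factor at
  \<open>a0\<close>.\<close>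

lemma reduction_closed_presentations: "reduction_closed i j n (presentations n z)"
  unfolding reduction_closed_def presentations_def
proof (intro allI impI, unfold mem_Collect_eq case_prod_conv)
  fix x y a0 and \<beta> :: "nat \<Rightarrow> 'k" assume z: "z = tensor_sum i j {..<n} x y" and a0: "a0 < n" and \<beta>: "\<beta> a0 = 0"
  let ?p = "pure_tensor i j"
  define s where "s = (\<Sum>b<n. j (\<beta> b) * y b)"
  have summand: "?p (x a - i (\<beta> a) * x a0) (if a = a0 then y a0 + s else y a) =
      (?p (x a) (y a) \<oplus>\<^bsub>A\<^esub> ?p (x a0) (- (j (\<beta> a) * y a))) \<oplus>\<^bsub>A\<^esub> (if a0 = a then ?p (x a0) s else \<zero>\<^bsub>A\<^esub>)" for a
  proof (cases "a = a0")
    case True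
    then show ?thesis by (simp add: \<beta> K.hom_zero L.hom_zero pure_tensor_add_right)
  next
    case False
    have e: "x a - i (\<beta> a) * x a0 = x a + i (- \<beta> a) * x a0" by (simp add: K.hom_uminus)
    have "?p (x a - i (\<beta> a) * x a0) (y a) = ?p (x a) (y a) \<oplus>\<^bsub>A\<^esub> ?p (x a0) (j (- \<beta> a) * y a)"
      unfolding e pure_tensor_add_left pure_tensor_scale ..
    then show ?thesis using False by (simp add: L.hom_uminus)
  qed
  have "tensor_sum i j {..<n} (\<lambda>a. x a - i (\<beta> a) * x a0) (\<lambda>a. if a = a0 then y a0 + s else y a) =
      (\<Oplus>\<^bsub>A\<^esub>a\<in>{..<n}. (?p (x a) (y a) \<oplus>\<^bsub>A\<^esub> ?p (x a0) (- (j (\<beta> a) * y a))) \<oplus>\<^bsub>A\<^esub> (if a0 = a then ?p (x a0) s else \<zero>\<^bsub>A\<^esub>))"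
    by (simp only: finsum_pure_tensor[OF finite_lessThan, symmetric] summand)
  also have "\<dots> = (\<Oplus>\<^bsub>A\<^esub>a\<in>{..<n}. ?p (x a) (y a)) \<oplus>\<^bsub>A\<^esub> (\<Oplus>\<^bsub>A\<^esub>a\<in>{..<n}. ?p (x a0) (- (j (\<beta> a) * y a))) \<oplus>\<^bsub>A\<^esub>
      (\<Oplus>\<^bsub>A\<^esub>a\<in>{..<n}. if a0 = a then ?p (x a0) s else \<zero>\<^bsub>A\<^esub>)"
    by (simp add: T.finsum_addf Pi_def)
  also have "(\<Oplus>\<^bsub>A\<^esub>a\<in>{..<n}. if a0 = a then ?p (x a0) s else \<zero>\<^bsub>A\<^esub>) = ?p (x a0) s"
    using T.finsum_singleton[of a0 "{..<n}" "\<lambda>_. ?p (x a0) s"] a0 by simp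
  also have "(\<Oplus>\<^bsub>A\<^esub>a\<in>{..<n}. ?p (x a0) (- (j (\<beta> a) * y a))) = ?p (x a0) (- s)"
    unfolding s_def sum_negf[symmetric] by (simp only: pure_tensor_sum_right[OF finite_lessThan])
  also have "(\<Oplus>\<^bsub>A\<^esub>a\<in>{..<n}. ?p (x a) (y a)) = z" by (simp add: z finsum_pure_tensor)
  also have "z \<oplus>\<^bsub>A\<^esub> ?p (x a0) (- s) \<oplus>\<^bsub>A\<^esub> ?p (x a0) s = z"
    using z tensor_sum_closed[of i j "{..<n}" x y] pure_tensor_add_right[of i j "x a0" "- s" s]
    by (simp add: T.a_assoc)
  finally show "z = tensor_sum i j {..<n} (\<lambda>a. x a - i (\<beta> a) * x a0)
      (\<lambda>a. if a = a0 then y a0 + (\<Sum>b<n. j (\<beta> b) * y b) else y a)"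
    unfolding s_def ..
qed

text \<open>The number of terms of an arbitrary presentation is frozen. The resulting infimum
  \<open>s\<close> might a priori exceed the seminorm; the inequality \<open>N z \<le> s\<close> is
  the direction used for the lower bound on products, and it also makes \<open>s\<close>
  positive.\<close>

lemma optimal_presentations:
  assumes z: "z \<in> carrier A" and pos: "0 < N z"
  obtains n s where "minimal_cost w w' n (presentations n z) s" "N z \<le> s"
proof -
  obtain n p where n: "0 < n" "p \<in> presentations n z" using presentations_nonempty[OF z] by blast
  define s where "s = Inf (cost n ` presentations n z)"
  have bdd: "bdd_below (cost n ` presentations n z)"
    by (rule bdd_belowI[of _ 0]) (use cost_nonneg n in auto)
  have s: "s \<le> cost n q" if "q \<in> presentations n z" for q
    unfolding s_def using bdd that by (intro cInf_lower) auto
  have Ns: "N z \<le> s"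
    unfolding s_def
  proof (rule cInf_greatest)
    show "cost n ` presentations n z \<noteq> {}" using n by blast
    fix c assume "c \<in> cost n ` presentations n z"
    then show "N z \<le> c" unfolding seminorm_altdef using n(1) seminorm_bdd by (intro cInf_lower) auto
  qed
  show ?thesis
  proof (rule that[OF _ Ns], unfold minimal_cost_def, intro conjI allI impI)
    show "0 < s" using pos Ns by simp
    fix x y assume "(x, y) \<in> presentations n z"
    then have "\<not> cost n (x, y) < s" using s by force
    then show "\<exists>a<n. s \<le> w (x a) * w' (y a)" using n(1) by (force simp: cost_less_iff)
  next
    fix e :: real assume e: "0 < e"
    have "s < s * (1 + e)" using pos Ns e by (simp add: algebra_simps)
    then obtain x y where "(x, y) \<in> presentations n z" "cost n (x, y) < s * (1 + e)"
      using cInf_less_iff[of "cost n ` presentations n z" "s * (1 + e)"] n bdd by (force simp: s_def)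
    then show "\<exists>x y. (x, y) \<in> presentations n z \<and> (\<forall>a<n. w (x a) * w' (y a) \<le> s * (1 + e))"
      using n(1) by (force simp: cost_less_iff)
  qed
qed

lemma tensor_null_difference:
  assumes "finite B" "finite C" "tensor_sum i j B f h = tensor_sum i j C u t"
  shows "tensor_null i j (B <+> C) (case_sum f u) (case_sum h (\<lambda>c. - t c))"
proof (rule tensor_null_of_sum_zero)
  show "finite (B <+> C)" using assms by simp
  then show "(\<Oplus>\<^bsub>tensor_ring i j\<^esub>a\<in>B <+> C. pure_tensor i j (case_sum f u a) (case_sum h (\<lambda>c. - t c) a)) = \<zero>\<^bsub>tensor_ring i j\<^esub>"
    using assms by (simp add: finsum_pure_tensor tensor_sum_Plus tensor_sum_uminus tensor_sum_closed T.r_neg)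
qed unfold_locales

text \<open>A failure gives a presentation of the product whose terms are all smaller than
  \<open>N z * N z'\<close>, hence smaller than \<open>s * s'\<close>. This contradicts
  \<open>tensor_product_bound\<close>, whose set \<open>C\<close> consists of these terms with
  negated second factors.\<close>

lemma seminorm_mult_ge:
  assumes z: "z \<in> carrier A" and z': "z' \<in> carrier A"
  shows "N z * N z' \<le> N (z \<otimes>\<^bsub>A\<^esub> z')"
proof (rule ccontr)
  assume "\<not> ?thesis"
  then have less: "N (z \<otimes>\<^bsub>A\<^esub> z') < N z * N z'" by simp
  have zz': "z \<otimes>\<^bsub>A\<^esub> z' \<in> carrier A" using z z' by simp
  have "0 < N z * N z'" using less seminorm_nonneg[OF zz'] by simp
  then have pos: "0 < N z" "0 < N z'"
    using seminorm_nonneg[OF z] seminorm_nonneg[OF z'] by (auto simp: zero_less_mult_iff)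
  obtain q :: nat and u t where u: "z \<otimes>\<^bsub>A\<^esub> z' = tensor_sum i j {..<q} u t"
    "\<forall>m<q. w (u m) * w' (t m) < N z * N z'"
    by (rule seminorm_lessE[OF zz' less])
  show False
  proof (rule optimal_presentations[OF z pos(1)], rule optimal_presentations[OF z' pos(2)])
    fix n s n' s'
    assume s: "minimal_cost w w' n (presentations n z) s" "N z \<le> s"
    assume s': "minimal_cost w w' n' (presentations n' z') s'" "N z' \<le> s'"
    have "\<exists>c\<in>{..<q}. s * s' \<le> w (u c) * w' (- t c)"
    proof (rule tensor_product_bound[OF K.valued_ext_axioms L.valued_ext_axioms
          reduction_closed_presentations s(1) reduction_closed_presentations s'(1) finite_lessThan])
      fix x y x' y' assume "(x, y) \<in> presentations n z" "(x', y') \<in> presentations n' z'"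
      then have "tensor_sum i j ({..<n} \<times> {..<n'}) (\<lambda>(a, b). x a * x' b) (\<lambda>(a, b). y a * y' b) = tensor_sum i j {..<q} u t"
        by (simp add: tensor_sum_times presentations_def flip: u(1))
      then show "tensor_null i j (({..<n} \<times> {..<n'}) <+> {..<q})
          (case_sum (\<lambda>(a, b). x a * x' b) u) (case_sum (\<lambda>(a, b). y a * y' b) (\<lambda>c. - t c))"
        by (intro tensor_null_difference) simp_all
    qed
    then obtain c where c: "c < q" "s * s' \<le> w (u c) * w' (t c)" by auto
    have "N z * N z' \<le> s * s'" using s(2) s'(2) pos by (intro mult_mono) auto
    then show False using u(2) c by fastforce
  qed
qed

lemma seminorm_mult: "z \<in> carrier A \<Longrightarrow> z' \<in> carrier A \<Longrightarrow> N (z \<otimes>\<^bsub>A\<^esub> z') = N z * N z'"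
  by (intro antisym seminorm_mult_le seminorm_mult_ge)

text \<open>Multiplicativity alone would allow the seminorm to vanish identically, so the lower
  bound requires its own application of \<open>tensor_product_bound\<close>.\<close>

lemma seminorm_one: "N \<one>\<^bsub>A\<^esub> = 1"
proof (rule antisym)
  show "N \<one>\<^bsub>A\<^esub> \<le> 1" using seminorm_pure_le[of 1 1] by (simp add: pure_tensor_one)
  show "1 \<le> N \<one>\<^bsub>A\<^esub>"
  proof (rule ccontr)
    assume "\<not> ?thesis"
    then have "N \<one>\<^bsub>A\<^esub> < 1" by simp
    then obtain q :: nat and u t where u: "\<one>\<^bsub>A\<^esub> = tensor_sum i j {..<q} u t" "\<forall>m<q. w (u m) * w' (t m) < 1"
      by (rule seminorm_lessE[OF T.one_closed])
    \<comment> \<open>Instead of all one-term presentations of the unit, whose least cost is not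
      known at this point, only \<open>1 \<otimes> 1\<close> is taken. This family is closed under
      elimination, because the single coefficient \<open>\<beta> 0\<close> is 0, and its cost is
      1.\<close>
    let ?S = "{(x, y). x 0 = 1 \<and> y 0 = 1} :: ((nat \<Rightarrow> 'a) \<times> (nat \<Rightarrow> 'b)) set"
    have red: "reduction_closed i j 1 ?S"
      by (auto simp: reduction_closed_def K.hom_zero L.hom_zero)
    have min: "minimal_cost w w' 1 ?S 1"
      by (auto simp: minimal_cost_def intro!: exI[of _ "\<lambda>_. 1"])
    have "\<exists>c\<in>{..<q}. 1 * 1 \<le> w (u c) * w' (- t c)"
    proof (rule tensor_product_bound[OF K.valued_ext_axioms L.valued_ext_axioms
          red min red min finite_lessThan])
      fix x y x' y' assume "(x, y) \<in> ?S" "(x', y') \<in> ?S"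
      then have "tensor_sum i j ({..<1::nat} \<times> {..<1::nat}) (\<lambda>(a, b). x a * x' b) (\<lambda>(a, b). y a * y' b) = tensor_sum i j {..<q} u t"
        unfolding tensor_sum_times lessThan_one tensor_sum_singleton by (simp add: pure_tensor_one flip: u(1))
      then show "tensor_null i j (({..<1::nat} \<times> {..<1::nat}) <+> {..<q})
          (case_sum (\<lambda>(a, b). x a * x' b) u) (case_sum (\<lambda>(a, b). y a * y' b) (\<lambda>c. - t c))"
        by (intro tensor_null_difference) simp_all
    qed
    then show False using u(2) by force
  qed
qed

text \<open>The lower bound comes from multiplicativity: a nonzero pure tensor is inverted by the
  tensor of the inverses, whose seminorm has the evident upper bound.\<close>

lemma seminorm_pure: "N (pure_tensor i j x y) = w x * w' y"
proof (cases "x = 0 \<or> y = 0")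
  case True
  then show ?thesis using seminorm_pure_le[of x y] seminorm_nonneg[OF pure_tensor_closed[of i j x y]] by auto
next
  case False
  have "pure_tensor i j x y \<otimes>\<^bsub>A\<^esub> pure_tensor i j (inverse x) (inverse y) = \<one>\<^bsub>A\<^esub>"
    using False by (simp add: pure_tensor_mult pure_tensor_one)
  then have "N (pure_tensor i j x y) * N (pure_tensor i j (inverse x) (inverse y)) = 1"
    using seminorm_mult[OF pure_tensor_closed pure_tensor_closed, of x y "inverse x" "inverse y"] seminorm_one by simp
  moreover have "N (pure_tensor i j x y) * N (pure_tensor i j (inverse x) (inverse y)) \<le>
      N (pure_tensor i j x y) * (inverse (w x) * inverse (w' y))"
    using seminorm_pure_le[of "inverse x" "inverse y"] seminorm_nonneg[OF pure_tensor_closed[of i j x y]]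
    by (intro mult_left_mono) auto
  ultimately have "1 \<le> N (pure_tensor i j x y) / (w x * w' y)" by (simp add: field_simps)
  then have "w x * w' y \<le> N (pure_tensor i j x y)" using False by (simp add: field_simps)
  then show ?thesis using seminorm_pure_le[of x y] by simp
qed

section \<open>The kernel and the norm on the quotient\<close>

abbreviation "I \<equiv> tensor_kernel i j w w'"

lemma kernel_iff: "z \<in> I \<longleftrightarrow> z \<in> carrier A \<and> N z = 0"
  by (simp add: tensor_kernel_def)

lemma primeideal_kernel: "primeideal I A"
proof (rule primeidealI)
  show "ideal I A"
  proof (rule idealI)
    show "subgroup I (add_monoid A)"
    proof (rule T.add.subgroupI)
      show "I \<subseteq> carrier A" by (auto simp: kernel_iff)
      have "\<zero>\<^bsub>A\<^esub> \<in> I" using seminorm_pure[of 0 0] by (simp add: kernel_iff)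
      then show "I \<noteq> {}" by blast
    next
      fix x assume "x \<in> I"
      then show "\<ominus>\<^bsub>A\<^esub> x \<in> I" by (simp add: kernel_iff seminorm_uminus)
    next
      fix x y assume "x \<in> I" "y \<in> I"
      then show "x \<oplus>\<^bsub>A\<^esub> y \<in> I"
        using seminorm_add[of x y] seminorm_nonneg[of "x \<oplus>\<^bsub>A\<^esub> y"] by (simp add: kernel_iff)
    qed
    show "ring A" by (rule T.ring_axioms)
  qed (simp_all add: kernel_iff seminorm_mult)
  show "carrier A \<noteq> I" 
  proof
    assume "carrier A = I"
    then have "\<one>\<^bsub>A\<^esub> \<in> I" using T.one_closed by blast
    then show False by (simp add: kernel_iff seminorm_one)
  qed
  show "cring A" by (rule T.is_cring)
  show "a \<in> I \<or> b \<in> I" if "a \<in> carrier A" "b \<in> carrier A" "a \<otimes>\<^bsub>A\<^esub> b \<in> I" for a b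
    using that by (simp add: kernel_iff seminorm_mult)
qed

text \<open>The ultrametric inequality, used in both directions, makes the seminorm constant on
  cosets of its kernel, so any representative may be chosen.\<close>

lemma quotient_norm:
  obtains N' where
    "\<And>z. z \<in> carrier A \<Longrightarrow> N' (I +>\<^bsub>A\<^esub> z) = N z"
    "\<And>a. a \<in> carrier (A Quot I) \<Longrightarrow> 0 \<le> N' a"
    "\<And>a. a \<in> carrier (A Quot I) \<Longrightarrow> N' a = 0 \<longleftrightarrow> a = \<zero>\<^bsub>A Quot I\<^esub>"
    "\<And>a b. a \<in> carrier (A Quot I) \<Longrightarrow> b \<in> carrier (A Quot I) \<Longrightarrow> N' (a \<otimes>\<^bsub>A Quot I\<^esub> b) = N' a * N' b"
    "\<And>a b. a \<in> carrier (A Quot I) \<Longrightarrow> b \<in> carrier (A Quot I) \<Longrightarrow> N' (a \<oplus>\<^bsub>A Quot I\<^esub> b) \<le> max (N' a) (N' b)"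
proof -
  interpret I: primeideal I A by (rule primeideal_kernel)
  define N' where "N' c = N (SOME z. z \<in> c)" for c
  have N': "N' (I +>\<^bsub>A\<^esub> z) = N z" if z: "z \<in> carrier A" for z
  proof -
    define z' where "z' = (SOME z'. z' \<in> I +>\<^bsub>A\<^esub> z)"
    have "z' \<in> I +>\<^bsub>A\<^esub> z" unfolding z'_def by (rule someI[of _ z]) (rule I.a_rcos_self[OF z])
    then obtain h where h: "h \<in> I" "z' = h \<oplus>\<^bsub>A\<^esub> z" by (auto simp: a_r_coset_def')
    have hA: "h \<in> carrier A" "N h = 0" using h by (auto simp: kernel_iff)
    have z'A: "z' \<in> carrier A" using h z hA by simp
    have "N z' \<le> N z" using seminorm_add[OF hA(1) z] seminorm_nonneg[OF z] by (simp add: h hA)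
    moreover have "z = \<ominus>\<^bsub>A\<^esub> h \<oplus>\<^bsub>A\<^esub> z'" using h z hA by (simp add: T.a_assoc[symmetric] T.l_neg)
    then have "N z \<le> N z'"
      using seminorm_add[of "\<ominus>\<^bsub>A\<^esub> h" z'] seminorm_nonneg[OF z'A] hA z'A by (simp add: seminorm_uminus)
    ultimately show ?thesis by (simp add: N'_def flip: z'_def)
  qed
  have E: "\<exists>z. z \<in> carrier A \<and> a = I +>\<^bsub>A\<^esub> z" if "a \<in> carrier (A Quot I)" for a
    using that unfolding FactRing_def A_RCOSETS_def' by auto
  note hom = I.rcos_ring_hom
  have zero: "I +>\<^bsub>A\<^esub> z = \<zero>\<^bsub>A Quot I\<^esub> \<longleftrightarrow> z \<in> I" if "z \<in> carrier A" for z
    using T.a_coset_join1[of I z] T.a_coset_join2[of z I] that I.a_subgroup by (auto simp: FactRing_def)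
  show ?thesis
  proof (rule that[OF N'])
    fix a assume "a \<in> carrier (A Quot I)"
    then obtain z where z: "z \<in> carrier A" "a = I +>\<^bsub>A\<^esub> z" using E by blast
    show "0 \<le> N' a" using z by (simp add: N' seminorm_nonneg)
    show "N' a = 0 \<longleftrightarrow> a = \<zero>\<^bsub>A Quot I\<^esub>" using z by (simp add: N' zero kernel_iff)
    fix b assume "b \<in> carrier (A Quot I)"
    then obtain z' where z': "z' \<in> carrier A" "b = I +>\<^bsub>A\<^esub> z'" using E by blast
    show "N' (a \<otimes>\<^bsub>A Quot I\<^esub> b) = N' a * N' b"
      using z z' ring_hom_mult[OF hom z(1) z'(1)] by (simp add: N' seminorm_mult flip: ring_hom_mult[OF hom])
    show "N' (a \<oplus>\<^bsub>A Quot I\<^esub> b) \<le> max (N' a) (N' b)"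
      using z z' by (simp add: N' seminorm_add flip: ring_hom_add[OF hom])
  qed
qed

end

section \<open>Valued fields given by types, and the conclusion\<close>

lemma standard_valued_field_type:
  "standard_valued_field (ring_of_type_algebra :: 'a::field ring) v \<longleftrightarrow> valued v"
  using field_from_type_algebra
  by (auto simp: standard_valued_field_def standard_valued_field_axioms_def valued_def
      ring_of_type_algebra_def le_max_iff_disj)

lemma standard_extension_type:
  assumes "standard_extension i (ring_of_type_algebra :: 'a::field ring) v (ring_of_type_algebra :: 'b::field ring) w"
  shows "valued_ext i v w"
proof -
  have "field_hom i"
    using assms by (auto simp: standard_extension_def field_hom_def ring_hom_def ring_of_type_algebra_def)
  then show ?thesis using assms
    by (simp add: valued_ext_def valued_ext_axioms_def standard_extension_def standard_valued_field_type)
      (simp add: ring_of_type_algebra_def)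
qed

theorem theorem9:
  fixes vk :: "'k::alg_closed_field \<Rightarrow> real"
    and vK :: "'K::field \<Rightarrow> real"
    and vL :: "'L::field \<Rightarrow> real"
    and i :: "'k \<Rightarrow> 'K"
    and j :: "'k \<Rightarrow> 'L"
  assumes K: "standard_extension i ring_of_type_algebra vk ring_of_type_algebra vK"
    and L: "standard_extension j ring_of_type_algebra vk ring_of_type_algebra vL"
  defines "A \<equiv> tensor_ring i j"
    and "N \<equiv> tensor_seminorm i j vK vL"
    and "I \<equiv> tensor_kernel i j vK vL"
  defines "F \<equiv> fraction_field (A Quot I)"
    and "\<iota> \<equiv> \<lambda>z. fraction (A Quot I) (I +>\<^bsub>A\<^esub> z) \<one>\<^bsub>A Quot I\<^esub>"
  shows "(\<forall>z\<in>carrier A. \<forall>z'\<in>carrier A. N (z \<otimes>\<^bsub>A\<^esub> z') = N z * N z') \<and>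
    primeideal I A \<and>
    (\<exists>w. standard_valued_field F w \<and>
         (\<forall>z\<in>carrier A. w (\<iota> z) = N z) \<and>
         standard_extension (\<lambda>x. \<iota> (pure_tensor i j x 1)) ring_of_type_algebra vK F w \<and>
         standard_extension (\<lambda>y. \<iota> (pure_tensor i j 1 y)) ring_of_type_algebra vL F w)"
proof -
  interpret standard_tensor i j vk vK vL
    unfolding standard_tensor_def using standard_extension_type[OF K] standard_extension_type[OF L] ..
  interpret I: primeideal I A unfolding I_def A_def by (rule primeideal_kernel)
  interpret Q: domain "A Quot I" by (rule I.quotient_is_domain)
  obtain N' where N': "\<And>z. z \<in> carrier A \<Longrightarrow> N' (I +>\<^bsub>A\<^esub> z) = N z"
    "\<And>a. a \<in> carrier (A Quot I) \<Longrightarrow> 0 \<le> N' a"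
    "\<And>a. a \<in> carrier (A Quot I) \<Longrightarrow> N' a = 0 \<longleftrightarrow> a = \<zero>\<^bsub>A Quot I\<^esub>"
    "\<And>a b. a \<in> carrier (A Quot I) \<Longrightarrow> b \<in> carrier (A Quot I) \<Longrightarrow> N' (a \<otimes>\<^bsub>A Quot I\<^esub> b) = N' a * N' b"
    "\<And>a b. a \<in> carrier (A Quot I) \<Longrightarrow> b \<in> carrier (A Quot I) \<Longrightarrow> N' (a \<oplus>\<^bsub>A Quot I\<^esub> b) \<le> max (N' a) (N' b)"
    unfolding A_def I_def N_def by (rule quotient_norm) blast
  obtain w where w: "standard_valued_field F w" "\<And>a. a \<in> carrier (A Quot I) \<Longrightarrow> w (fraction (A Quot I) a \<one>\<^bsub>A Quot I\<^esub>) = N' a"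
    unfolding F_def using Q.fraction_field_valuation[OF N'(2-5)] by blast
  have \<iota>_hom: "\<iota> \<in> ring_hom A F"
    using ring_hom_trans[OF I.rcos_ring_hom Q.fraction_hom] by (simp add: \<iota>_def F_def comp_def)
  have w\<iota>: "w (\<iota> z) = N z" if "z \<in> carrier A" for z
    unfolding \<iota>_def using w(2) N'(1)[OF that] ring_hom_closed[OF I.rcos_ring_hom that] by simp
  have pure: "pure_tensor i j x y \<in> carrier A" for x y by (simp add: A_def)
  have "(\<lambda>x. pure_tensor i j x 1) \<in> ring_hom ring_of_type_algebra A"
    by (rule ring_hom_memI)
      (simp_all add: A_def ring_of_type_algebra_def pure_tensor_mult pure_tensor_add_left pure_tensor_one)
  then have hK: "(\<lambda>x. \<iota> (pure_tensor i j x 1)) \<in> ring_hom ring_of_type_algebra F"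
    using ring_hom_trans[OF _ \<iota>_hom] by (fastforce simp: comp_def)
  have "(\<lambda>y. pure_tensor i j 1 y) \<in> ring_hom ring_of_type_algebra A"
    by (rule ring_hom_memI)
      (simp_all add: A_def ring_of_type_algebra_def pure_tensor_mult pure_tensor_add_right pure_tensor_one)
  then have hL: "(\<lambda>y. \<iota> (pure_tensor i j 1 y)) \<in> ring_hom ring_of_type_algebra F"
    using ring_hom_trans[OF _ \<iota>_hom] by (fastforce simp: comp_def)
  have eK: "standard_extension (\<lambda>x. \<iota> (pure_tensor i j x 1)) ring_of_type_algebra vK F w"
    unfolding standard_extension_def standard_valued_field_type
    using K.valued_axioms w(1) hK w\<iota>[OF pure] seminorm_pure by (simp add: N_def)
  have eL: "standard_extension (\<lambda>y. \<iota> (pure_tensor i j 1 y)) ring_of_type_algebra vL F w"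
    unfolding standard_extension_def standard_valued_field_type
    using L.valued_axioms w(1) hL w\<iota>[OF pure] seminorm_pure by (simp add: N_def)
  have "N (z \<otimes>\<^bsub>A\<^esub> z') = N z * N z'" if "z \<in> carrier A" "z' \<in> carrier A" for z z'
    using seminorm_mult that by (simp add: A_def N_def)
  then show ?thesis using I.primeideal_axioms w(1) w\<iota> eK eL by blast
qed

end
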